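(* Let $\vartheta$ be a probability measure on $\mathbb{R}_+$ which has no atoms. Let $\overline{\vartheta}(x)=\vartheta([x,\infty))$, $a_\vartheta=\sup\{x\ge0:\overline{\vartheta}(x)=1\}$ and $b_\vartheta=\inf\{x\ge0:\overline{\vartheta}(x)=0\}$. Define $\psi_\vartheta$ on $[0,\infty)$ by $$\psi_\vartheta(x)=\int_{[0,x]}\frac{z}{\overline{\vartheta}(z)}\,d\vartheta(z)\quad (a_\vartheta\le x<b_\vartheta),$$ $\psi_\vartheta(x)=0$ for $0\le x<a_\vartheta$ and $\psi_\vartheta(x)=\infty$ for $x\ge b_\vartheta$, and let $\varphi_\vartheta(z)=\inf\{x\ge0:\psi_\vartheta(x)>z\}$ be its right-continuous inverse. Let $X=N+A$ be a local submartingale of class $(\Sigma)$, with only negative jumps and such that $A_\infty=\infty$. Then the stopping time $$T_\vartheta=\inf\{t\ge0:\ X_t\ge\varphi_\vartheta(A_t)\}$$ is almost surely finite and solves the Skorokhod embedding problem for $X$, i.e. the law of $X_{T_\vartheta}$ is $\vartheta$.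
   Context: All processes are defined on a filtered probability space; "increasing" means nondecreasing. A positive (i.e. nonnegative) local submartingale $X$ which decomposes as $X_t=N_t+A_t$ is of class $(\Sigma)$ if: (i) $(N_t)$ is a càdlàg local martingale with $N_0=0$; (ii) $(A_t)$ is a continuous increasing process with $A_0=0$; (iii) the measure $(dA_t)$ is carried by the set $\{t: X_t=0\}$. "Only negative jumps" means that all jumps of $X$ are negative (continuous $X$ is allowed). $A_\infty=\lim_{t\to\infty}A_t$.
   Formalization: Proved for T=inf{t≥0: 0<φ(A_t)≤X_t}: if a_ϑ=0 then φ(0)=0=X_0=A_0, so the stated T is 0 and X_T=0; for a_ϑ>0 both times agree. No usual conditions are assumed: T is a stopping time of the filtration augmented by null sets and X_T is measurable for the completion. *)

theory Defs
  imports "HOL-Probability.Probability"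
begin

section \<open>Filtered probability spaces and (local) martingales\<close>

text \<open>
  Processes are indexed by real times \<open>t \<ge> 0\<close>; values at negative times are never used.
  Filtrations are indexed by \<^typ>\<open>ennreal\<close>, so that the library's \<^const>\<open>stopping_time\<close> covers
  random times that may be infinite. The member \<open>F \<infinity>\<close> plays no role (\<open>T \<le> \<infinity>\<close> always holds).
  The usual conditions are not assumed.
\<close>

locale filtered_prob_space = prob_space M + filtration "space M" F
  for M :: "'a measure" and F :: "ennreal \<Rightarrow> 'a measure" +
  assumes subalgebra_F: "\<And>t. subalgebra M (F t)"

definition adapted :: "(ennreal \<Rightarrow> 'a measure) \<Rightarrow> (real \<Rightarrow> 'a \<Rightarrow> real) \<Rightarrow> bool" where
  "adapted F X \<longleftrightarrow> (\<forall>t\<ge>0. X t \<in> borel_measurable (F (ennreal t)))"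

definition martingale ::
  "'a measure \<Rightarrow> (ennreal \<Rightarrow> 'a measure) \<Rightarrow> (real \<Rightarrow> 'a \<Rightarrow> real) \<Rightarrow> bool" where
  "martingale M F X \<longleftrightarrow> adapted F X \<and> (\<forall>t\<ge>0. integrable M (X t)) \<and>
     (\<forall>s t. 0 \<le> s \<and> s \<le> t \<longrightarrow> (AE \<omega> in M. real_cond_exp M (F (ennreal s)) (X t) \<omega> = X s \<omega>))"

definition submartingale ::
  "'a measure \<Rightarrow> (ennreal \<Rightarrow> 'a measure) \<Rightarrow> (real \<Rightarrow> 'a \<Rightarrow> real) \<Rightarrow> bool" where
  "submartingale M F X \<longleftrightarrow> adapted F X \<and> (\<forall>t\<ge>0. integrable M (X t)) \<and>
     (\<forall>s t. 0 \<le> s \<and> s \<le> t \<longrightarrow> (AE \<omega> in M. X s \<omega> \<le> real_cond_exp M (F (ennreal s)) (X t) \<omega>))"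

definition stopped :: "(real \<Rightarrow> 'a \<Rightarrow> real) \<Rightarrow> ('a \<Rightarrow> ennreal) \<Rightarrow> real \<Rightarrow> 'a \<Rightarrow> real" where
  "stopped X T t \<omega> = X (enn2real (min (ennreal t) (T \<omega>))) \<omega>"

definition localizing ::
  "'a measure \<Rightarrow> (ennreal \<Rightarrow> 'a measure) \<Rightarrow> (nat \<Rightarrow> 'a \<Rightarrow> ennreal) \<Rightarrow> bool" where
  "localizing M F \<tau> \<longleftrightarrow> (\<forall>n. stopping_time F (\<tau> n)) \<and>
     (AE \<omega> in M. incseq (\<lambda>n. \<tau> n \<omega>) \<and> (\<lambda>n. \<tau> n \<omega>) \<longlonglongrightarrow> \<infinity>)"

text \<open>
  The processes localized below all vanish at time 0, so there is no need to subtract the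
  initial value (or to multiply by the indicator of \<open>\<tau> n > 0\<close>) before stopping.
\<close>

definition local_martingale ::
  "'a measure \<Rightarrow> (ennreal \<Rightarrow> 'a measure) \<Rightarrow> (real \<Rightarrow> 'a \<Rightarrow> real) \<Rightarrow> bool" where
  "local_martingale M F X \<longleftrightarrow> adapted F X \<and>
     (\<exists>\<tau>. localizing M F \<tau> \<and> (\<forall>n. martingale M F (stopped X (\<tau> n))))"

definition local_submartingale ::
  "'a measure \<Rightarrow> (ennreal \<Rightarrow> 'a measure) \<Rightarrow> (real \<Rightarrow> 'a \<Rightarrow> real) \<Rightarrow> bool" where
  "local_submartingale M F X \<longleftrightarrow> adapted F X \<and>
     (\<exists>\<tau>. localizing M F \<tau> \<and> (\<forall>n. submartingale M F (stopped X (\<tau> n))))"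

text \<open>
  The filtration augmented by the subsets of \<open>M\<close>-null sets; it has the same \<open>\<sigma>\<close>-algebras as
  \<open>F\<close> if \<open>F\<close> is complete.
\<close>

definition augmented :: "'a measure \<Rightarrow> (ennreal \<Rightarrow> 'a measure) \<Rightarrow> ennreal \<Rightarrow> 'a measure" where
  "augmented M F t = sigma (space M) (sets (F t) \<union> null_sets (completion M))"


section \<open>Path properties and the class \<open>(\<Sigma>)\<close>\<close>

definition cadlag :: "(real \<Rightarrow> real) \<Rightarrow> bool" where
  "cadlag f \<longleftrightarrow> (\<forall>t\<ge>0. continuous (at_right t) f) \<and> (\<forall>t>0. \<exists>l. (f \<longlongrightarrow> l) (at_left t))"

definition jump :: "(real \<Rightarrow> real) \<Rightarrow> real \<Rightarrow> real" where
  "jump f t = f t - Lim (at_left t) f"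

definition only_negative_jumps :: "'a measure \<Rightarrow> (real \<Rightarrow> 'a \<Rightarrow> real) \<Rightarrow> bool" where
  "only_negative_jumps M X \<longleftrightarrow> (AE \<omega> in M. \<forall>t>0. jump (\<lambda>s. X s \<omega>) t \<le> 0)"

text \<open>
  \<open>class_Sigma M F X N A\<close>: \<open>X\<close> is of class \<open>(\<Sigma>)\<close> with decomposition \<open>X = N + A\<close>. The path
  \<open>A\<close>, which starts at 0, is extended by 0 to negative times to form the measure \<open>dA\<close>.
\<close>

definition class_Sigma ::
  "'a measure \<Rightarrow> (ennreal \<Rightarrow> 'a measure) \<Rightarrow> (real \<Rightarrow> 'a \<Rightarrow> real) \<Rightarrow> (real \<Rightarrow> 'a \<Rightarrow> real)
     \<Rightarrow> (real \<Rightarrow> 'a \<Rightarrow> real) \<Rightarrow> bool" where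
  "class_Sigma M F X N A \<longleftrightarrow>
     local_submartingale M F X \<and> (AE \<omega> in M. \<forall>t\<ge>0. X t \<omega> \<ge> 0) \<and>
     (AE \<omega> in M. \<forall>t\<ge>0. X t \<omega> = N t \<omega> + A t \<omega>) \<and>
     local_martingale M F N \<and> (AE \<omega> in M. cadlag (\<lambda>t. N t \<omega>)) \<and> (AE \<omega> in M. N 0 \<omega> = 0) \<and>
     adapted F A \<and> (AE \<omega> in M. continuous_on {0..} (\<lambda>t. A t \<omega>) \<and> mono_on {0..} (\<lambda>t. A t \<omega>)) \<and>
       (AE \<omega> in M. A 0 \<omega> = 0) \<and>
     (AE \<omega> in M. AE t in interval_measure (\<lambda>t. A (max 0 t) \<omega>). 0 \<le> t \<longrightarrow> X t \<omega> = 0)"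


section \<open>The embedding\<close>

definition tail :: "real measure \<Rightarrow> real \<Rightarrow> real" where
  "tail \<theta> x = measure \<theta> {x..}"

definition lower_end :: "real measure \<Rightarrow> ennreal" where
  "lower_end \<theta> = Sup {ennreal x | x. 0 \<le> x \<and> tail \<theta> x = 1}"

definition upper_end :: "real measure \<Rightarrow> ennreal" where
  "upper_end \<theta> = Inf {ennreal x | x. 0 \<le> x \<and> tail \<theta> x = 0}"

definition psi :: "real measure \<Rightarrow> real \<Rightarrow> ennreal" where
  "psi \<theta> x =
     (if ennreal x < lower_end \<theta> then 0
      else if ennreal x < upper_end \<theta> then (\<integral>\<^sup>+ z\<in>{0..x}. ennreal (z / tail \<theta> z) \<partial>\<theta>)
      else \<infinity>)"

definition phi :: "real measure \<Rightarrow> real \<Rightarrow> ennreal" where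
  "phi \<theta> z = Inf {ennreal x | x. 0 \<le> x \<and> psi \<theta> x > ennreal z}"

text \<open>
  The condition \<open>0 < phi \<theta> (A t \<omega>)\<close> is automatic if \<open>lower_end \<theta> > 0\<close> (lemma
  \<open>embedding_time_eq\<close>). If \<open>lower_end \<theta> = 0\<close>, then \<open>phi \<theta> 0 = 0\<close>, and without it the
  trivial contact \<open>X 0 = 0 = phi \<theta> (A 0)\<close> would force the infimum to be 0
  (lemmas \<open>phi_0_eq_0\<close>, \<open>Inf_eq_0_without_positivity\<close>). Requiring \<open>t > 0\<close>
  instead would not suffice, as \<open>X\<close> and \<open>A\<close> may stay at 0 for some time.
\<close>

definition embedding_time ::
  "real measure \<Rightarrow> (real \<Rightarrow> 'a \<Rightarrow> real) \<Rightarrow> (real \<Rightarrow> 'a \<Rightarrow> real) \<Rightarrow> 'a \<Rightarrow> ennreal" where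
  "embedding_time \<theta> X A \<omega> =
     Inf {ennreal t | t. 0 \<le> t \<and> 0 < phi \<theta> (A t \<omega>) \<and> ennreal (X t \<omega>) \<ge> phi \<theta> (A t \<omega>)}"

lemma lower_end_le_phi: "lower_end \<theta> \<le> phi \<theta> z"
  unfolding phi_def by (intro Inf_greatest) (force simp: psi_def split: if_splits)

lemma embedding_time_eq:
  assumes "lower_end \<theta> > 0"
  shows "embedding_time \<theta> X A \<omega> = Inf {ennreal t | t. 0 \<le> t \<and> ennreal (X t \<omega>) \<ge> phi \<theta> (A t \<omega>)}"
proof -
  have "0 < phi \<theta> z" for z
    using assms lower_end_le_phi by (rule order.strict_trans2)
  then show ?thesis by (simp add: embedding_time_def)
qed

lemma phi_0_eq_0:
  assumes "real_distribution \<theta>" and "measure \<theta> {0..} = 1" and na: "\<And>x. measure \<theta> {x} = 0"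
   and a0: "lower_end \<theta> = 0"
  shows "phi \<theta> 0 = 0"
proof -
  interpret real_distribution \<theta> by fact
  have tm: "tail \<theta> y \<le> tail \<theta> x" if "x \<le> y" for x y
    unfolding tail_def using that by (intro finite_measure_mono) auto
  have [measurable]: "tail \<theta> \<in> borel_measurable borel"
  proof -
    have "mono (\<lambda>x. - tail \<theta> x)" using tm by (auto simp: mono_def)
    then have "(\<lambda>x. - tail \<theta> x) \<in> borel_measurable borel" by (rule borel_measurable_mono)
    then have "(\<lambda>x. - (- tail \<theta> x)) \<in> borel_measurable borel" by measurable
    then show ?thesis by simp
  qed
  have pos: "psi \<theta> x > 0" if x: "x > 0" for x
  proof (rule ccontr)
    assume "\<not> psi \<theta> x > 0"
    then have lt: "ennreal x < upper_end \<theta>" and z: "(\<integral>\<^sup>+ z\<in>{0..x}. ennreal (z / tail \<theta> z) \<partial>\<theta>) = 0"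
      using a0 by (auto simp: psi_def split: if_splits)
    have tp: "tail \<theta> z > 0" if "0 \<le> z" "z \<le> x" for z
    proof (rule ccontr)
      assume "\<not> ?thesis"
      then have "tail \<theta> z = 0" by (simp add: tail_def zero_less_measure_iff)
      then have "upper_end \<theta> \<le> ennreal z" unfolding upper_end_def using that by (intro Inf_lower) auto
      then show False using lt that ennreal_leI[of z x] by (simp add: leD order_trans)
    qed
    have "AE z in \<theta>. ennreal (z / tail \<theta> z) * indicator {0..x} z = 0"
      using z by (subst (asm) nn_integral_0_iff_AE) auto
    moreover have "AE z in \<theta>. z \<noteq> 0"
      using na[of 0] by (intro AE_I[where N="{0}"]) (auto simp: emeasure_eq_measure)
    moreover have "AE z in \<theta>. z \<in> {0..}"
      using assms(2) by (subst prob_eq_1[symmetric]) (auto simp: events_eq_borel)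
    ultimately have "AE z in \<theta>. z \<in> {x..}"
    proof eventually_elim
      case (elim z)
      show ?case
      proof (rule ccontr)
        assume "z \<notin> {x..}"
        then have "0 < z" "z \<le> x" using elim by auto
        then have "0 < z / tail \<theta> z" using tp[of z] by simp
        then show False using elim \<open>0 < z\<close> \<open>z \<le> x\<close> by (auto simp: indicator_def)
      qed
    qed
    then have "tail \<theta> x = 1" unfolding tail_def by (subst prob_eq_1) auto
    then have "ennreal x \<le> lower_end \<theta>" unfolding lower_end_def using x by (intro Sup_upper) auto
    with a0 x show False by simp
  qed
  have "phi \<theta> 0 \<le> ennreal e" if "e > 0" for e
    unfolding phi_def using pos[OF that] that by (intro Inf_lower) auto
  then show ?thesis
    using ennreal_le_epsilon[of 0 "phi \<theta> 0"] by simp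
qed

lemma Inf_eq_0_without_positivity:
  assumes "real_distribution \<theta>" and "measure \<theta> {0..} = 1" and "\<And>x. measure \<theta> {x} = 0"
    and "lower_end \<theta> = 0" and "A 0 \<omega> = 0" and "X 0 \<omega> = 0"
  shows "Inf {ennreal t | t. 0 \<le> t \<and> ennreal (X t \<omega>) \<ge> phi \<theta> (A t \<omega>)} = 0"
proof -
  have "Inf {ennreal t | t. 0 \<le> t \<and> ennreal (X t \<omega>) \<ge> phi \<theta> (A t \<omega>)} \<le> ennreal 0"
    using assms phi_0_eq_0[OF assms(1-4)] by (intro Inf_lower CollectI exI[of _ 0]) simp
  then show ?thesis by simp
qed

end

theory Submission
  imports Defs
begin

text \<open>
  Stop \<open>N = X - A\<close> at the first contact time \<open>T\<close> of \<open>X\<close> with a nondecreasing barrier \<open>g(A)\<close>,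
  \<open>g \<ge> c > 0\<close>, or at the time \<open>\<tau>\<^sub>v\<close> at which \<open>A\<close> exceeds \<open>v\<close>, where \<open>X\<close> vanishes. As \<open>X\<close> has no
  upward jumps, \<open>N\<close> is bounded up to then, so \<open>E[g(Z); Z \<le> v] = E[min Z v]\<close> for \<open>Z = A\<^sub>T\<close>. Hence the
  survival function of \<open>Z\<close> decays at rate \<open>1/g\<close>. For \<open>g = \<phi>\<close> the function \<open>v \<mapsto> \<theta>[\<phi>(v), \<infinity>)\<close> decays at
  the same rate, because \<open>\<psi>(\<phi>(v)) = v\<close>; so both agree and \<open>X\<^sub>T = \<phi>(Z)\<close> has law \<open>\<theta>\<close>. The
  approximate contact times (gap at most \<open>1/n\<close>) announce \<open>T\<close>; this excludes a jump of \<open>X\<close> at \<open>T\<close> and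
  makes \<open>T\<close> a stopping time without right-continuity of the filtration.
\<close>

section \<open>Paths of class \<open>(\<Sigma>)\<close> and their contact with a barrier\<close>

text \<open>The formula for \<open>\<psi>\<close> comes from the decay rate: if
  \<open>S(v) = \<theta>[\<phi>(v), \<infinity>)\<close> is to satisfy
  \<open>- dS = S dv / \<phi>(v)\<close>, then with \<open>z = \<phi>(v)\<close> this reads
  \<open>dv = z d\<theta>(z) / \<theta>[z, \<infinity>)\<close>, and integration gives
  \<open>v = \<psi>(z)\<close>. Gaps in the support of \<theta> make \<phi> jump, so the decay is
  expressed by two-sided difference inequalities, obtained by subtracting the sampling identities at
  two levels \<open>v \<le> w\<close>. The lower bound \<open>c\<close> of the barrier separates a
  contact, where \<open>X \<ge> c\<close>, from the arrival at \<tau>_v, where \<open>X = 0\<close>;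
  both measurability and the analysis of the path just before a contact rest on this gap. But
  \<open>\<phi>(0) = 0\<close> can happen. The barrier is then raised to \<open>\<phi>(u)\<close> on
  levels below \<open>u = 1/(n+1)\<close>. The probability of a contact at such a level is at most
  \<open>u / \<phi>(u) \<le> 1 / S(u) - 1\<close>, which tends to 0 with \<open>u\<close>.\<close>

definition entry :: "(real \<Rightarrow> bool) \<Rightarrow> real" where
  "entry P = Inf {t. 0 \<le> t \<and> P t}"

lemma entry_le: "0 \<le> t \<Longrightarrow> P t \<Longrightarrow> entry P \<le> t"
  unfolding entry_def by (intro cInf_lower bdd_belowI[of _ 0]) auto

lemma entry_nonneg: "\<exists>t\<ge>0. P t \<Longrightarrow> 0 \<le> entry P"
  unfolding entry_def by (intro cInf_greatest) auto

lemma entry_less_iff: "\<exists>t\<ge>0. P t \<Longrightarrow> entry P < r \<longleftrightarrow> (\<exists>t. 0 \<le> t \<and> t < r \<and> P t)"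
  unfolding entry_def by (subst cInf_less_iff) (auto intro: bdd_belowI[of _ 0])

text \<open>The second assumption makes \<open>P\<close> persist to the right, so a witness before
  \<open>r\<close> can be moved to a rational one. This is how entry times become measurable from
  countably many sections of a process.\<close>

lemma entry_less_iff_rat:
  assumes "\<exists>t\<ge>0. P t" and "\<And>t. 0 \<le> t \<Longrightarrow> P t \<Longrightarrow> eventually P (at_right t)"
  shows "entry P < r \<longleftrightarrow> (\<exists>q\<in>\<rat>. 0 \<le> q \<and> q < r \<and> P q)"
proof
  assume "entry P < r"
  then obtain t where t: "0 \<le> t" "t < r" "P t" using assms(1) by (auto simp: entry_less_iff)
  then obtain b where b: "b > t" "\<And>s. t < s \<Longrightarrow> s < b \<Longrightarrow> P s"
    using assms(2)[OF t(1,3)] unfolding eventually_at_right_field by auto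
  obtain q where "q \<in> \<rat>" "t < q" "q < min b r" using Rats_dense_in_real[of t "min b r"] t b by auto
  with b t show "\<exists>q\<in>\<rat>. 0 \<le> q \<and> q < r \<and> P q" by (intro bexI[of _ q]) auto
next
  assume "\<exists>q\<in>\<rat>. 0 \<le> q \<and> q < r \<and> P q"
  then show "entry P < r" using assms(1) by (auto simp: entry_less_iff)
qed

text \<open>An infimum that is not attained is approached by witnesses from the right. It is used
  for contradictions: if \<open>P\<close> fails at its entry and, by right-continuity, also just
  after it, this lemma is violated.\<close>

lemma not_eventually_entry:
  assumes "\<exists>t\<ge>0. P t" "\<not> P (entry P)"
  shows "\<not> eventually (\<lambda>t. \<not> P t) (at_right (entry P))"
proof
  assume "eventually (\<lambda>t. \<not> P t) (at_right (entry P))"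
  then obtain b where b: "b > entry P" "\<And>s. entry P < s \<Longrightarrow> s < b \<Longrightarrow> \<not> P s"
    unfolding eventually_at_right_field by auto
  from b(1) obtain t where t: "0 \<le> t" "t < b" "P t" using assms(1) by (auto simp: entry_less_iff)
  with entry_le[of t P] b(2)[of t] assms(2) show False by (cases "t = entry P") auto
qed

text \<open>The deterministic content of the hypotheses for one path. The sign of the jumps enters
  as a left limit that is at least \<open>x t\<close>. The condition on \<open>dA\<close> enters as
  \<open>carried\<close>: an interval on which \<open>a\<close> grows contains a zero of
  \<open>x\<close>.\<close>

locale Sigma_path =
  fixes x a :: "real \<Rightarrow> real"
  assumes x_nonneg: "0 \<le> t \<Longrightarrow> 0 \<le> x t"
    and x_0: "x 0 = 0" and a_0: "a 0 = 0"
    and x_right: "0 \<le> t \<Longrightarrow> (x \<longlongrightarrow> x t) (at_right t)"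
    and x_left: "0 < t \<Longrightarrow> \<exists>l\<ge>x t. (x \<longlongrightarrow> l) (at_left t)"
    and a_cont: "continuous_on {0..} a"
    and a_mono: "0 \<le> s \<Longrightarrow> s \<le> t \<Longrightarrow> a s \<le> a t"
    and a_top: "filterlim a at_top at_top"
    and carried: "0 \<le> s \<Longrightarrow> s < t \<Longrightarrow> a s < a t \<Longrightarrow> \<exists>r\<in>{s<..t}. x r = 0"
begin

definition tau :: "real \<Rightarrow> real" where
  "tau v = entry (\<lambda>t. v < a t)"

lemma a_nonneg: "0 \<le> t \<Longrightarrow> 0 \<le> a t"
  using a_mono[of 0 t] a_0 by simp

lemma a_right: "0 \<le> t \<Longrightarrow> (a \<longlongrightarrow> a t) (at_right t)"
  using a_cont by (auto simp: continuous_on_def intro: tendsto_within_subset)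

lemma a_left: "0 < t \<Longrightarrow> (a \<longlongrightarrow> a t) (at_left t)"
proof -
  assume "0 < t"
  then have "isCont a t" using a_cont by (auto intro: continuous_on_interior)
  then show ?thesis by (simp add: isCont_def filterlim_at_split)
qed

lemma ex_a_gt: "\<exists>t\<ge>0. v < a t"
proof -
  have "eventually (\<lambda>t. 0 \<le> t \<and> v < a t) at_top"
    using a_top by (intro eventually_conj eventually_ge_at_top) (auto simp: filterlim_at_top_dense)
  then show ?thesis by (auto dest!: eventually_happens)
qed

lemma tau_nonneg: "0 \<le> tau v"
  unfolding tau_def by (intro entry_nonneg ex_a_gt)

lemma a_gt_of_tau_less:
  assumes "tau v < t" shows "v < a t"
proof -
  obtain s where "0 \<le> s" "s < t" "v < a s"
    using assms ex_a_gt unfolding tau_def by (auto simp: entry_less_iff)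
  with a_mono[of s t] show ?thesis by simp
qed

lemma a_tau:
  assumes "0 \<le> v" shows "a (tau v) = v"
proof (rule antisym)
  show "a (tau v) \<le> v"
  proof (rule ccontr)
    assume "\<not> ?thesis"
    then have gt: "v < a (tau v)" by simp
    then have "tau v \<noteq> 0" using a_0 assms by auto
    then have pos: "0 < tau v" using tau_nonneg[of v] by simp
    have "eventually (\<lambda>t. v < a t \<and> t \<in> {0<..<tau v}) (at_left (tau v))"
      using order_tendstoD(1)[OF a_left[OF pos] gt] eventually_at_left_real[OF pos]
      by (rule eventually_conj)
    then have "\<exists>t. v < a t \<and> t \<in> {0<..<tau v}"
      by (rule eventually_happens'[OF trivial_limit_at_left_real])
    then obtain t where "v < a t" "0 < t" "t < tau v" by auto
    with entry_le[of t "\<lambda>t. v < a t"] show False by (simp add: tau_def)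
  qed
  show "v \<le> a (tau v)"
  proof (rule ccontr)
    assume "\<not> ?thesis"
    then have "eventually (\<lambda>t. a t < v) (at_right (tau v))"
      using order_tendstoD(2)[OF a_right[OF tau_nonneg]] by auto
    moreover have "eventually (\<lambda>t. tau v < t) (at_right (tau v))"
      by (rule eventually_at_right_less)
    ultimately have "eventually (\<lambda>t. False) (at_right (tau v))"
      by eventually_elim (use a_gt_of_tau_less in fastforce)
    then show False by simp
  qed
qed

text \<open>Immediately after \<open>tau v\<close> the level \<open>v\<close> is exceeded, so
  \<open>carried\<close> puts zeros of \<open>x\<close> into every interval just to the right of
  \<open>tau v\<close>, and right-continuity transfers the value 0.\<close>

lemma x_tau:
  assumes "0 \<le> v" shows "x (tau v) = 0"
proof (rule ccontr)
  assume "x (tau v) \<noteq> 0"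
  then have "0 < x (tau v)" using x_nonneg[OF tau_nonneg[of v]] by simp
  then have "eventually (\<lambda>t. 0 < x t) (at_right (tau v))"
    by (rule order_tendstoD(1)[OF x_right[OF tau_nonneg]])
  then obtain b where b: "b > tau v" "\<And>s. tau v < s \<Longrightarrow> s < b \<Longrightarrow> 0 < x s"
    unfolding eventually_at_right_field by auto
  define s where "s = (tau v + b) / 2"
  have s: "tau v < s" "s < b" using b by (auto simp: s_def)
  then obtain r where "r \<in> {tau v<..s}" "x r = 0"
    using carried[OF tau_nonneg s(1)] a_gt_of_tau_less[OF s(1)] a_tau[OF assms] by auto
  with b(2)[of r] s show False by auto
qed

end

section \<open>Approximate contact times of a path with a barrier\<close>

locale Sigma_path_level = Sigma_path x a for x a +
  fixes g :: "real \<Rightarrow> real" and c :: real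
  assumes g_mono: "mono g" and g_right: "(g \<longlongrightarrow> g z) (at_right z)"
    and c_pos: "0 < c" and g_ge: "c \<le> g z"
begin

text \<open>Strict inequalities keep the condition valid just after a time at which it holds, which
  yields \<open>near_less_iff_rat\<close>. The disjunct \<open>v < a t\<close> ends the search at
  \<open>tau v\<close>, so the time is finite even if the barrier is never approached.\<close>

definition near :: "real \<Rightarrow> nat \<Rightarrow> real" where
  "near v n = entry (\<lambda>t. v < a t \<or> g (a t) - 1 / Suc n < x t)"

definition near_lim :: "real \<Rightarrow> real" where
  "near_lim v = (SUP n. near v n)"

lemma gD: "y \<le> z \<Longrightarrow> g y \<le> g z"
  using g_mono by (auto simp: mono_def)

text \<open>As \<open>a\<close> is nondecreasing, \<open>a s\<close> approaches \<open>a t\<close>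
  from above, the side on which \<open>g\<close> is continuous.\<close>

lemma g_a_right:
  assumes "0 \<le> t" shows "((\<lambda>s. g (a s)) \<longlongrightarrow> g (a t)) (at_right t)"
proof (rule order_tendstoI)
  fix y assume "y < g (a t)"
  have "eventually (\<lambda>s. t < s) (at_right t)" by (rule eventually_at_right_less)
  then show "eventually (\<lambda>s. y < g (a s)) (at_right t)"
    by eventually_elim (use \<open>y < g (a t)\<close> gD a_mono[OF assms] in \<open>meson less_imp_le order.strict_trans2\<close>)
next
  fix y assume y: "y > g (a t)"
  then obtain b where b: "b > a t" "\<And>z. a t < z \<Longrightarrow> z < b \<Longrightarrow> g z < y"
    using order_tendstoD(2)[OF g_right] unfolding eventually_at_right_field by blast
  have "eventually (\<lambda>s. t < s) (at_right t)" by (rule eventually_at_right_less)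
  moreover have "eventually (\<lambda>s. a s < b) (at_right t)"
    by (rule order_tendstoD(2)[OF a_right[OF assms] b(1)])
  ultimately show "eventually (\<lambda>s. g (a s) < y) (at_right t)"
  proof eventually_elim
    case (elim s)
    then show ?case using a_mono[OF assms, of s] b(2)[of "a s"] y by (cases "a s = a t") auto
  qed
qed

lemma gap_right: "0 \<le> t \<Longrightarrow> ((\<lambda>s. x s - g (a s)) \<longlongrightarrow> x t - g (a t)) (at_right t)"
  by (intro tendsto_diff x_right g_a_right)

lemma ex_near: "\<exists>t\<ge>0. v < a t \<or> g (a t) - 1 / Suc n < x t"
  using ex_a_gt by blast

lemma near_nonneg: "0 \<le> near v n"
  unfolding near_def by (intro entry_nonneg ex_near)

lemma near_le_tau: "near v n \<le> tau v"
proof (rule dense_ge)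
  fix t assume "tau v < t"
  then have "v < a t" "0 \<le> t" using a_gt_of_tau_less tau_nonneg[of v] by auto
  then show "near v n \<le> t" unfolding near_def by (intro entry_le) auto
qed

lemma before_near:
  assumes "0 \<le> t" "t < near v n" shows "a t \<le> v" "x t \<le> g (a t) - 1 / Suc n"
  using assms entry_le[of t "\<lambda>t. v < a t \<or> g (a t) - 1 / Suc n < x t"]
  unfolding near_def by force+

lemma near_mono: "incseq (near v)"
proof (rule incseq_SucI, rule ccontr)
  fix n assume "\<not> near v n \<le> near v (Suc n)"
  then have "near v (Suc n) < near v n" by simp
  then obtain t where t: "0 \<le> t" "t < near v n" "v < a t \<or> g (a t) - 1 / Suc (Suc n) < x t"
    unfolding near_def[of v "Suc n"] by (subst (asm) entry_less_iff[OF ex_near]) auto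
  moreover have "1 / real (Suc (Suc n)) \<le> 1 / Suc n" by (simp add: field_simps)
  ultimately show False using before_near[OF t(1,2)] by linarith
qed

lemma near_less_iff_rat:
  "near v n < r \<longleftrightarrow> (\<exists>q\<in>\<rat>. 0 \<le> q \<and> q < r \<and> (v < a q \<or> g (a q) - 1 / Suc n < x q))"
  unfolding near_def
proof (rule entry_less_iff_rat[OF ex_near])
  fix t :: real assume t: "0 \<le> t" and "v < a t \<or> g (a t) - 1 / Suc n < x t"
  then consider "v < a t" | "- (1 / Suc n) < x t - g (a t)" by fastforce
  then show "eventually (\<lambda>t. v < a t \<or> g (a t) - 1 / Suc n < x t) (at_right t)"
  proof cases
    case 1
    from order_tendstoD(1)[OF a_right[OF t] this] show ?thesis by eventually_elim simp
  next
    case 2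
    from order_tendstoD(1)[OF gap_right[OF t] this] show ?thesis by eventually_elim auto
  qed
qed

text \<open>A gap larger than \<open>1 / Suc n\<close> at \<open>near v n\<close> would persist to
  the right, and so would \<open>a \<le> v\<close> before \<open>tau v\<close>; then the infimum
  would lie later. Only the weak inequality survives the passage to the infimum.\<close>

lemma x_near:
  assumes "near v n < tau v" shows "g (a (near v n)) - 1 / Suc n \<le> x (near v n)"
proof (rule ccontr)
  let ?R = "near v n" and ?P = "\<lambda>t. v < a t \<or> g (a t) - 1 / Suc n < x t"
  assume neg: "\<not> ?thesis"
  have le: "a t \<le> v" if "0 \<le> t" "t < tau v" for t
    using that entry_le[of t "\<lambda>t. v < a t"] unfolding tau_def by force
  have "eventually (\<lambda>s. x s - g (a s) < - (1 / Suc n)) (at_right ?R)"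
    using neg by (intro order_tendstoD(2)[OF gap_right[OF near_nonneg]]) auto
  moreover have "eventually (\<lambda>s. s \<in> {?R<..<tau v}) (at_right ?R)"
    by (rule eventually_at_right_real[OF assms])
  ultimately have "eventually (\<lambda>s. \<not> ?P s) (at_right ?R)"
  proof eventually_elim
    case (elim s)
    then show ?case using le[of s] near_nonneg[of v n] by auto
  qed
  moreover have "\<not> ?P ?R" using neg le[OF near_nonneg assms] by auto
  ultimately show False
    using not_eventually_entry[OF ex_near[of v n]] unfolding near_def by blast
qed

lemma bdd_near: "bdd_above (range (near v))"
  using near_le_tau by (auto intro!: bdd_aboveI)

lemma near_le_lim: "near v n \<le> near_lim v"
  unfolding near_lim_def by (rule cSUP_upper[OF UNIV_I bdd_near])

lemma near_tendsto: "near v \<longlonglongrightarrow> near_lim v"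
  unfolding near_lim_def by (rule LIMSEQ_incseq_SUP[OF bdd_near near_mono])

lemma near_lim_nonneg: "0 \<le> near_lim v"
  using near_le_lim[of v 0] near_nonneg[of v 0] by linarith

lemma near_lim_le_tau: "near_lim v \<le> tau v"
  unfolding near_lim_def by (intro cSUP_least near_le_tau) auto

lemma less_near_lim: "t < near_lim v \<longleftrightarrow> (\<exists>n. t < near v n)"
  unfolding near_lim_def using less_cSUP_iff[OF _ bdd_near] by auto

lemma a_le_until_near_lim: "0 \<le> v \<Longrightarrow> 0 \<le> t \<Longrightarrow> t \<le> near_lim v \<Longrightarrow> a t \<le> v"
  using a_mono[of t "tau v"] near_lim_le_tau[of v] a_tau[of v] by linarith

lemma x_less_before_near_lim:
  assumes "0 \<le> t" "t < near_lim v" shows "x t < g (a t)"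
proof -
  obtain n where "t < near v n" using assms by (auto simp: less_near_lim)
  then have "x t \<le> g (a t) - 1 / Suc n" using before_near assms by blast
  moreover have "0 < 1 / real (Suc n)" by simp
  ultimately show ?thesis by linarith
qed

text \<open>At \<open>near_lim v\<close> itself the left limit of \<open>x\<close> is at most
  \<open>g (a t)\<close> by monotonicity, and \<open>x\<close> cannot jump above its left limit.
  Here the absence of upward jumps bounds the path.\<close>

lemma x_le_until_near_lim:
  assumes "0 \<le> t" "t \<le> near_lim v" shows "x t \<le> g (a t)"
proof (cases "t = 0")
  case True
  then show ?thesis using x_0 c_pos g_ge[of "a 0"] by simp
next
  case False
  then have t: "0 < t" using assms by simp
  obtain l where l: "x t \<le> l" "(x \<longlongrightarrow> l) (at_left t)" using x_left[OF t] by auto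
  have "eventually (\<lambda>s. x s \<le> g (a t)) (at_left t)"
    using eventually_at_left_real[OF t]
  proof eventually_elim
    case (elim s)
    then have "x s < g (a s)" using assms x_less_before_near_lim[of s v] by auto
    also have "\<dots> \<le> g (a t)" using elim by (intro gD a_mono) auto
    finally show ?case by simp
  qed
  then have "l \<le> g (a t)" using l(2) by (intro tendsto_upperbound) auto
  with l show ?thesis by simp
qed

text \<open>Either the approximating times reach their limit, or they approach it strictly from the
  left and the left limit of \<open>x\<close> applies. Any difference between \<open>l\<close> and
  the value is a downward jump, which is later excluded almost surely by comparing
  expectations.\<close>

lemma x_near_tendsto: "\<exists>l\<ge>x (near_lim v). (\<lambda>n. x (near v n)) \<longlonglongrightarrow> l"
proof (cases "\<exists>m. near v m = near_lim v")
  case True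
  then obtain m where m: "near v m = near_lim v" by auto
  have "near v n = near_lim v" if "n \<ge> m" for n
    using incseqD[OF near_mono that, of v] near_le_lim[of v n] m by simp
  then have "(\<lambda>n. x (near v n)) \<longlonglongrightarrow> x (near_lim v)"
    by (intro tendsto_eventually eventually_sequentiallyI[of m]) auto
  then show ?thesis by blast
next
  case False
  then have less: "near v n < near_lim v" for n using near_le_lim[of v n] by (metis order_le_less)
  then have "0 < near_lim v" using near_nonneg[of v 0] by (metis order_le_less_trans)
  then obtain l where l: "x (near_lim v) \<le> l" "(x \<longlongrightarrow> l) (at_left (near_lim v))" using x_left by blast
  have "filterlim (near v) (at_left (near_lim v)) sequentially"
    unfolding filterlim_at using near_tendsto less by (auto intro!: always_eventually less_imp_neq)
  from filterlim_compose[OF l(2) this] l(1) show ?thesis by blast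
qed

text \<open>
  If \<open>x\<close> does not jump down at \<open>near_lim v\<close>, then neither does the gap \<open>x - g(a)\<close>: an upward jump
  of \<open>g(a)\<close> needs an increase of \<open>a\<close> immediately before, hence zeros of \<open>x\<close> there.
\<close>
lemma contact_or_tau:
  assumes v: "0 \<le> v" and lim: "(\<lambda>n. x (near v n)) \<longlonglongrightarrow> x (near_lim v)"
  shows "near_lim v = tau v \<and> (\<forall>t. 0 \<le> t \<and> t \<le> tau v \<longrightarrow> x t < g (a t)) \<or>
         near_lim v < tau v \<and> x (near_lim v) = g (a (near_lim v))"
proof (cases "\<exists>m. near v m = tau v")
  case True
  then have eq: "near_lim v = tau v"
    using near_le_lim[of v] near_lim_le_tau[of v] by (metis antisym)
  have "x t < g (a t)" if "0 \<le> t" "t \<le> tau v" for t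
  proof (cases "t = tau v")
    case True
    then show ?thesis using x_tau[OF v] g_ge[of "a t"] c_pos by simp
  next
    case False
    then show ?thesis using x_less_before_near_lim[of t v] that eq by simp
  qed
  with eq show ?thesis by blast
next
  case False
  then have less: "near v n < tau v" for n using near_le_tau[of v n] by (metis order_le_less)
  let ?R = "near_lim v"
  \<comment> \<open>The lower bound \<open>c\<close> of the barrier keeps
    \<open>x (near v n)\<close> away from 0, so \<open>x\<close> is positive at the limit.\<close>
  have c_le: "c - 1 / Suc n \<le> x (near v n)" for n
    using x_near[OF less, of n] g_ge[of "a (near v n)"] by linarith
  have inv: "(\<lambda>n. 1 / real (Suc n)) \<longlonglongrightarrow> 0"
    using LIMSEQ_Suc[OF lim_1_over_n] by simp
  have "(\<lambda>n. c - 1 / real (Suc n)) \<longlonglongrightarrow> c - 0" by (intro tendsto_intros inv)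
  then have "c \<le> x ?R" using c_le by (intro LIMSEQ_le[OF _ lim]) auto
  then have pos: "0 < x ?R" using c_pos by simp
  have "\<exists>m. a (near v m) = a ?R"
  proof (rule ccontr)
    assume "\<not> ?thesis"
    then have aless: "a (near v n) < a ?R" for n
      using a_mono[OF near_nonneg near_le_lim, of v n] by (metis order_le_less)
    then have nless: "near v n < ?R" for n
      using near_le_lim[of v n] by (metis less_irrefl order_le_less)
    then have R: "0 < ?R" using near_nonneg[of v 0] by (metis order_le_less_trans)
    have fl: "filterlim (near v) (at_left ?R) sequentially"
      unfolding filterlim_at using near_tendsto nless by (auto intro!: always_eventually less_imp_neq)
    obtain l where l: "(x \<longlongrightarrow> l) (at_left ?R)" using x_left[OF R] by blast
    \<comment> \<open>By \<open>lim\<close> the left limit equals the value, so \<open>x\<close> is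
      positive on a left neighbourhood of \<open>?R\<close>; growth of \<open>a\<close> there would
      produce a zero.\<close>
    have "l = x ?R" using LIMSEQ_unique[OF filterlim_compose[OF l fl] lim] .
    then have "eventually (\<lambda>s. 0 < x s) (at_left ?R)" using order_tendstoD(1)[OF l] pos by simp
    then obtain b where b: "b < ?R" "\<And>s. b < s \<Longrightarrow> s < ?R \<Longrightarrow> 0 < x s"
      unfolding eventually_at_left_field by auto
    obtain n where n: "b < near v n" using b(1) by (auto simp: less_near_lim)
    have "eventually (\<lambda>s. a (near v n) < a s) (at_left ?R)"
      by (rule order_tendstoD(1)[OF a_left[OF R] aless])
    moreover have "eventually (\<lambda>s. s \<in> {near v n<..<?R}) (at_left ?R)"
      by (rule eventually_at_left_real[OF nless])
    ultimately have "eventually (\<lambda>s. a (near v n) < a s \<and> s \<in> {near v n<..<?R}) (at_left ?R)"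
      by (rule eventually_conj)
    then have "\<exists>s. a (near v n) < a s \<and> s \<in> {near v n<..<?R}"
      by (rule eventually_happens'[OF trivial_limit_at_left_real])
    then obtain s where s: "a (near v n) < a s" "near v n < s" "s < ?R" by auto
    then obtain r where "r \<in> {near v n<..s}" "x r = 0" using carried[OF near_nonneg s(2,1)] by auto
    with b(2)[of r] n s show False by auto
  qed
  then obtain m where m: "a (near v m) = a ?R" by auto
  have const: "a (near v n) = a ?R" if "n \<ge> m" for n
    using a_mono[OF near_nonneg near_le_lim, of v n]
      a_mono[OF near_nonneg incseqD[OF near_mono that], of v] m by simp
  \<comment> \<open>From index \<open>m\<close> on, the barrier has the constant height
    \<open>g (a ?R)\<close>, so the approximate inequalities pass to the limit although
    \<open>g\<close> may be discontinuous from the left.\<close>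
  have "(\<lambda>n. g (a ?R) - 1 / real (Suc n)) \<longlonglongrightarrow> g (a ?R) - 0" by (intro tendsto_intros inv)
  moreover have "g (a ?R) - 1 / Suc n \<le> x (near v n)" if "n \<ge> m" for n
    using x_near[OF less, of n] const[OF that] by simp
  ultimately have "g (a ?R) \<le> x ?R"
    using LIMSEQ_le[OF _ lim, of "\<lambda>n. g (a ?R) - 1 / Suc n"] by auto
  then have "x ?R = g (a ?R)"
    using x_le_until_near_lim[OF near_lim_nonneg order_refl, of v] by (rule antisym[rotated])
  moreover have "?R \<noteq> tau v" using pos x_tau[OF v] by auto
  ultimately show ?thesis using near_lim_le_tau[of v] by auto
qed

section \<open>The first contact of a single path\<close>

definition contact :: "real \<Rightarrow> bool" where
  "contact t \<longleftrightarrow> g (a t) \<le> x t"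

definition contact_time :: real where
  "contact_time = entry contact"

text \<open>The law is computed for the level of \<open>a\<close> at the contact. The value
  \<infinity> for paths without contact makes \<open>v < contact_level\<close> include them.\<close>

definition contact_level :: ennreal where
  "contact_level = (if \<exists>t\<ge>0. contact t then ennreal (a contact_time) else \<infinity>)"

text \<open>The gap \<open>x - g(a)\<close> is right-continuous, and contact means that it is
  nonnegative, a closed condition; so the infimum is attained.\<close>

lemma contact_contact_time:
  assumes "\<exists>t\<ge>0. contact t" shows "0 \<le> contact_time" "contact contact_time"
proof -
  show nn: "0 \<le> contact_time" unfolding contact_time_def by (intro entry_nonneg assms)
  show "contact contact_time"
  proof (rule ccontr)
    assume "\<not> ?thesis"
    then have "eventually (\<lambda>s. x s - g (a s) < 0) (at_right contact_time)"
      by (intro order_tendstoD(2)[OF gap_right[OF nn]]) (auto simp: contact_def)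
    then have "eventually (\<lambda>s. \<not> contact s) (at_right contact_time)"
      by eventually_elim (auto simp: contact_def)
    with \<open>\<not> contact contact_time\<close> not_eventually_entry[OF assms] show False
      by (simp add: contact_time_def)
  qed
qed

lemma contact_time_le: "0 \<le> t \<Longrightarrow> contact t \<Longrightarrow> contact_time \<le> t"
  unfolding contact_time_def by (rule entry_le)

text \<open>Determines the pair of \<open>x\<close> and \<open>a\<close> at
  \<open>near_lim v\<close> from the contact level alone: \<open>(0, v)\<close> above
  \<open>v\<close>, and otherwise \<open>(g z, z)\<close> for the level \<open>z\<close>. All
  expectations below are evaluated with it.\<close>

lemma contact_level_cases:
  assumes v: "0 \<le> v" and lim: "(\<lambda>n. x (near v n)) \<longlonglongrightarrow> x (near_lim v)"
  obtains "near_lim v = tau v" "\<And>t. 0 \<le> t \<Longrightarrow> contact t \<Longrightarrow> tau v < t" "ennreal v < contact_level"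
    "x (near_lim v) = 0" "a (near_lim v) = v"
  | "near_lim v = contact_time" "contact contact_time" "contact_level = ennreal (a contact_time)"
    "a contact_time \<le> v" "x contact_time = g (a contact_time)" "near_lim v < tau v"
proof (cases "near_lim v = tau v \<and> (\<forall>t. 0 \<le> t \<and> t \<le> tau v \<longrightarrow> x t < g (a t))")
  case True
  then have tau: "tau v < t" if "0 \<le> t" "contact t" for t
    using that by (force simp: contact_def)
  have "ennreal v < contact_level"
  proof (cases "\<exists>t\<ge>0. contact t")
    case True
    note c = contact_contact_time[OF True]
    have "v < a contact_time" by (rule a_gt_of_tau_less[OF tau[OF c]])
    then show ?thesis using v True by (simp add: contact_level_def ennreal_lessI)
  next
    case False
    then show ?thesis unfolding contact_level_def by (subst if_not_P) auto
  qed
  then show ?thesis using that(1) True tau x_tau[OF v] a_tau[OF v] by auto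
next
  case False
  then have *: "near_lim v < tau v" "x (near_lim v) = g (a (near_lim v))"
    using contact_or_tau[OF assms] by auto
  have c: "contact (near_lim v)" using * by (simp add: contact_def)
  then have ex: "\<exists>t\<ge>0. contact t" using near_lim_nonneg by auto
  have "\<not> contact t" if "0 \<le> t" "t < near_lim v" for t
    using x_less_before_near_lim[OF that] by (simp add: contact_def)
  then have eq: "near_lim v = contact_time"
    using contact_time_le[OF near_lim_nonneg c] contact_contact_time[OF ex] by (meson antisym_conv2 not_le)
  show ?thesis
    using that(2) * ex contact_contact_time[OF ex] a_le_until_near_lim[OF v near_lim_nonneg order_refl]
    unfolding eq contact_level_def by auto
qed

text \<open>Replaces an uncountable union over \<open>[0, t]\<close> by countably many times. If
  every gap \<open>1 / Suc n\<close> is undercut by time \<open>t\<close>, then all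
  \<open>near (real k) n\<close> are at most \<open>t\<close>; for \<open>real k > a t\<close> their
  limit lies before \<open>tau (real k)\<close> and is a genuine contact. The time \<open>t\<close>
  is listed separately because a contact at \<open>t\<close> must be detected without looking beyond
  \<open>t\<close>.\<close>

lemma contact_iff_near_contact:
  assumes lim: "\<And>k. (\<lambda>n. x (near (real k) n)) \<longlonglongrightarrow> x (near_lim (real k))" and t: "0 \<le> t"
  shows "(\<exists>s. 0 \<le> s \<and> s \<le> t \<and> contact s) \<longleftrightarrow>
    (\<forall>n. \<exists>q\<in>insert t (\<rat> \<inter> {0..t}). g (a q) - 1 / Suc n < x q)" (is "?L \<longleftrightarrow> ?R")
proof
  assume ?L
  then obtain s where s: "0 \<le> s" "s \<le> t" "contact s" by auto
  show ?R
  proof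
    fix n
    show "\<exists>q\<in>insert t (\<rat> \<inter> {0..t}). g (a q) - 1 / Suc n < x q"
    proof (cases "s = t")
      case True
      then have "0 < 1 / real (Suc n)" "g (a t) \<le> x t" using s by (auto simp: contact_def)
      then have "g (a t) - 1 / Suc n < x t" by linarith
      then show ?thesis by blast
    next
      case False
      have "- (1 / real (Suc n)) < 0" "0 \<le> x s - g (a s)" using s(3) by (auto simp: contact_def)
      then have "eventually (\<lambda>q. - (1 / Suc n) < x q - g (a q)) (at_right s)"
        by (intro order_tendstoD(1)[OF gap_right[OF s(1)]]) linarith
      then obtain b where b: "b > s" "\<And>q. s < q \<Longrightarrow> q < b \<Longrightarrow> - (1 / Suc n) < x q - g (a q)"
        unfolding eventually_at_right_field by auto
      obtain q where "q \<in> \<rat>" "s < q" "q < min b t"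
        using Rats_dense_in_real[of s "min b t"] s b False by auto
      then show ?thesis using b(2)[of q] s by (intro bexI[of _ q]) auto
    qed
  qed
next
  assume R: ?R
  obtain k :: nat where k: "a t < real k" using reals_Archimedean2 by blast
  have "near (real k) n \<le> t" for n
  proof -
    obtain q where "q \<in> insert t (\<rat> \<inter> {0..t})" "g (a q) - 1 / Suc n < x q" using R by blast
    then show ?thesis using t entry_le[of q "\<lambda>t. real k < a t \<or> g (a t) - 1 / Suc n < x t"]
      by (auto simp: near_def)
  qed
  then have le: "near_lim (real k) \<le> t" unfolding near_lim_def by (intro cSUP_least) auto
  have "t < tau (real k)"
    using k a_tau[of "real k"] a_mono[OF tau_nonneg, of "real k" t] by fastforce
  have "near_lim (real k) \<noteq> tau (real k)" using le \<open>t < tau (real k)\<close> by simp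
  with contact_or_tau[OF _ lim, of k] have "x (near_lim k) = g (a (near_lim k))" by simp
  then show ?L using le near_lim_nonneg[of k] by (intro exI[of _ "near_lim k"]) (simp add: contact_def)
qed

end

section \<open>Optional sampling\<close>

locale real_filtration = prob_space P for P :: "'a measure" +
  fixes G :: "real \<Rightarrow> 'a measure"
  assumes subalg_G: "0 \<le> t \<Longrightarrow> subalgebra P (G t)"
    and sets_G_mono: "0 \<le> s \<Longrightarrow> s \<le> t \<Longrightarrow> sets (G s) \<subseteq> sets (G t)"
begin

text \<open>The strict inequality makes this weaker than \<open>{R \<le> r} \<in> sets (G r)\<close>
  when \<open>G\<close> is not right-continuous. Entry times seen at rational times satisfy it, and
  it suffices for discretisation from above.\<close>

definition optional_time :: "('a \<Rightarrow> real) \<Rightarrow> bool" where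
  "optional_time R \<longleftrightarrow> (\<forall>\<omega>. 0 \<le> R \<omega>) \<and> (\<forall>r>0. {\<omega> \<in> space P. R \<omega> < r} \<in> sets (G r))"

text \<open>\<open>Suc\<close> of the floor puts the grid time strictly after \<open>R\<close>.
  Hence \<open>grid_index R k \<omega> = j\<close> is a difference of two events of the form
  \<open>{R < r}\<close> with \<open>r \<le> j / Suc k\<close>, and right limits of the paths
  apply.\<close>

definition grid_index :: "('a \<Rightarrow> real) \<Rightarrow> nat \<Rightarrow> 'a \<Rightarrow> nat" where
  "grid_index R k \<omega> = Suc (nat \<lfloor>R \<omega> * Suc k\<rfloor>)"

lemma space_G: "0 \<le> t \<Longrightarrow> space (G t) = space P"
  using subalg_G by (auto simp: subalgebra_def)

lemma sets_G: "0 \<le> t \<Longrightarrow> E \<in> sets (G t) \<Longrightarrow> E \<in> sets P"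
  using subalg_G by (auto simp: subalgebra_def)

lemma measurable_G: "0 \<le> t \<Longrightarrow> f \<in> borel_measurable (G t) \<Longrightarrow> f \<in> borel_measurable P"
  using measurable_from_subalg[OF subalg_G] by blast

lemma optional_time_nonneg: "optional_time R \<Longrightarrow> 0 \<le> R \<omega>"
  by (simp add: optional_time_def)

lemma optional_time_less: "optional_time R \<Longrightarrow> 0 < r \<Longrightarrow> {\<omega> \<in> space P. R \<omega> < r} \<in> sets (G r)"
  by (simp add: optional_time_def)

lemma optional_time_min_const:
  assumes "optional_time R" "0 \<le> b" shows "optional_time (\<lambda>\<omega>. min (R \<omega>) b)"
  unfolding optional_time_def
proof (intro conjI allI impI)
  fix r :: real assume r: "0 < r"
  have "{\<omega> \<in> space P. min (R \<omega>) b < r} = (if b < r then space P else {\<omega> \<in> space P. R \<omega> < r})"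
    by auto
  then show "{\<omega> \<in> space P. min (R \<omega>) b < r} \<in> sets (G r)"
    using optional_time_less[OF assms(1) r] sets.top[of "G r"] r by (simp add: space_G)
qed (use assms in \<open>auto simp: optional_time_def\<close>)

text \<open>\<open>R n < r\<close> for all \<open>n\<close> only gives \<open>S \<le> r\<close>. A
  margin \<open>1 / Suc m\<close> uniform in \<open>n\<close> expresses the strict inequality
  through countably many events of \<open>G r\<close>; the conjunct \<open>0 < r - 1 / Suc m\<close>
  keeps the time index positive.\<close>

lemma optional_time_SUP:
  assumes R: "\<And>n. optional_time (R n)" and lim: "\<And>\<omega>. incseq (\<lambda>n. R n \<omega>)" "\<And>\<omega>. (\<lambda>n. R n \<omega>) \<longlonglongrightarrow> S \<omega>"
  shows "optional_time S"
  unfolding optional_time_def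
proof (intro conjI allI impI)
  fix r :: real assume r: "0 < r"
  have less: "S \<omega> < r \<longleftrightarrow> (\<exists>m. \<forall>n. 0 < r - 1 / Suc m \<and> R n \<omega> < r - 1 / Suc m)" for \<omega>
  proof
    assume "S \<omega> < r"
    then have "0 < r - S \<omega>" by simp
    then obtain m where m: "1 / real (Suc m) < r - S \<omega>" by (rule nat_approx_posE)
    have R_le: "R n \<omega> \<le> S \<omega>" for n by (rule incseq_le[OF lim])
    have "0 \<le> R 0 \<omega>" by (rule optional_time_nonneg[OF R])
    show "\<exists>m. \<forall>n. 0 < r - 1 / Suc m \<and> R n \<omega> < r - 1 / Suc m"
    proof (intro exI[of _ m] allI)
      fix n
      show "0 < r - 1 / Suc m \<and> R n \<omega> < r - 1 / Suc m"
        using m R_le[of n] R_le[of 0] \<open>0 \<le> R 0 \<omega>\<close> by linarith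
    qed
  next
    assume "\<exists>m. \<forall>n. 0 < r - 1 / Suc m \<and> R n \<omega> < r - 1 / Suc m"
    then obtain m where "\<And>n. R n \<omega> \<le> r - 1 / Suc m" by (meson less_imp_le)
    then have "S \<omega> \<le> r - 1 / Suc m" by (intro LIMSEQ_le_const2[OF lim(2)]) auto
    moreover have "0 < 1 / real (Suc m)" by simp
    ultimately show "S \<omega> < r" by linarith
  qed
  define E where "E m n = {\<omega> \<in> space P. 0 < r - 1 / Suc m \<and> R n \<omega> < r - 1 / Suc m}" for m n
  have E: "E m n \<in> sets (G r)" for m n
  proof (cases "0 < r - 1 / Suc m")
    case True
    have "r - 1 / Suc m \<le> r" by simp
    then have "{\<omega> \<in> space P. R n \<omega> < r - 1 / Suc m} \<in> sets (G r)"
      using optional_time_less[OF R True] sets_G_mono[of "r - 1 / Suc m" r] True by (meson less_imp_le subsetD)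
    then show ?thesis using True by (simp add: E_def)
  next
    case False
    then show ?thesis by (simp add: E_def)
  qed
  have "(\<Union>m. \<Inter>n. E m n) \<in> sets (G r)" using E by (intro sets.countable_UN sets.countable_INT) auto
  moreover have "(\<Union>m. \<Inter>n. E m n) = {\<omega> \<in> space P. S \<omega> < r}"
    unfolding less E_def by blast
  ultimately show "{\<omega> \<in> space P. S \<omega> < r} \<in> sets (G r)" by simp
next
  show "0 \<le> S \<omega>" for \<omega>
    by (rule LIMSEQ_le_const[OF lim(2)]) (use optional_time_nonneg[OF R] in auto)
qed

lemma grid_index_eq_iff:
  assumes "0 \<le> R \<omega>"
  shows "grid_index R k \<omega> = j \<longleftrightarrow> 0 < j \<and> (real j - 1) / Suc k \<le> R \<omega> \<and> R \<omega> < real j / Suc k"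
proof -
  have "grid_index R k \<omega> = j \<longleftrightarrow> 0 < j \<and> \<lfloor>R \<omega> * Suc k\<rfloor> = int j - 1"
    using assms unfolding grid_index_def by (cases j) (auto simp: nat_eq_iff)
  also have "\<lfloor>R \<omega> * Suc k\<rfloor> = int j - 1 \<longleftrightarrow> real j - 1 \<le> R \<omega> * Suc k \<and> R \<omega> * Suc k < real j"
    by (simp add: floor_eq_iff)
  also have "\<dots> \<longleftrightarrow> (real j - 1) / Suc k \<le> R \<omega> \<and> R \<omega> < real j / Suc k"
    by (simp only: pos_divide_le_eq pos_less_divide_eq of_nat_0_less_iff zero_less_Suc)
  finally show ?thesis .
qed

lemma grid_index_event:
  assumes R: "optional_time R"
  shows "{\<omega> \<in> space P. grid_index R k \<omega> = j} \<in> sets (G (real j / Suc k))"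
proof (cases "0 < j")
  case True
  let ?r = "real j / Suc k" and ?q = "(real j - 1) / Suc k"
  have r: "0 < ?r" "0 \<le> ?q" "?q \<le> ?r" using True by (auto intro!: divide_right_mono)
  have q: "{\<omega> \<in> space P. R \<omega> < s} \<in> sets (G ?r)" if "0 < s" "s \<le> ?r" for s
    using optional_time_less[OF R that(1)] sets_G_mono[of s ?r] that by auto
  have "{\<omega> \<in> space P. R \<omega> < ?q} \<in> sets (G ?r)"
  proof (cases "0 < ?q")
    case True
    then show ?thesis using r(3) by (rule q)
  next
    case False
    then have "\<not> R \<omega> < ?q" for \<omega> using optional_time_nonneg[OF R, of \<omega>] by linarith
    then show ?thesis by simp
  qed
  moreover have "{\<omega> \<in> space P. grid_index R k \<omega> = j} = {\<omega> \<in> space P. R \<omega> < ?r} - {\<omega> \<in> space P. R \<omega> < ?q}"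
    using True by (auto simp: grid_index_eq_iff[of R, OF optional_time_nonneg[OF R]] simp del: of_nat_Suc)
  ultimately show ?thesis using optional_time_less[OF R r(1)] by auto
next
  case False
  then show ?thesis by (simp add: grid_index_eq_iff[of R, OF optional_time_nonneg[OF R]])
qed

lemma grid_index_bounds:
  assumes "0 \<le> R \<omega>"
  shows "R \<omega> < grid_index R k \<omega> / Suc k" "grid_index R k \<omega> / Suc k \<le> R \<omega> + 1 / Suc k"
proof -
  have "(real (grid_index R k \<omega>) - 1) / Suc k \<le> R \<omega> \<and> R \<omega> < grid_index R k \<omega> / Suc k"
    using grid_index_eq_iff[of R \<omega> k, OF assms] by blast
  then show "R \<omega> < grid_index R k \<omega> / Suc k" "grid_index R k \<omega> / Suc k \<le> R \<omega> + 1 / Suc k"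
    by (auto simp: diff_divide_distrib)
qed

lemma grid_tendsto:
  assumes "0 \<le> R \<omega>"
  shows "filterlim (\<lambda>k. grid_index R k \<omega> / Suc k) (at_right (R \<omega>)) sequentially"
  unfolding filterlim_at
proof (intro conjI always_eventually allI)
  let ?D = "\<lambda>k. grid_index R k \<omega> / Suc k"
  have b: "R \<omega> < ?D k" "?D k \<le> R \<omega> + 1 / Suc k" for k
    using grid_index_bounds[of R \<omega> k, OF assms] by blast+
  show "?D k \<in> {R \<omega><..}" for k using b(1)[of k] by (rule greaterThan_iff[THEN iffD2])
  show "?D k \<noteq> R \<omega>" for k using b(1)[of k] by (rule less_imp_neq[THEN not_sym])
  have lim: "(\<lambda>k. R \<omega> + 1 / real (Suc k)) \<longlonglongrightarrow> R \<omega> + 0"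
    by (intro tendsto_add tendsto_const LIMSEQ_Suc[OF lim_1_over_n])
  show "?D \<longlonglongrightarrow> R \<omega>"
  proof (rule tendsto_sandwich)
    show "(\<lambda>_. R \<omega>) \<longlonglongrightarrow> R \<omega>" by (rule tendsto_const)
    show "(\<lambda>k. R \<omega> + 1 / real (Suc k)) \<longlonglongrightarrow> R \<omega>" using lim by (simp only: add_0_right)
    show "eventually (\<lambda>k. R \<omega> \<le> ?D k) sequentially"
      by (intro always_eventually allI less_imp_le b)
    show "eventually (\<lambda>k. ?D k \<le> R \<omega> + 1 / real (Suc k)) sequentially"
      by (intro always_eventually allI b)
  qed
qed

lemma grid_sample_measurable:
  assumes R: "optional_time R" and Y: "\<And>t. 0 \<le> t \<Longrightarrow> Y t \<in> borel_measurable P"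
  shows "(\<lambda>\<omega>. Y (grid_index R k \<omega> / Suc k) \<omega> :: real) \<in> borel_measurable P"
proof (rule measurable_compose_countable[where g="grid_index R k" and f="\<lambda>j. Y (j / Suc k)"])
  show "Y (real j / Suc k) \<in> borel_measurable P" for j by (intro Y) simp
  have "{\<omega> \<in> space P. grid_index R k \<omega> = j} \<in> sets P" for j
    by (rule sets_G[OF _ grid_index_event[OF R]]) simp
  then show "grid_index R k \<in> P \<rightarrow>\<^sub>M count_space UNIV"
    by (simp add: measurable_count_space_eq_countable vimage_def Int_def conj_commute)
qed

lemma sample_measurable:
  assumes R: "optional_time R" and Y: "\<And>t. 0 \<le> t \<Longrightarrow> Y t \<in> borel_measurable P"
    and right: "\<And>\<omega> t. 0 \<le> t \<Longrightarrow> ((\<lambda>s. Y s \<omega>) \<longlongrightarrow> (Y t \<omega> :: real)) (at_right t)"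
  shows "(\<lambda>\<omega>. Y (R \<omega>) \<omega>) \<in> borel_measurable P"
  by (rule borel_measurable_LIMSEQ_real[OF _ grid_sample_measurable[OF R Y]])
    (rule filterlim_compose[OF right[OF optional_time_nonneg[OF R]] grid_tendsto[of R, OF optional_time_nonneg[OF R]]])

text \<open>
  Beyond \<open>R\<close> the process need not be bounded. Truncating on both sides of
  \<open>E[Y\<^sub>D; \<bar>Y\<^sub>D\<bar> \<le> K + 1] = E[Y\<^sub>m; \<bar>Y\<^sub>D\<bar> \<le> K + 1]\<close>, where \<open>D \<le> m\<close> is the discretised time, replaces
  the usual appeal to uniform integrability.
\<close>
lemma bounded_optional_sampling:
  assumes R: "optional_time R" and Rn: "\<And>\<omega>. R \<omega> \<le> real n"
    and Y: "\<And>t. 0 \<le> t \<Longrightarrow> Y t \<in> borel_measurable (G t)" "\<And>t. 0 \<le> t \<Longrightarrow> integrable P (Y t)"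
    and mart: "\<And>s t E. 0 \<le> s \<Longrightarrow> s \<le> t \<Longrightarrow> E \<in> sets (G s) \<Longrightarrow>
      (\<integral>\<omega>. indicator E \<omega> * Y s \<omega> \<partial>P) = (\<integral>\<omega>. indicator E \<omega> * Y t \<omega> \<partial>P)"
    and right: "\<And>\<omega> t. 0 \<le> t \<Longrightarrow> ((\<lambda>s. Y s \<omega>) \<longlongrightarrow> (Y t \<omega> :: real)) (at_right t)"
    and K: "\<And>\<omega>. \<bar>Y (R \<omega>) \<omega>\<bar> \<le> K"
  shows "(\<integral>\<omega>. Y (R \<omega>) \<omega> \<partial>P) = (\<integral>\<omega>. Y 0 \<omega> \<partial>P)"
proof -
  note nn = optional_time_nonneg[OF R]
  have Ym: "Y t \<in> borel_measurable P" if "0 \<le> t" for t using measurable_G[OF that Y(1)[OF that]] .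
  define D where "D k \<omega> = grid_index R k \<omega> / Suc k" for k \<omega>
  \<comment> \<open>The threshold exceeds the bound \<open>K\<close> on \<open>Y\<close> at
    \<open>R\<close>, so the convergence of \<open>Y\<close> at \<open>D k\<close> makes the
    indicator eventually 1.\<close>
  define I where "I k \<omega> = (if \<bar>Y (D k \<omega>) \<omega>\<bar> \<le> K + 1 then 1 else 0 :: real)" for k \<omega>
  \<comment> \<open>The grid time overshoots \<open>R \<le> n\<close> by at most
    \<open>1 / Suc k \<le> 1\<close>.\<close>
  define m where "m = real (Suc n)"
  have m0: "0 \<le> m" by (simp add: m_def)
  have K0: "0 \<le> K" using K order_trans[OF abs_ge_zero] by blast
  have Dm[measurable]: "(\<lambda>\<omega>. Y (D k \<omega>) \<omega>) \<in> borel_measurable P" for k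
    unfolding D_def by (rule grid_sample_measurable[OF R Ym])
  have [measurable]: "(\<lambda>\<omega>. I k \<omega>) \<in> borel_measurable P" for k
    unfolding I_def by measurable
  have [measurable]: "(\<lambda>\<omega>. Y (R \<omega>) \<omega>) \<in> borel_measurable P"
    by (rule sample_measurable[OF R Ym right])
  have [measurable]: "Y m \<in> borel_measurable P" by (rule Ym[OF m0])
  have D: "(\<lambda>k. Y (D k \<omega>) \<omega>) \<longlonglongrightarrow> Y (R \<omega>) \<omega>" for \<omega>
    unfolding D_def by (rule filterlim_compose[OF right[OF nn] grid_tendsto[of R, OF nn]])
  have Ilim: "(\<lambda>k. I k \<omega>) \<longlonglongrightarrow> 1" for \<omega>
  proof (rule tendsto_eventually)
    have "\<bar>Y (R \<omega>) \<omega>\<bar> < K + 1" using K[of \<omega>] by simp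
    from order_tendstoD(2)[OF tendsto_rabs[OF D] this] show "eventually (\<lambda>k. I k \<omega> = 1) sequentially"
      by eventually_elim (simp add: I_def)
  qed
  have eq: "(\<integral>\<omega>. I k \<omega> * Y (D k \<omega>) \<omega> \<partial>P) = (\<integral>\<omega>. I k \<omega> * Y m \<omega> \<partial>P)" for k
  proof -
    \<comment> \<open>\<open>C j\<close> joins the event that the grid time is
      \<open>j / Suc k\<close> with the truncation of \<open>Y\<close> at that very time. It is
      therefore known at that time, and the martingale identity applies on it.\<close>
    define C where "C j = {\<omega> \<in> space P. grid_index R k \<omega> = j} \<inter> {\<omega> \<in> space P. \<bar>Y (j / Suc k) \<omega>\<bar> \<le> K + 1}" for j
    have C: "C j \<in> sets (G (real j / Suc k))" for j
    proof -
      have "{\<omega> \<in> space (G (j / Suc k)). \<bar>Y (j / Suc k) \<omega>\<bar> \<le> K + 1} \<in> sets (G (j / Suc k))"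
        using Y(1)[of "j / Suc k"] by measurable
      then show ?thesis unfolding C_def using grid_index_event[OF R, of k j] by (auto simp: space_G)
    qed
    have jm: "grid_index R k \<omega> \<in> {..Suc n * Suc k}" "D k \<omega> \<le> m" for \<omega>
    proof -
      have "D k \<omega> \<le> R \<omega> + 1 / Suc k" unfolding D_def using grid_index_bounds[of R, OF nn] by blast
      also have "\<dots> \<le> real n + 1" by (intro add_mono Rn) simp
      finally show *: "D k \<omega> \<le> m" by (simp add: m_def)
      then have "real (grid_index R k \<omega>) \<le> m * Suc k" unfolding D_def
        by (subst (asm) pos_divide_le_eq) auto
      also have "\<dots> = real (Suc n * Suc k)" by (simp only: m_def of_nat_mult)
      finally show "grid_index R k \<omega> \<in> {..Suc n * Suc k}" by (simp only: of_nat_le_iff atMost_iff)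
    qed
    have sum: "I k \<omega> * (Y (D k \<omega>) \<omega> - Y m \<omega>) =
      (\<Sum>j\<in>{j\<in>{..Suc n * Suc k}. real j / Suc k \<le> m}. indicator (C j) \<omega> * Y (j / Suc k) \<omega> - indicator (C j) \<omega> * Y m \<omega>)"
      (is "_ = sum ?f ?J") if "\<omega> \<in> space P" for \<omega>
    proof -
      have mem: "grid_index R k \<omega> \<in> ?J" using jm[of \<omega>] by (simp add: D_def)
      have "sum ?f ?J = sum ?f {grid_index R k \<omega>}"
        by (rule sum.mono_neutral_right) (use mem in \<open>auto simp: C_def\<close>)
      also have "\<dots> = I k \<omega> * (Y (D k \<omega>) \<omega> - Y m \<omega>)"
        using that by (simp add: C_def I_def D_def algebra_simps indicator_def)
      finally show ?thesis by simp
    qed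
    have int: "integrable P (\<lambda>\<omega>. indicator (C j) \<omega> * Y t \<omega>)" if "0 \<le> t" for j t
      using integrable_mult_indicator[OF sets_G[OF _ C] Y(2)[OF that], of j] by (simp del: of_nat_Suc)
    have "(\<integral>\<omega>. I k \<omega> * (Y (D k \<omega>) \<omega> - Y m \<omega>) \<partial>P) =
      (\<integral>\<omega>. (\<Sum>j\<in>{j\<in>{..Suc n * Suc k}. real j / Suc k \<le> m}. indicator (C j) \<omega> * Y (j / Suc k) \<omega> - indicator (C j) \<omega> * Y m \<omega>) \<partial>P)"
      by (intro Bochner_Integration.integral_cong refl sum)
    also have "\<dots> = (\<Sum>j\<in>{j\<in>{..Suc n * Suc k}. real j / Suc k \<le> m}.
        (\<integral>\<omega>. indicator (C j) \<omega> * Y (j / Suc k) \<omega> \<partial>P) - (\<integral>\<omega>. indicator (C j) \<omega> * Y m \<omega> \<partial>P))"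
      by (subst Bochner_Integration.integral_sum)
        (auto intro!: Bochner_Integration.integrable_diff int sum.cong Bochner_Integration.integral_diff m0
          simp del: of_nat_Suc)
    also have "\<dots> = 0"
      by (intro sum.neutral ballI) (use mart[OF _ _ C] in \<open>auto simp del: of_nat_Suc\<close>)
    finally have 0: "(\<integral>\<omega>. I k \<omega> * (Y (D k \<omega>) \<omega> - Y m \<omega>) \<partial>P) = 0" .
    have i1: "integrable P (\<lambda>\<omega>. I k \<omega> * Y (D k \<omega>) \<omega>)"
      by (rule integrable_const_bound[of _ "K + 1"]) (use K0 in \<open>auto simp: I_def\<close>)
    have i2: "integrable P (\<lambda>\<omega>. I k \<omega> * Y m \<omega>)"
      by (rule Bochner_Integration.integrable_bound[OF Y(2)[OF m0]]) (auto, auto simp: I_def)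
    show ?thesis using 0 Bochner_Integration.integral_diff[OF i1 i2] by (simp add: right_diff_distrib)
  qed
  have "(\<lambda>k. \<integral>\<omega>. I k \<omega> * Y (D k \<omega>) \<omega> \<partial>P) \<longlonglongrightarrow> (\<integral>\<omega>. 1 * Y (R \<omega>) \<omega> \<partial>P)"
  proof (rule integral_dominated_convergence[where w="\<lambda>_. K + 1"])
    show "AE \<omega> in P. norm (I k \<omega> * Y (D k \<omega>) \<omega>) \<le> K + 1" for k using K0 by (auto simp: I_def)
    show "AE \<omega> in P. (\<lambda>k. I k \<omega> * Y (D k \<omega>) \<omega>) \<longlonglongrightarrow> 1 * Y (R \<omega>) \<omega>"
      by (intro always_eventually allI tendsto_mult Ilim D)
  qed auto
  moreover have "(\<lambda>k. \<integral>\<omega>. I k \<omega> * Y m \<omega> \<partial>P) \<longlonglongrightarrow> (\<integral>\<omega>. 1 * Y m \<omega> \<partial>P)"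
  proof (rule integral_dominated_convergence[where w="\<lambda>\<omega>. \<bar>Y m \<omega>\<bar>"])
    show "AE \<omega> in P. (\<lambda>k. I k \<omega> * Y m \<omega>) \<longlonglongrightarrow> 1 * Y m \<omega>"
      by (intro always_eventually allI tendsto_mult Ilim tendsto_const)
    show "AE \<omega> in P. norm (I k \<omega> * Y m \<omega>) \<le> \<bar>Y m \<omega>\<bar>" for k by (auto simp: I_def)
    show "integrable P (\<lambda>\<omega>. \<bar>Y m \<omega>\<bar>)" using Y(2)[OF m0] by simp
  qed auto
  ultimately have "(\<integral>\<omega>. Y (R \<omega>) \<omega> \<partial>P) = (\<integral>\<omega>. Y m \<omega> \<partial>P)"
    unfolding eq by (auto dest: LIMSEQ_unique)
  moreover have "(\<integral>\<omega>. Y 0 \<omega> \<partial>P) = (\<integral>\<omega>. Y m \<omega> \<partial>P)"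
  proof -
    have "(\<integral>\<omega>. indicator (space P) \<omega> * Y 0 \<omega> \<partial>P) = (\<integral>\<omega>. indicator (space P) \<omega> * Y m \<omega> \<partial>P)"
      using mart[of 0 m "space P"] sets.top[of "G 0"] m0 by (simp add: space_G)
    moreover have "(\<integral>\<omega>. indicator (space P) \<omega> * Y t \<omega> \<partial>P) = (\<integral>\<omega>. Y t \<omega> \<partial>P)" for t
      by (intro Bochner_Integration.integral_cong) auto
    ultimately show ?thesis by simp
  qed
  ultimately show ?thesis by simp
qed

end

text \<open>Every path is regular here, not just almost every one, so that all times are defined and
  nonnegative everywhere; the general case is reduced to this one by a change on a null set. The
  martingale property is stated by integrals over events, the form in which it survives that
  change.\<close>

locale Sigma_process = real_filtration P G + complete_measure P
  for P :: "'a measure" and G :: "real \<Rightarrow> 'a measure" +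
  fixes X A :: "real \<Rightarrow> 'a \<Rightarrow> real" and \<sigma> :: "nat \<Rightarrow> 'a \<Rightarrow> ennreal"
  assumes path: "Sigma_path (\<lambda>t. X t \<omega>) (\<lambda>t. A t \<omega>)"
    and X_adapted: "0 \<le> t \<Longrightarrow> X t \<in> borel_measurable (G t)"
    and A_adapted: "0 \<le> t \<Longrightarrow> A t \<in> borel_measurable (G t)"
    and stopped_adapted: "0 \<le> t \<Longrightarrow> stopped (\<lambda>t \<omega>. X t \<omega> - A t \<omega>) (\<sigma> n) t \<in> borel_measurable (G t)"
    and stopped_integrable: "0 \<le> t \<Longrightarrow> integrable P (stopped (\<lambda>t \<omega>. X t \<omega> - A t \<omega>) (\<sigma> n) t)"
    and stopped_martingale: "0 \<le> s \<Longrightarrow> s \<le> t \<Longrightarrow> E \<in> sets (G s) \<Longrightarrow>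
      (\<integral>\<omega>. indicator E \<omega> * stopped (\<lambda>t \<omega>. X t \<omega> - A t \<omega>) (\<sigma> n) s \<omega> \<partial>P) =
      (\<integral>\<omega>. indicator E \<omega> * stopped (\<lambda>t \<omega>. X t \<omega> - A t \<omega>) (\<sigma> n) t \<omega> \<partial>P)"
    and localizing_top: "AE \<omega> in P. (\<lambda>n. \<sigma> n \<omega>) \<longlonglongrightarrow> \<infinity>"
begin

text \<open>Just after \<open>t\<close> the stopped path still follows \<open>X - A\<close> if
  \<open>t < S\<close>, and is already frozen otherwise.\<close>

lemma stopped_right:
  assumes "0 \<le> t"
  shows "((\<lambda>s. stopped (\<lambda>t \<omega>. X t \<omega> - A t \<omega>) S s \<omega>) \<longlongrightarrow> stopped (\<lambda>t \<omega>. X t \<omega> - A t \<omega>) S t \<omega>) (at_right t)"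
proof -
  interpret Sigma_path "\<lambda>t. X t \<omega>" "\<lambda>t. A t \<omega>" by (rule path)
  have right: "((\<lambda>s. X s \<omega> - A s \<omega>) \<longlongrightarrow> X t \<omega> - A t \<omega>) (at_right t)"
    by (intro tendsto_diff x_right a_right assms)
  have gt: "eventually (\<lambda>s. t < s) (at_right t)" by (rule eventually_at_right_less)
  show ?thesis
  proof (cases "ennreal t < S \<omega>")
    case True
    obtain u where u: "t < u" "ennreal u \<le> S \<omega>"
    proof (cases "S \<omega>")
      case (real r)
      then show ?thesis using that[of r] True assms by (auto simp: ennreal_less_iff)
    next
      case top
      then show ?thesis using that[of "t + 1"] by simp
    qed
    have "eventually (\<lambda>s. s < u) (at_right t)"
      using eventually_at_right_real[OF u(1)] by eventually_elim simp
    with gt have ev: "eventually (\<lambda>s. X s \<omega> - A s \<omega> = stopped (\<lambda>t \<omega>. X t \<omega> - A t \<omega>) S s \<omega>) (at_right t)"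
    proof eventually_elim
      case (elim s)
      then have "ennreal s \<le> S \<omega>" using u(2) ennreal_leI[of s u] by (auto intro: order_trans)
      then show ?case using elim assms by (simp add: stopped_def min_absorb1)
    qed
    have "stopped (\<lambda>t \<omega>. X t \<omega> - A t \<omega>) S t \<omega> = X t \<omega> - A t \<omega>"
      using True assms by (simp add: stopped_def min_absorb1 less_imp_le)
    with right ev show ?thesis by (simp add: tendsto_cong[OF ev])
  next
    case False
    then have le: "S \<omega> \<le> ennreal t" by simp
    from gt have "eventually (\<lambda>s. stopped (\<lambda>t \<omega>. X t \<omega> - A t \<omega>) S s \<omega> = stopped (\<lambda>t \<omega>. X t \<omega> - A t \<omega>) S t \<omega>) (at_right t)"
    proof eventually_elim
      case (elim s)
      then have "S \<omega> \<le> ennreal s" using le ennreal_leI[of t s] by (auto intro: order_trans)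
      then show ?case using le by (simp add: stopped_def min_absorb2)
    qed
    then show ?thesis by (rule tendsto_eventually)
  qed
qed

text \<open>The bound is required along the whole path up to \<open>R\<close>, because
  \<open>\<sigma> n\<close> and the truncation at \<open>n\<close> may stop earlier. With it,
  dominated convergence removes both.\<close>

lemma optional_sampling:
  assumes R: "optional_time R"
    and K: "\<And>\<omega> s. 0 \<le> s \<Longrightarrow> s \<le> R \<omega> \<Longrightarrow> \<bar>X s \<omega> - A s \<omega>\<bar> \<le> K"
  shows "(\<integral>\<omega>. X (R \<omega>) \<omega> - A (R \<omega>) \<omega> \<partial>P) = 0"
proof -
  note nn = optional_time_nonneg[OF R]
  let ?N = "\<lambda>t \<omega>. X t \<omega> - A t \<omega>"
  let ?S = "\<lambda>n \<omega>. stopped ?N (\<sigma> n) (min (R \<omega>) (real n)) \<omega>"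
  have Rn: "optional_time (\<lambda>\<omega>. min (R \<omega>) (real n))" for n
    by (rule optional_time_min_const[OF R]) simp
  have SK: "\<bar>?S n \<omega>\<bar> \<le> K" for n \<omega>
  proof -
    have "enn2real (min (ennreal (min (R \<omega>) (real n))) (\<sigma> n \<omega>)) \<le> enn2real (ennreal (min (R \<omega>) (real n)))"
      by (intro enn2real_mono) auto
    also have "\<dots> \<le> R \<omega>" using nn[of \<omega>] by simp
    finally show ?thesis unfolding stopped_def by (intro K) auto
  qed
  have "(\<integral>\<omega>. ?S n \<omega> \<partial>P) = (\<integral>\<omega>. stopped ?N (\<sigma> n) 0 \<omega> \<partial>P)" for n
    by (rule bounded_optional_sampling[OF Rn min.cobounded2 stopped_adapted stopped_integrable
          stopped_martingale stopped_right SK])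
  moreover have "stopped ?N (\<sigma> n) 0 \<omega> = 0" for n \<omega>
    using Sigma_path.x_0[OF path, of \<omega>] Sigma_path.a_0[OF path, of \<omega>] by (simp add: stopped_def)
  ultimately have 0: "(\<integral>\<omega>. ?S n \<omega> \<partial>P) = 0" for n by simp
  have m: "?S n \<in> borel_measurable P" for n
    by (rule sample_measurable[OF Rn measurable_G[OF _ stopped_adapted] stopped_right])
  have Nm: "(\<lambda>\<omega>. ?N (R \<omega>) \<omega>) \<in> borel_measurable P"
    by (intro borel_measurable_diff sample_measurable[OF R measurable_G[OF _ X_adapted]]
        sample_measurable[OF R measurable_G[OF _ A_adapted]])
      (auto intro: Sigma_path.x_right[OF path] Sigma_path.a_right[OF path])
  have "(\<lambda>n. \<integral>\<omega>. ?S n \<omega> \<partial>P) \<longlonglongrightarrow> (\<integral>\<omega>. ?N (R \<omega>) \<omega> \<partial>P)"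
  proof (rule integral_dominated_convergence[where w="\<lambda>_. K"])
    show "AE \<omega> in P. (\<lambda>n. ?S n \<omega>) \<longlonglongrightarrow> ?N (R \<omega>) \<omega>"
      using localizing_top
    proof eventually_elim
      case (elim \<omega>)
      have "ennreal (R \<omega>) < \<infinity>" by simp
      from order_tendstoD(1)[OF elim this]
      have e1: "eventually (\<lambda>n. ennreal (R \<omega>) < \<sigma> n \<omega>) sequentially" .
      obtain m :: nat where "R \<omega> \<le> real m" using real_arch_simple by blast
      then have e2: "eventually (\<lambda>n. R \<omega> \<le> real n) sequentially"
        using order_trans by (intro eventually_sequentiallyI[of m]) fastforce
      from e1 e2 have "eventually (\<lambda>n. ?S n \<omega> = ?N (R \<omega>) \<omega>) sequentially"
        by eventually_elim (use nn[of \<omega>] in \<open>simp add: stopped_def min_absorb1 less_imp_le\<close>)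
      then show ?case by (rule tendsto_eventually)
    qed
    show "AE \<omega> in P. norm (?S n \<omega>) \<le> K" for n using SK by auto
  qed (use m Nm in auto)
  then show ?thesis unfolding 0 by (simp add: LIMSEQ_const_iff)
qed

end

section \<open>The law of \<open>A\<close> at the contact time\<close>

locale Sigma_process_level = Sigma_process P G X A \<sigma>
  for P :: "'a measure" and G :: "real \<Rightarrow> 'a measure" and X A :: "real \<Rightarrow> 'a \<Rightarrow> real"
    and \<sigma> :: "nat \<Rightarrow> 'a \<Rightarrow> ennreal" +
  fixes g :: "real \<Rightarrow> real" and c :: real
  assumes level_mono: "mono g" and level_right: "(g \<longlongrightarrow> g z) (at_right z)"
    and level_pos: "0 < c" and level_ge: "c \<le> g z"
begin

abbreviation near_time :: "real \<Rightarrow> nat \<Rightarrow> 'a \<Rightarrow> real" where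
  "near_time v n \<omega> \<equiv> Sigma_path_level.near (\<lambda>t. X t \<omega>) (\<lambda>t. A t \<omega>) g v n"

abbreviation near_end :: "real \<Rightarrow> 'a \<Rightarrow> real" where
  "near_end v \<omega> \<equiv> Sigma_path_level.near_lim (\<lambda>t. X t \<omega>) (\<lambda>t. A t \<omega>) g v"

abbreviation touch :: "'a \<Rightarrow> real \<Rightarrow> bool" where
  "touch \<omega> \<equiv> Sigma_path_level.contact (\<lambda>t. X t \<omega>) (\<lambda>t. A t \<omega>) g"

abbreviation touch_time :: "'a \<Rightarrow> real" where
  "touch_time \<omega> \<equiv> Sigma_path_level.contact_time (\<lambda>t. X t \<omega>) (\<lambda>t. A t \<omega>) g"

abbreviation touch_level :: "'a \<Rightarrow> ennreal" where
  "touch_level \<omega> \<equiv> Sigma_path_level.contact_level (\<lambda>t. X t \<omega>) (\<lambda>t. A t \<omega>) g"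

lemma path_level: "Sigma_path_level (\<lambda>t. X t \<omega>) (\<lambda>t. A t \<omega>) g c"
  by (intro Sigma_path_level.intro path Sigma_path_level_axioms.intro
      level_mono level_right level_pos level_ge)

lemma level_borel[measurable]: "g \<in> borel_measurable borel"
  by (rule borel_measurable_mono[OF level_mono])

lemma X_right: "0 \<le> t \<Longrightarrow> ((\<lambda>s. X s \<omega>) \<longlongrightarrow> X t \<omega>) (at_right t)"
  by (rule Sigma_path.x_right[OF path])

lemma A_right: "0 \<le> t \<Longrightarrow> ((\<lambda>s. A s \<omega>) \<longlongrightarrow> A t \<omega>) (at_right t)"
  by (rule Sigma_path.a_right[OF path])

lemma X_sample_measurable: "optional_time R \<Longrightarrow> (\<lambda>\<omega>. X (R \<omega>) \<omega>) \<in> borel_measurable P"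
  by (rule sample_measurable[OF _ measurable_G[OF _ X_adapted] X_right])

lemma A_sample_measurable: "optional_time R \<Longrightarrow> (\<lambda>\<omega>. A (R \<omega>) \<omega>) \<in> borel_measurable P"
  by (rule sample_measurable[OF _ measurable_G[OF _ A_adapted] A_right])

lemma near_event:
  assumes "0 \<le> q"
  shows "{\<omega> \<in> space P. g (A q \<omega>) - e < X q \<omega>} \<in> sets (G q)"
proof -
  have [measurable]: "A q \<in> borel_measurable (G q)" "X q \<in> borel_measurable (G q)"
    using X_adapted A_adapted assms by auto
  have "{\<omega> \<in> space (G q). g (A q \<omega>) - e < X q \<omega>} \<in> sets (G q)" by measurable
  then show ?thesis by (simp add: space_G assms)
qed

lemma near_optional: "optional_time (near_time v n)"
  unfolding optional_time_def
proof (intro conjI allI impI)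
  show "0 \<le> near_time v n \<omega>" for \<omega> by (rule Sigma_path_level.near_nonneg[OF path_level])
  fix r :: real assume r: "0 < r"
  define E where "E q = {\<omega> \<in> space P. v < A q \<omega>} \<union> {\<omega> \<in> space P. g (A q \<omega>) - 1 / Suc n < X q \<omega>}" for q
  have "E q \<in> sets (G r)" if "q \<in> {q \<in> \<rat>. 0 \<le> q \<and> q < r}" for q
  proof -
    have q: "0 \<le> q" "q \<le> r" using that by auto
    have [measurable]: "A q \<in> borel_measurable (G q)" using A_adapted q by auto
    have "{\<omega> \<in> space (G q). v < A q \<omega>} \<in> sets (G q)" by measurable
    then have "E q \<in> sets (G q)" using near_event[OF q(1)] q unfolding E_def by (auto simp: space_G)
    then show ?thesis using sets_G_mono[OF q] by auto
  qed
  then have "(\<Union>q\<in>{q \<in> \<rat>. 0 \<le> q \<and> q < r}. E q) \<in> sets (G r)"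
    by (intro sets.countable_UN' countable_subset[OF _ countable_rat]) auto
  also have "(\<Union>q\<in>{q \<in> \<rat>. 0 \<le> q \<and> q < r}. E q) = {\<omega> \<in> space P. near_time v n \<omega> < r}"
    unfolding Sigma_path_level.near_less_iff_rat[OF path_level] E_def by blast
  finally show "{\<omega> \<in> space P. near_time v n \<omega> < r} \<in> sets (G r)" .
qed

lemma near_end_optional: "optional_time (near_end v)"
  by (rule optional_time_SUP[OF near_optional Sigma_path_level.near_mono[OF path_level]
        Sigma_path_level.near_tendsto[OF path_level]])

lemma bounds_until_near_end:
  assumes "0 \<le> v" "0 \<le> s" "s \<le> near_end v \<omega>"
  shows "0 \<le> X s \<omega>" "X s \<omega> \<le> g v" "0 \<le> A s \<omega>" "A s \<omega> \<le> v" "\<bar>X s \<omega> - A s \<omega>\<bar> \<le> g v + v"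
proof -
  show a: "0 \<le> X s \<omega>" "0 \<le> A s \<omega>"
    using Sigma_path.x_nonneg[OF path] Sigma_path.a_nonneg[OF path] assms by auto
  show b: "A s \<omega> \<le> v" by (rule Sigma_path_level.a_le_until_near_lim[OF path_level assms])
  have "X s \<omega> \<le> g (A s \<omega>)" by (rule Sigma_path_level.x_le_until_near_lim[OF path_level assms(2,3)])
  also have "\<dots> \<le> g v" using b level_mono by (auto simp: mono_def)
  finally show d: "X s \<omega> \<le> g v" .
  show "\<bar>X s \<omega> - A s \<omega>\<bar> \<le> g v + v" using a b d assms(1) by auto
qed

lemma near_le_end: "near_time v n \<omega> \<le> near_end v \<omega>"
  by (rule Sigma_path_level.near_le_lim[OF path_level])

lemma sampling_near:
  assumes "0 \<le> v"
  shows "(\<integral>\<omega>. X (near_time v n \<omega>) \<omega> - A (near_time v n \<omega>) \<omega> \<partial>P) = 0"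
  using bounds_until_near_end(5)[OF assms] near_le_end
  by (intro optional_sampling[OF near_optional, where K="g v + v"]) (meson order_trans)

lemma sampling_near_end:
  assumes "0 \<le> v"
  shows "(\<integral>\<omega>. X (near_end v \<omega>) \<omega> - A (near_end v \<omega>) \<omega> \<partial>P) = 0"
  using bounds_until_near_end(5)[OF assms]
  by (intro optional_sampling[OF near_end_optional, where K="g v + v"])

lemma near_end_nonneg: "0 \<le> near_end v \<omega>"
  by (rule Sigma_path_level.near_lim_nonneg[OF path_level])

lemma near_nonneg: "0 \<le> near_time v n \<omega>"
  by (rule Sigma_path_level.near_nonneg[OF path_level])

text \<open>
  The only possible jump of \<open>X\<close> at \<open>near_end v\<close> is downward, and its expectation vanishes
  because \<open>near_end v\<close> is announced by the times \<open>near_time v n\<close>.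
\<close>
lemma AE_X_near_tendsto:
  assumes v: "0 \<le> v"
  shows "AE \<omega> in P. (\<lambda>n. X (near_time v n \<omega>) \<omega>) \<longlonglongrightarrow> X (near_end v \<omega>) \<omega>"
proof -
  have "\<exists>l. \<forall>\<omega>. l \<omega> \<ge> X (near_end v \<omega>) \<omega> \<and> (\<lambda>n. X (near_time v n \<omega>) \<omega>) \<longlonglongrightarrow> l \<omega>"
    by (intro choice allI) (use Sigma_path_level.x_near_tendsto[OF path_level] in blast)
  then obtain l where l: "\<And>\<omega>. X (near_end v \<omega>) \<omega> \<le> l \<omega>"
    "\<And>\<omega>. (\<lambda>n. X (near_time v n \<omega>) \<omega>) \<longlonglongrightarrow> l \<omega>" by blast
  have A_lim: "(\<lambda>n. A (near_time v n \<omega>) \<omega>) \<longlonglongrightarrow> A (near_end v \<omega>) \<omega>" for \<omega>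
    by (rule continuous_on_tendsto_compose[OF Sigma_path.a_cont[OF path]
          Sigma_path_level.near_tendsto[OF path_level]])
      (auto simp: near_end_nonneg near_nonneg)
  note [measurable] = X_sample_measurable[OF near_optional] A_sample_measurable[OF near_optional]
    X_sample_measurable[OF near_end_optional] A_sample_measurable[OF near_end_optional]
  have [measurable]: "l \<in> borel_measurable P"
    by (rule borel_measurable_LIMSEQ_real[OF l(2)]) measurable
  let ?D = "\<lambda>n \<omega>. (X (near_time v n \<omega>) \<omega> - A (near_time v n \<omega>) \<omega>) - (X (near_end v \<omega>) \<omega> - A (near_end v \<omega>) \<omega>)"
  have b: "\<bar>X (near_time v n \<omega>) \<omega> - A (near_time v n \<omega>) \<omega>\<bar> \<le> g v + v"
    "\<bar>X (near_end v \<omega>) \<omega> - A (near_end v \<omega>) \<omega>\<bar> \<le> g v + v" for n \<omega>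
    using bounds_until_near_end(5)[OF v] near_le_end near_nonneg near_end_nonneg by auto
  have int: "integrable P (\<lambda>\<omega>. X (near_time v n \<omega>) \<omega> - A (near_time v n \<omega>) \<omega>)"
    "integrable P (\<lambda>\<omega>. X (near_end v \<omega>) \<omega> - A (near_end v \<omega>) \<omega>)" for n
    by (rule integrable_const_bound[of _ "g v + v"]; use b in simp)+
  have "(\<lambda>n. \<integral>\<omega>. ?D n \<omega> \<partial>P) \<longlonglongrightarrow>
    (\<integral>\<omega>. (l \<omega> - A (near_end v \<omega>) \<omega>) - (X (near_end v \<omega>) \<omega> - A (near_end v \<omega>) \<omega>) \<partial>P)"
  proof (rule integral_dominated_convergence[where w="\<lambda>_. 2 * (g v + v)"])
    show "AE \<omega> in P. (\<lambda>n. ?D n \<omega>) \<longlonglongrightarrow> (l \<omega> - A (near_end v \<omega>) \<omega>) - (X (near_end v \<omega>) \<omega> - A (near_end v \<omega>) \<omega>)"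
      by (intro always_eventually allI tendsto_diff l A_lim tendsto_const)
    show "AE \<omega> in P. norm (?D n \<omega>) \<le> 2 * (g v + v)" for n
    proof (intro always_eventually allI)
      fix \<omega> show "norm (?D n \<omega>) \<le> 2 * (g v + v)" using b(1)[of \<omega> n] b(2)[of \<omega>] by simp
    qed
  qed auto
  moreover have "(\<integral>\<omega>. ?D n \<omega> \<partial>P) = 0" for n
    by (subst Bochner_Integration.integral_diff[OF int]) (simp add: sampling_near sampling_near_end v)
  ultimately have "(\<integral>\<omega>. l \<omega> - X (near_end v \<omega>) \<omega> \<partial>P) = 0" by (simp add: LIMSEQ_const_iff)
  moreover have "integrable P (\<lambda>\<omega>. l \<omega> - X (near_end v \<omega>) \<omega>)"
  proof (rule integrable_const_bound[of _ "g v"])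
    show "AE \<omega> in P. norm (l \<omega> - X (near_end v \<omega>) \<omega>) \<le> g v"
    proof (intro always_eventually allI)
      fix \<omega>
      have "l \<omega> \<le> g v"
        by (rule LIMSEQ_le_const2[OF l(2)]) (use bounds_until_near_end(2)[OF v near_nonneg near_le_end] in auto)
      then show "norm (l \<omega> - X (near_end v \<omega>) \<omega>) \<le> g v"
        using l(1)[of \<omega>] bounds_until_near_end(1)[OF v near_end_nonneg order_refl, of \<omega>] by simp
    qed
  qed measurable
  ultimately have "AE \<omega> in P. l \<omega> - X (near_end v \<omega>) \<omega> = 0"
    using l(1) by (subst (asm) integral_nonneg_eq_0_iff_AE) auto
  then show ?thesis
  proof eventually_elim
    case (elim \<omega>)
    then have "l \<omega> = X (near_end v \<omega>) \<omega>" by simp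
    then show ?case using l(2)[of \<omega>] by simp
  qed
qed

lemma AE_near_end_cases:
  assumes v: "0 \<le> v"
  shows "AE \<omega> in P. (if touch_level \<omega> \<le> ennreal v
    then X (near_end v \<omega>) \<omega> = g (enn2real (touch_level \<omega>)) \<and> A (near_end v \<omega>) \<omega> = enn2real (touch_level \<omega>)
    else X (near_end v \<omega>) \<omega> = 0 \<and> A (near_end v \<omega>) \<omega> = v)"
  using AE_X_near_tendsto[OF v]
proof eventually_elim
  case (elim \<omega>)
  interpret p: Sigma_path_level "\<lambda>t. X t \<omega>" "\<lambda>t. A t \<omega>" g c by (rule path_level)
  from v elim show ?case
  proof (cases rule: p.contact_level_cases)
    case 1
    then show ?thesis by (simp add: not_le[symmetric])
  next
    case 2
    then have "0 \<le> A (touch_time \<omega>) \<omega>" using p.a_nonneg near_end_nonneg[of \<omega> v] by simp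
    with 2 show ?thesis by (simp add: ennreal_leI)
  qed
qed

text \<open>Up to a null set the event is \<open>0 < X\<close> at \<open>near_end v\<close>: the
  barrier is at least \<open>c > 0\<close> at a contact, and \<open>X\<close> vanishes there in the
  other case. Completeness of \<open>P\<close> turns this into measurability.\<close>

lemma touch_level_event:
  assumes v: "0 \<le> v"
  shows "{\<omega> \<in> space P. touch_level \<omega> \<le> ennreal v} \<in> sets P"
proof -
  note [measurable] = X_sample_measurable[OF near_end_optional[of v]]
  have "AE \<omega> in P. \<omega> \<in> {\<omega> \<in> space P. 0 < X (near_end v \<omega>) \<omega>} \<longleftrightarrow>
      \<omega> \<in> {\<omega> \<in> space P. touch_level \<omega> \<le> ennreal v}"
    using AE_near_end_cases[OF v]
  proof eventually_elim
    case (elim \<omega>)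
    then show ?case using level_pos level_ge[of "enn2real (touch_level \<omega>)"] by (auto split: if_splits)
  qed
  then show ?thesis by (rule in_sets_AE) auto
qed

lemma touch_level_measurable[measurable]: "touch_level \<in> borel_measurable P"
proof (rule borel_measurableI_le)
  fix y :: ennreal
  show "{\<omega> \<in> space P. touch_level \<omega> \<le> y} \<in> sets P"
    by (cases y) (auto intro: touch_level_event)
qed

section \<open>Decay of the survival function of the contact level\<close>

definition survival :: "real \<Rightarrow> real" where
  "survival v = prob {\<omega> \<in> space P. ennreal v < touch_level \<omega>}"

lemma X_near_end_integrable: "0 \<le> v \<Longrightarrow> integrable P (\<lambda>\<omega>. X (near_end v \<omega>) \<omega>)"
  using bounds_until_near_end(1,2)[OF _ near_end_nonneg order_refl]
  by (intro integrable_const_bound[of _ "g v"] X_sample_measurable near_end_optional) auto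

lemma A_near_end_integrable: "0 \<le> v \<Longrightarrow> integrable P (\<lambda>\<omega>. A (near_end v \<omega>) \<omega>)"
  using bounds_until_near_end(3,4)[OF _ near_end_nonneg order_refl]
  by (intro integrable_const_bound[of _ v] A_sample_measurable near_end_optional) auto

lemma expectation_near_end:
  assumes "0 \<le> v"
  shows "(\<integral>\<omega>. X (near_end v \<omega>) \<omega> \<partial>P) = (\<integral>\<omega>. A (near_end v \<omega>) \<omega> \<partial>P)"
  using sampling_near_end[OF assms] X_near_end_integrable[OF assms] A_near_end_integrable[OF assms] by simp

text \<open>Subtract the identity \<open>E[X] = E[A]\<close> at \<open>near_end v\<close> from the
  one at \<open>near_end w\<close>, and let \<open>Z\<close> be the contact level. The increment of
  \<open>X\<close> is \<open>g(Z)\<close> on \<open>v < Z \<le> w\<close> and 0 elsewhere, hence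
  between \<open>g v\<close> and \<open>g w\<close> times that indicator. The increment of
  \<open>A\<close> is \<open>w - v\<close> if \<open>w < Z\<close>, 0 if \<open>Z \<le> v\<close>,
  and between these values otherwise.\<close>

lemma survival_ineqs:
  assumes v: "0 \<le> v" and w: "v \<le> w"
  shows "(w - v) * survival w \<le> g w * (survival v - survival w)"
    and "g v * (survival v - survival w) \<le> (w - v) * survival v"
proof -
  have w0: "0 \<le> w" using v w by simp
  define Ev where "Ev = {\<omega> \<in> space P. ennreal v < touch_level \<omega>}"
  define Ew where "Ew = {\<omega> \<in> space P. ennreal w < touch_level \<omega>}"
  have E[measurable]: "Ev \<in> sets P" "Ew \<in> sets P" unfolding Ev_def Ew_def by measurable
  have indI: "integrable P (\<lambda>\<omega>. k * indicator E \<omega> :: real)" if "E \<in> sets P" for E k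
    using that by (intro integrable_mult_right integrable_const_bound[of _ 1]) auto
  have int: "integrable P (\<lambda>\<omega>. k * (indicator Ev \<omega> - indicator Ew \<omega> :: real))" for k
    unfolding right_diff_distrib by (intro Bochner_Integration.integrable_diff indI E)
  have intX: "integrable P (\<lambda>\<omega>. X (near_end w \<omega>) \<omega> - X (near_end v \<omega>) \<omega>)"
    by (intro Bochner_Integration.integrable_diff X_near_end_integrable v w0)
  have intA: "integrable P (\<lambda>\<omega>. A (near_end w \<omega>) \<omega> - A (near_end v \<omega>) \<omega>)"
    by (intro Bochner_Integration.integrable_diff A_near_end_integrable v w0)
  have ind1: "(\<integral>\<omega>. k * indicator Ev \<omega> \<partial>P) = k * survival v" "(\<integral>\<omega>. k * indicator Ew \<omega> \<partial>P) = k * survival w" for k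
    using sets.sets_into_space[OF E(1)] sets.sets_into_space[OF E(2)]
    by (simp_all add: survival_def Int_absorb2 Ev_def[symmetric] Ew_def[symmetric])
  have ind: "(\<integral>\<omega>. k * (indicator Ev \<omega> - indicator Ew \<omega>) \<partial>P) = k * (survival v - survival w)" for k
    by (simp only: right_diff_distrib ind1 Bochner_Integration.integral_diff[OF indI[OF E(1)] indI[OF E(2)]])
  have eq: "(\<integral>\<omega>. X (near_end w \<omega>) \<omega> - X (near_end v \<omega>) \<omega> \<partial>P) = (\<integral>\<omega>. A (near_end w \<omega>) \<omega> - A (near_end v \<omega>) \<omega> \<partial>P)"
    using v w0 by (simp add: X_near_end_integrable A_near_end_integrable expectation_near_end)
  have ae: "AE \<omega> in P.
     g v * (indicator Ev \<omega> - indicator Ew \<omega>) \<le> X (near_end w \<omega>) \<omega> - X (near_end v \<omega>) \<omega> \<and>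
     X (near_end w \<omega>) \<omega> - X (near_end v \<omega>) \<omega> \<le> g w * (indicator Ev \<omega> - indicator Ew \<omega>) \<and>
     (w - v) * indicator Ew \<omega> \<le> A (near_end w \<omega>) \<omega> - A (near_end v \<omega>) \<omega> \<and>
     A (near_end w \<omega>) \<omega> - A (near_end v \<omega>) \<omega> \<le> (w - v) * indicator Ev \<omega>"
    using AE_near_end_cases[OF v] AE_near_end_cases[OF w0] AE_space
  proof eventually_elim
    case (elim \<omega>)
    have mono: "g x \<le> g y" if "x \<le> y" for x y using level_mono that by (auto simp: mono_def)
    consider "touch_level \<omega> \<le> ennreal v" | "ennreal v < touch_level \<omega>" "touch_level \<omega> \<le> ennreal w"
      | "ennreal w < touch_level \<omega>" by force
    then show ?case
    proof cases
      case 1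
      then have "touch_level \<omega> \<le> ennreal w" using ennreal_leI[OF w] by (rule order_trans)
      moreover have "indicator Ev \<omega> = (0 :: real)" "indicator Ew \<omega> = (0 :: real)"
        using 1 calculation by (auto simp: Ev_def Ew_def not_less[symmetric])
      ultimately show ?thesis using 1 elim by simp
    next
      case 2
      then obtain r where r: "touch_level \<omega> = ennreal r" "0 \<le> r"
        by (cases "touch_level \<omega>") (auto simp: top_unique)
      with 2 have "v < r" "r \<le> w" using v w0 by (auto simp: ennreal_less_iff)
      moreover have "\<not> touch_level \<omega> \<le> ennreal v" using 2 by simp
      moreover have "indicator Ev \<omega> = (1 :: real)" "indicator Ew \<omega> = (0 :: real)"
        using 2 elim by (auto simp: Ev_def Ew_def not_less[symmetric])
      moreover have "enn2real (touch_level \<omega>) = r" using r by simp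
      ultimately show ?thesis using 2(2) elim mono[of v r] mono[of r w] by simp
    next
      case 3
      then have "ennreal v < touch_level \<omega>" using ennreal_leI[OF w] by (rule le_less_trans[rotated])
      moreover from this have "\<not> touch_level \<omega> \<le> ennreal v" "\<not> touch_level \<omega> \<le> ennreal w" using 3 by auto
      moreover have "indicator Ev \<omega> = (1 :: real)" "indicator Ew \<omega> = (1 :: real)"
        using 3 calculation elim by (auto simp: Ev_def Ew_def)
      ultimately show ?thesis using elim by simp
    qed
  qed
  note aes = ae[unfolded AE_conj_iff]
  have "g v * (survival v - survival w) \<le> (\<integral>\<omega>. X (near_end w \<omega>) \<omega> - X (near_end v \<omega>) \<omega> \<partial>P)"
    unfolding ind[symmetric] using aes by (intro integral_mono_AE int intX) blast
  also have "\<dots> \<le> (\<integral>\<omega>. (w - v) * indicator Ev \<omega> \<partial>P)"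
    unfolding eq using aes by (intro integral_mono_AE intA indI E) blast
  also have "\<dots> = (w - v) * survival v" by (rule ind1)
  finally show "g v * (survival v - survival w) \<le> (w - v) * survival v" .
  have "(w - v) * survival w = (\<integral>\<omega>. (w - v) * indicator Ew \<omega> \<partial>P)" by (rule ind1[symmetric])
  also have "\<dots> \<le> (\<integral>\<omega>. A (near_end w \<omega>) \<omega> - A (near_end v \<omega>) \<omega> \<partial>P)"
    using aes by (intro integral_mono_AE intA indI E) blast
  also have "\<dots> \<le> g w * (survival v - survival w)"
    unfolding ind[symmetric] eq[symmetric] using aes by (intro integral_mono_AE int intX) blast
  finally show "(w - v) * survival w \<le> g w * (survival v - survival w)" .
qed

text \<open>At \<open>near_end 0\<close> the process \<open>A\<close> is 0, so the nonnegative
  \<open>X\<close> has mean 0 there and vanishes; a contact at level 0 would give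
  \<open>X \<ge> c\<close>.\<close>

lemma AE_touch_level_pos: "AE \<omega> in P. 0 < touch_level \<omega>"
proof -
  have A0: "A (near_end 0 \<omega>) \<omega> = 0" for \<omega>
    using bounds_until_near_end(3,4)[OF order_refl near_end_nonneg order_refl, of \<omega>] by simp
  have "(\<integral>\<omega>. X (near_end 0 \<omega>) \<omega> \<partial>P) = 0" using expectation_near_end[of 0] by (simp add: A0)
  then have "AE \<omega> in P. X (near_end 0 \<omega>) \<omega> = 0"
    using bounds_until_near_end(1)[OF order_refl near_end_nonneg order_refl]
    by (subst (asm) integral_nonneg_eq_0_iff_AE) (auto simp: X_near_end_integrable)
  with AE_near_end_cases[OF order_refl] show ?thesis
  proof eventually_elim
    case (elim \<omega>)
    then show ?case using level_ge[of "enn2real (touch_level \<omega>)"] level_pos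
      by (auto simp: zero_less_iff_neq_zero split: if_splits)
  qed
qed

lemma survival_0: "survival 0 = 1"
  unfolding survival_def using AE_touch_level_pos by (subst prob_eq_1) auto

lemma AE_X_near_tendsto_nat:
  "AE \<omega> in P. \<forall>k. (\<lambda>n. X (near_time (real k) n \<omega>) \<omega>) \<longlonglongrightarrow> X (near_end (real k) \<omega>) \<omega>"
  by (subst AE_all_countable) (auto intro: AE_X_near_tendsto)

text \<open>An integer \<open>k\<close> above the level of the contact excludes the case in which
  \<open>tau k\<close> comes first; the other case contains the equality. With integer levels the
  exceptional set is a countable union.\<close>

lemma AE_X_touch_time:
  "AE \<omega> in P. (\<exists>t\<ge>0. touch \<omega> t) \<longrightarrow> X (touch_time \<omega>) \<omega> = g (A (touch_time \<omega>) \<omega>)"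
  using AE_X_near_tendsto_nat
proof eventually_elim
  case (elim \<omega>)
  interpret p: Sigma_path_level "\<lambda>t. X t \<omega>" "\<lambda>t. A t \<omega>" g c by (rule path_level)
  obtain k :: nat where k: "A (touch_time \<omega>) \<omega> < real k" using reals_Archimedean2 by blast
  show ?case
  proof
    assume ex: "\<exists>t\<ge>0. touch \<omega> t"
    show "X (touch_time \<omega>) \<omega> = g (A (touch_time \<omega>) \<omega>)"
    proof (rule p.contact_level_cases[OF _ elim[rule_format, of k]])
      show "0 \<le> real k" by simp
      assume "ennreal (real k) < touch_level \<omega>"
      then have "ennreal (real k) < ennreal (A (touch_time \<omega>) \<omega>)"
        using ex by (simp add: p.contact_level_def)
      with k show ?thesis by (simp add: ennreal_less_iff)
    qed
  qed
qed

lemma touch_event: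
  assumes t: "0 \<le> t"
  obtains E where "E \<in> sets (G t)" "AE \<omega> in P. (\<exists>s. 0 \<le> s \<and> s \<le> t \<and> touch \<omega> s) \<longleftrightarrow> \<omega> \<in> E"
proof
  let ?E = "\<lambda>n q. {\<omega> \<in> space P. g (A q \<omega>) - 1 / Suc n < X q \<omega>}"
  have "?E n q \<in> sets (G t)" if "q \<in> insert t (\<rat> \<inter> {0..t})" for n q
    using near_event[of q "1 / Suc n"] sets_G_mono[of q t] that t by auto
  then have "(\<Union>q\<in>insert t (\<rat> \<inter> {0..t}). ?E n q) \<in> sets (G t)" for n
    by (intro sets.countable_UN' countable_insert countable_Int1 countable_rat) auto
  then show "(\<Inter>n. \<Union>q\<in>insert t (\<rat> \<inter> {0..t}). ?E n q) \<in> sets (G t)"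
    by (intro sets.countable_INT) auto
  show "AE \<omega> in P. (\<exists>s. 0 \<le> s \<and> s \<le> t \<and> touch \<omega> s) \<longleftrightarrow>
      \<omega> \<in> (\<Inter>n. \<Union>q\<in>insert t (\<rat> \<inter> {0..t}). ?E n q)"
    using AE_X_near_tendsto_nat AE_space
  proof eventually_elim
    case (elim \<omega>)
    interpret p: Sigma_path_level "\<lambda>t. X t \<omega>" "\<lambda>t. A t \<omega>" g c by (rule path_level)
    show ?case
      using p.contact_iff_near_contact[OF elim(1)[rule_format] t] elim(2) by blast
  qed
qed

end

section \<open>Exponential decay along a barrier\<close>

text \<open>Cut \<open>[a, b]\<close> into \<open>n + 1\<close> equal pieces: the factor
  \<open>w - v\<close> becomes \<open>(b - a) / (n + 1)\<close> and the increments of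
  \<open>\<gamma>\<close> telescope, so the total bound tends to 0. Jumps of \<open>\<gamma>\<close>
  do no harm.\<close>

lemma const_if_increments_small:
  fixes \<Phi> \<gamma> :: "real \<Rightarrow> real"
  assumes ab: "a \<le> b" and bound: "\<And>v w. a \<le> v \<Longrightarrow> v \<le> w \<Longrightarrow> w \<le> b \<Longrightarrow> \<bar>\<Phi> w - \<Phi> v\<bar> \<le> C * (w - v) * (\<gamma> w - \<gamma> v)"
  shows "\<Phi> b = \<Phi> a"
proof -
  let ?D = "C * (b - a) * (\<gamma> b - \<gamma> a)"
  have le: "\<bar>\<Phi> b - \<Phi> a\<bar> \<le> ?D / Suc n" for n
  proof -
    define h where "h = (b - a) / Suc n"
    define t where "t i = a + real i * h" for i
    have h: "0 \<le> h" "real (Suc n) * h = b - a" using ab by (simp_all add: h_def)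
    have t: "a \<le> t i" "t i \<le> t (Suc i)" "t (Suc i) - t i = h" for i
      using h by (auto simp: t_def algebra_simps)
    have tb: "t (Suc i) \<le> b" if "i < Suc n" for i
    proof -
      have "real (Suc i) * h \<le> real (Suc n) * h" using that h(1) by (intro mult_right_mono) auto
      then show ?thesis using h(2) by (simp only: t_def)
    qed
    have t0: "t 0 = a" "t (Suc n) = b" using h(2) by (auto simp only: t_def of_nat_0 mult_zero_left)
    have "\<bar>\<Phi> b - \<Phi> a\<bar> = \<bar>\<Sum>i<Suc n. \<Phi> (t (Suc i)) - \<Phi> (t i)\<bar>"
      by (subst sum_lessThan_telescope) (simp only: t0)
    also have "\<dots> \<le> (\<Sum>i<Suc n. \<bar>\<Phi> (t (Suc i)) - \<Phi> (t i)\<bar>)" by (rule sum_abs)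
    also have "\<dots> \<le> (\<Sum>i<Suc n. C * h * (\<gamma> (t (Suc i)) - \<gamma> (t i)))"
    proof (rule sum_mono)
      fix i assume "i \<in> {..<Suc n}"
      then show "\<bar>\<Phi> (t (Suc i)) - \<Phi> (t i)\<bar> \<le> C * h * (\<gamma> (t (Suc i)) - \<gamma> (t i))"
        using bound[OF t(1,2) tb, of i] unfolding t(3) by simp
    qed
    also have "\<dots> = C * h * (\<gamma> b - \<gamma> a)"
      unfolding sum_distrib_left[symmetric] by (subst sum_lessThan_telescope) (simp only: t0)
    also have "\<dots> = ?D / Suc n" by (simp add: h_def)
    finally show ?thesis .
  qed
  have "(\<lambda>n. ?D / real (Suc n)) \<longlonglongrightarrow> 0"
    by (rule LIMSEQ_Suc[OF lim_const_over_n])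
  then have "\<bar>\<Phi> b - \<Phi> a\<bar> \<le> 0" by (rule LIMSEQ_le_const) (use le in auto)
  then show ?thesis by simp
qed

text \<open>A derivative-free form of \<open>S' = - S / g\<close> for monotone, possibly discontinuous \<open>g\<close>.\<close>
definition decays :: "(real \<Rightarrow> real) \<Rightarrow> (real \<Rightarrow> real) \<Rightarrow> real \<Rightarrow> bool" where
  "decays g S a \<longleftrightarrow> (\<forall>v w. a \<le> v \<longrightarrow> v \<le> w \<longrightarrow>
     (w - v) * S w \<le> g w * (S v - S w) \<and> g v * (S v - S w) \<le> (w - v) * S v)"

lemma decaysD:
  assumes "decays g S a" "a \<le> v" "v \<le> w"
  shows "(w - v) * S w \<le> g w * (S v - S w)" "g v * (S v - S w) \<le> (w - v) * S v"
  using assms by (auto simp: decays_def)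

lemma decays_mono:
  assumes "decays g S a" "a \<le> v" "v \<le> w" "0 < g w" "0 \<le> S w"
  shows "S w \<le> S v"
proof -
  have "0 \<le> (w - v) * S w" using assms by simp
  also have "\<dots> \<le> g w * (S v - S w)" by (rule decaysD[OF assms(1-3)])
  finally show ?thesis using assms(4) by (simp add: zero_le_mult_iff)
qed

text \<open>With \<open>d = w - v\<close> the inequalities give
  \<open>S w (g w + d) \<le> S v g w\<close> and \<open>K v (g v - d) \<le> K w g v\<close>.
  Cross-multiplication leaves
  \<open>g w g v - (g v - d) (g w + d) = d ((g w + w) - (g v + v))\<close>: the first-order terms
  cancel up to the increment of \<open>g\<close>.\<close>

lemma decays_cross_le:
  assumes S: "decays g S a" "\<And>v. a \<le> v \<Longrightarrow> 0 \<le> S v" and K: "decays g K a" "\<And>v. a \<le> v \<Longrightarrow> 0 \<le> K v"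
    and g: "\<And>v w. a \<le> v \<Longrightarrow> v \<le> w \<Longrightarrow> g v \<le> g w" "0 < g a"
    and vw: "a \<le> v" "v \<le> w"
  shows "S w * K v - K w * S v \<le> S a * K a / (g a)\<^sup>2 * (w - v) * ((g w + w) - (g v + v))"
proof (cases "S w * K v - K w * S v \<le> 0")
  case True
  have "0 \<le> S a * K a / (g a)\<^sup>2 * (w - v) * ((g w + w) - (g v + v))"
    using S(2)[of a] K(2)[of a] g(1)[OF vw] vw by (intro mult_nonneg_nonneg divide_nonneg_nonneg) auto
  with True show ?thesis by linarith
next
  case False
  let ?p = "S v" and ?p' = "S w" and ?q = "K v" and ?q' = "K w" and ?d = "w - v"
  have gv: "g a \<le> g v" "g a \<le> g w" "g v \<le> g w" using g(1) vw by (auto intro: order_trans)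
  have gpos: "0 < g v" "0 < g w" using gv g(2) by auto
  have nn: "0 \<le> ?p" "0 \<le> ?q" "0 \<le> S a" "0 \<le> K a" using S K vw by auto
  have pa: "?p \<le> S a" "?q \<le> K a"
    using decays_mono[OF S(1) order_refl vw(1) gpos(1) nn(1)] decays_mono[OF K(1) order_refl vw(1) gpos(1) nn(2)] by auto
  have e1: "?p' * (g w + ?d) \<le> ?p * g w" using decaysD(1)[OF S(1) vw] by (simp add: algebra_simps)
  have e2: "?q * (g v - ?d) \<le> ?q' * g v" using decaysD(2)[OF K(1) vw] by (simp add: algebra_simps)
  have f1: "(?p' * (g w + ?d)) * (?q * g v) \<le> (?p * g w) * (?q * g v)"
    using nn gpos by (intro mult_right_mono[OF e1]) auto
  have f2: "(?q * (g v - ?d)) * (?p * (g w + ?d)) \<le> (?q' * g v) * (?p * (g w + ?d))"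
    using nn gpos vw by (intro mult_right_mono[OF e2]) auto
  \<comment> \<open>The left side is positive in this case, so the factor \<open>(g a)^2\<close> may
    be enlarged to \<open>g v (g w + d)\<close>.\<close>
  have "(S w * K v - K w * S v) * (g a)\<^sup>2 \<le> (S w * K v - K w * S v) * (g v * (g w + ?d))"
    using False gv g(2) gpos vw unfolding power2_eq_square by (intro mult_left_mono mult_mono) auto
  also have "\<dots> \<le> ?p * ?q * (?d * ((g w + w) - (g v + v)))"
    using f1 f2 by (simp add: algebra_simps)
  also have "\<dots> \<le> S a * K a * (?d * ((g w + w) - (g v + v)))"
    using pa nn gv vw by (intro mult_right_mono mult_mono) auto
  finally show ?thesis using g(2) by (simp add: field_simps)
qed

text \<open>\<open>decays_cross_le\<close>, applied in both orders, bounds the increments of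
  \<open>S / K\<close> in terms of the monotone function \<open>g v + v\<close>. As \<open>K\<close>
  is nonincreasing, \<open>K b\<close> bounds the denominators from below.\<close>

lemma decays_unique:
  assumes S: "decays g S a" "\<And>v. a \<le> v \<Longrightarrow> 0 \<le> S v" and K: "decays g K a" "\<And>v. a \<le> v \<Longrightarrow> 0 < K v"
    and g: "\<And>v w. a \<le> v \<Longrightarrow> v \<le> w \<Longrightarrow> g v \<le> g w" "0 < g a" and b: "a \<le> b"
  shows "S b / K b = S a / K a"
proof (rule const_if_increments_small[where \<Phi>="\<lambda>v. S v / K v" and \<gamma>="\<lambda>v. g v + v"
      and C="S a * K a / (g a)\<^sup>2 / (K b)\<^sup>2", OF b])
  fix v w assume vw: "a \<le> v" "v \<le> w" "w \<le> b"
  let ?B = "S a * K a / (g a)\<^sup>2 * (w - v) * ((g w + w) - (g v + v))"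
  have K0: "0 \<le> K v" if "a \<le> v" for v using K(2)[OF that] by simp
  have c: "\<bar>S w * K v - K w * S v\<bar> \<le> ?B"
    using decays_cross_le[OF S K(1) K0 g vw(1,2)] decays_cross_le[OF K(1) K0 S g vw(1,2)]
    by (auto simp: abs_le_iff mult.commute)
  have pos: "0 < K v" "0 < K w" "0 < K b" using K(2) vw b by auto
  have gpos: "0 < g w" "0 < g b" using g(1)[of a w] g(1)[of a b] g(2) vw b by auto
  have Kb: "K b \<le> K w" "K b \<le> K v"
    using decays_mono[OF K(1) _ vw(3) gpos(2)] decays_mono[OF K(1) vw(1) _ gpos(2)] vw pos by auto
  have B0: "0 \<le> ?B" using c by linarith
  have "\<bar>S w / K w - S v / K v\<bar> = \<bar>S w * K v - K w * S v\<bar> / (K w * K v)"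
    using pos by (simp add: diff_frac_eq abs_mult mult.commute)
  also have "\<dots> \<le> ?B / (K b * K b)"
    using c B0 pos Kb by (intro frac_le mult_mono) auto
  also have "\<dots> = S a * K a / (g a)\<^sup>2 / (K b)\<^sup>2 * (w - v) * ((g w + w) - (g v + v))"
    by (simp add: power2_eq_square)
  finally show "\<bar>S w / K w - S v / K v\<bar> \<le> S a * K a / (g a)\<^sup>2 / (K b)\<^sup>2 * (w - v) * ((g w + w) - (g v + v))" .
qed

section \<open>The functions \<open>\<psi>\<close> and \<open>\<phi>\<close>\<close>

locale embedding_target = real_distribution \<theta> for \<theta> +
  assumes nonneg: "measure \<theta> {0..} = 1" and no_atom: "measure \<theta> {x} = 0"
begin

lemma tail_eq_cdf: "tail \<theta> x = 1 - cdf \<theta> x"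
proof -
  have "prob {x} + prob {x<..} = prob ({x} \<union> {x<..})" by (rule finite_measure_Union[symmetric]) auto
  also have "{x} \<union> {x<..} = {x..}" by auto
  finally have "tail \<theta> x = prob (space \<theta> - {..x})"
    by (simp add: tail_def no_atom Compl_eq_Diff_UNIV[symmetric] Compl_atMost)
  then show ?thesis by (subst (asm) prob_compl) (auto simp: cdf_def)
qed

lemma tail_antimono: "x \<le> y \<Longrightarrow> tail \<theta> y \<le> tail \<theta> x"
  by (simp add: tail_eq_cdf cdf_nondecreasing)

lemma tail_nonneg: "0 \<le> tail \<theta> x"
  by (simp add: tail_def)

lemma tail_le_1: "tail \<theta> x \<le> 1"
  by (simp add: tail_def)

lemma tail_0: "tail \<theta> 0 = 1"
  by (simp add: tail_def nonneg)

lemma isCont_tail: "isCont (tail \<theta>) x"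
proof -
  have "isCont (cdf \<theta>) x" by (simp add: isCont_cdf no_atom)
  then show ?thesis unfolding tail_eq_cdf[abs_def] by (intro continuous_intros)
qed

lemma tail_at_top: "(tail \<theta> \<longlongrightarrow> 0) at_top"
  using tendsto_diff[OF tendsto_const cdf_lim_at_top_prob, of 1] by (simp add: tail_eq_cdf[abs_def])

lemma measure_Ioc: "x \<le> y \<Longrightarrow> measure \<theta> {x<..y} = tail \<theta> x - tail \<theta> y"
  using cdf_diff_eq[of x y] by (cases "x = y") (auto simp: tail_eq_cdf)

lemma tail_borel[measurable]: "tail \<theta> \<in> borel_measurable borel"
  by (intro borel_measurable_continuous_onI continuous_at_imp_continuous_on ballI isCont_tail)

lemma ex_tail_eq:
  assumes p: "0 < p" "p \<le> 1" obtains x where "0 \<le> x" "tail \<theta> x = p"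
proof -
  have "eventually (\<lambda>x. tail \<theta> x < p \<and> 0 \<le> x) at_top"
    by (intro eventually_conj eventually_ge_at_top order_tendstoD(2)[OF tail_at_top p(1)])
  then obtain B where B: "tail \<theta> B < p" "0 \<le> B" by (auto dest!: eventually_happens)
  have "\<exists>x. 0 \<le> x \<and> x \<le> B \<and> tail \<theta> x = p"
    using B p by (intro IVT2) (auto simp: tail_0 isCont_tail)
  then show ?thesis using that by blast
qed

text \<open>Replaces the end points by conditions on the tail. Below
  \<open>lower_end \<theta>\<close> the interval \<open>[0, x]\<close> has no mass, so the integral
  is 0 there as well. Below \<open>upper_end \<theta>\<close> means nonzero tail, because a
  continuous tail takes half its value at some later point.\<close>

lemma psi_eq:
  assumes x: "0 \<le> x"
  shows "psi \<theta> x = (if tail \<theta> x = 0 then \<infinity> else \<integral>\<^sup>+ z\<in>{0..x}. ennreal (z / tail \<theta> z) \<partial>\<theta>)"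
proof -
  have low: "tail \<theta> x = 1" if less: "ennreal x < lower_end \<theta>"
  proof -
    obtain y where "0 \<le> y" "tail \<theta> y = 1" "ennreal x < ennreal y"
      using less unfolding lower_end_def less_Sup_iff by auto
    then show ?thesis using tail_antimono[of x y] tail_le_1[of x] x by (auto simp: ennreal_less_iff)
  qed
  have up: "ennreal x < upper_end \<theta> \<longleftrightarrow> tail \<theta> x \<noteq> 0"
  proof
    assume "ennreal x < upper_end \<theta>"
    then show "tail \<theta> x \<noteq> 0"
      using x Inf_lower[of "ennreal x" "{ennreal x | x. 0 \<le> x \<and> tail \<theta> x = 0}"] unfolding upper_end_def by force
  next
    assume "tail \<theta> x \<noteq> 0"
    then have pos: "0 < tail \<theta> x" using tail_nonneg[of x] by simp
    then obtain y where y: "0 \<le> y" "tail \<theta> y = tail \<theta> x / 2"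
      using ex_tail_eq[of "tail \<theta> x / 2"] tail_le_1[of x] by auto
    then have "x < y" using pos tail_antimono[of y x] by (auto simp: not_less[symmetric])
    moreover have "ennreal y \<le> upper_end \<theta>"
      unfolding upper_end_def
    proof (rule Inf_greatest)
      fix e assume "e \<in> {ennreal x | x. 0 \<le> x \<and> tail \<theta> x = 0}"
      then obtain u where "e = ennreal u" "0 \<le> u" "tail \<theta> u = 0" by auto
      then show "ennreal y \<le> e" using tail_antimono[of u y] y pos by (cases "u \<le> y") (auto simp: ennreal_leI)
    qed
    ultimately show "ennreal x < upper_end \<theta>" using x by (meson ennreal_lessI le_less_trans less_le_trans)
  qed
  have "(\<integral>\<^sup>+ z\<in>{0..x}. ennreal (z / tail \<theta> z) \<partial>\<theta>) = 0" if "ennreal x < lower_end \<theta>"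
  proof -
    have "{0..x} = {0} \<union> {0<..x}" using x by auto
    moreover have "prob ({0} \<union> {0<..x}) \<le> prob {0} + prob {0<..x}" by (rule measure_Un_le) auto
    ultimately have "prob {0..x} \<le> prob {0} + prob {0<..x}" by (simp only:)
    also have "\<dots> = 0" using x low[OF that] by (simp add: no_atom measure_Ioc tail_0)
    finally have "prob {0..x} = 0" by (simp add: measure_le_0_iff)
    then have "AE z in \<theta>. z \<notin> {0..x}" by (intro AE_not_in) (auto simp: null_sets_def emeasure_eq_measure)
    then have "AE z in \<theta>. ennreal (z / tail \<theta> z) * indicator {0..x} z = 0" by eventually_elim simp
    then show ?thesis by (subst nn_integral_0_iff_AE) auto
  qed
  then show ?thesis using low up by (auto simp: psi_def)
qed

text \<open>\<open>enn2real\<close> sends \<infinity> to 0, so where the tail vanishes the value is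
  a dummy; comparisons of values therefore assume positive tails.\<close>

definition psi_real :: "real \<Rightarrow> real" where
  "psi_real x = enn2real (psi \<theta> x)"

text \<open>\<open>z / tail \<theta> z\<close> is nondecreasing, so on \<open>{x<..y}\<close> it
  lies between its values at the ends, and the mass of that interval is the difference of the
  tails.\<close>

lemma weight_bounds:
  assumes "0 \<le> x" "x \<le> y" "0 < tail \<theta> y"
  shows "ennreal (x / tail \<theta> x * (tail \<theta> x - tail \<theta> y)) \<le> (\<integral>\<^sup>+ z\<in>{x<..y}. ennreal (z / tail \<theta> z) \<partial>\<theta>)"
    and "(\<integral>\<^sup>+ z\<in>{x<..y}. ennreal (z / tail \<theta> z) \<partial>\<theta>) \<le> ennreal (y / tail \<theta> y * (tail \<theta> x - tail \<theta> y))"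
proof -
  have c: "(\<integral>\<^sup>+ z\<in>{x<..y}. ennreal k \<partial>\<theta>) = ennreal (k * (tail \<theta> x - tail \<theta> y))" if "0 \<le> k" for k
    using that tail_antimono[OF assms(2)]
    by (simp add: nn_integral_cmult_indicator emeasure_eq_measure measure_Ioc assms ennreal_mult)
  have b: "x / tail \<theta> x \<le> z / tail \<theta> z \<and> z / tail \<theta> z \<le> y / tail \<theta> y" if "z \<in> {x<..y}" for z
    using that assms tail_antimono[of x z] tail_antimono[of z y] by (auto intro!: frac_le)
  have "0 \<le> x / tail \<theta> x" "0 \<le> y / tail \<theta> y" using assms by (auto simp: tail_nonneg)
  note c = c[OF this(1)] c[OF this(2)]
  show "ennreal (x / tail \<theta> x * (tail \<theta> x - tail \<theta> y)) \<le> (\<integral>\<^sup>+ z\<in>{x<..y}. ennreal (z / tail \<theta> z) \<partial>\<theta>)"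
    unfolding c(1)[symmetric] by (intro nn_integral_mono) (use b in \<open>auto simp: indicator_def intro!: ennreal_leI\<close>)
  show "(\<integral>\<^sup>+ z\<in>{x<..y}. ennreal (z / tail \<theta> z) \<partial>\<theta>) \<le> ennreal (y / tail \<theta> y * (tail \<theta> x - tail \<theta> y))"
    unfolding c(2)[symmetric] by (intro nn_integral_mono) (use b in \<open>auto simp: indicator_def intro!: ennreal_leI\<close>)
qed

lemma psi_0: "psi \<theta> 0 = 0"
proof -
  have "ennreal (z / tail \<theta> z) * indicator {0..0} z = 0" for z by (auto simp: indicator_def)
  then show ?thesis unfolding psi_eq[OF order_refl] by (simp add: tail_0)
qed

lemma psi_split:
  assumes "0 \<le> x" "x \<le> y" "0 < tail \<theta> y"
  shows "psi \<theta> y = psi \<theta> x + (\<integral>\<^sup>+ z\<in>{x<..y}. ennreal (z / tail \<theta> z) \<partial>\<theta>)"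
proof -
  have "0 < tail \<theta> x" using tail_antimono[OF assms(2)] assms(3) by simp
  moreover have "(\<integral>\<^sup>+ z\<in>{0..y}. ennreal (z / tail \<theta> z) \<partial>\<theta>) =
    (\<integral>\<^sup>+ z. ennreal (z / tail \<theta> z) * indicator {0..x} z + ennreal (z / tail \<theta> z) * indicator {x<..y} z \<partial>\<theta>)"
    using assms by (intro nn_integral_cong) (auto simp: indicator_def)
  ultimately show ?thesis using assms by (simp add: psi_eq nn_integral_add)
qed

lemma psi_eq_psi_real:
  assumes "0 \<le> x" "0 < tail \<theta> x" shows "psi \<theta> x = ennreal (psi_real x)"
proof -
  have "psi \<theta> x \<le> ennreal (x / tail \<theta> x * (tail \<theta> 0 - tail \<theta> x))"
    using weight_bounds(2)[OF order_refl assms] psi_split[OF order_refl assms] by (simp add: psi_0)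
  then have "psi \<theta> x < top" by (rule le_less_trans) simp
  then show ?thesis by (simp add: psi_real_def)
qed

lemma psi_real_nonneg: "0 \<le> psi_real x"
  by (simp add: psi_real_def)

lemma psi_real_0: "psi_real 0 = 0"
  by (simp add: psi_real_def psi_0)

lemma psi_real_bounds:
  assumes "0 \<le> x" "x \<le> y" "0 < tail \<theta> y"
  shows "x / tail \<theta> x * (tail \<theta> x - tail \<theta> y) \<le> psi_real y - psi_real x"
    and "psi_real y - psi_real x \<le> y / tail \<theta> y * (tail \<theta> x - tail \<theta> y)"
proof -
  let ?I = "\<integral>\<^sup>+ z\<in>{x<..y}. ennreal (z / tail \<theta> z) \<partial>\<theta>"
  have tx: "0 < tail \<theta> x" using tail_antimono[OF assms(2)] assms(3) by simp
  have "?I < top" using weight_bounds(2)[OF assms] by (rule le_less_trans) simp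
  then obtain r where r: "?I = ennreal r" "0 \<le> r" by (cases ?I) auto
  have "ennreal (psi_real y) = ennreal (psi_real x + r)"
    using psi_split[OF assms] assms tx r by (simp add: psi_eq_psi_real psi_real_nonneg)
  then have "psi_real y = psi_real x + r"
    using r(2) by (subst (asm) ennreal_inj) (auto simp: psi_real_nonneg)
  then have eq: "psi_real y - psi_real x = r" by simp
  have y0: "0 \<le> y / tail \<theta> y * (tail \<theta> x - tail \<theta> y)"
    using assms tail_antimono[OF assms(2)] by simp
  show "x / tail \<theta> x * (tail \<theta> x - tail \<theta> y) \<le> psi_real y - psi_real x"
    using weight_bounds(1)[OF assms] r unfolding eq by simp
  show "psi_real y - psi_real x \<le> y / tail \<theta> y * (tail \<theta> x - tail \<theta> y)"
    using weight_bounds(2)[OF assms] r y0 unfolding eq by simp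
qed

lemma psi_real_mono:
  assumes "0 \<le> x" "x \<le> y" "0 < tail \<theta> y" shows "psi_real x \<le> psi_real y"
proof -
  have "0 \<le> x / tail \<theta> x * (tail \<theta> x - tail \<theta> y)"
    using assms tail_antimono[OF assms(2)] tail_nonneg[of x] by simp
  then show ?thesis using psi_real_bounds(1)[OF assms] by linarith
qed

text \<open>On \<open>{0..b}\<close> the increments of \<open>psi_real\<close> are at most
  \<open>b / tail \<theta> b\<close> times those of the continuous tail.\<close>

lemma psi_real_continuous:
  assumes "0 < tail \<theta> b" shows "continuous_on {0..b} psi_real"
proof (rule continuous_on_eq_continuous_within[THEN iffD2], rule ballI)
  fix x assume x: "x \<in> {0..b}"
  let ?C = "b / tail \<theta> b"
  have le: "\<bar>psi_real y - psi_real x\<bar> \<le> ?C * \<bar>tail \<theta> y - tail \<theta> x\<bar>" if "y \<in> {0..b}" for y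
  proof -
    have *: "\<bar>psi_real w - psi_real v\<bar> \<le> ?C * \<bar>tail \<theta> w - tail \<theta> v\<bar>" if "0 \<le> v" "v \<le> w" "w \<le> b" for v w
    proof -
      have w: "0 < tail \<theta> w" using tail_antimono[OF that(3)] assms by simp
      have "psi_real w - psi_real v \<le> w / tail \<theta> w * (tail \<theta> v - tail \<theta> w)"
        by (rule psi_real_bounds(2)[OF that(1,2) w])
      also have "\<dots> \<le> ?C * (tail \<theta> v - tail \<theta> w)"
        using that assms tail_antimono[OF that(2)] tail_antimono[OF that(3)] by (intro mult_right_mono frac_le) auto
      finally show ?thesis using psi_real_mono[OF that(1,2) w] tail_antimono[OF that(2)] by simp
    qed
    show ?thesis
      using *[of x y] *[of y x] x that by (cases "x \<le> y") (auto simp: abs_minus_commute)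
  qed
  have t: "((\<lambda>y. ?C * \<bar>tail \<theta> y - tail \<theta> x\<bar>) \<longlongrightarrow> ?C * \<bar>tail \<theta> x - tail \<theta> x\<bar>) (at x within {0..b})"
    using isCont_tail[of x] by (intro tendsto_intros) (auto simp: isCont_def intro: tendsto_within_subset)
  then have t0: "((\<lambda>y. ?C * \<bar>tail \<theta> y - tail \<theta> x\<bar>) \<longlongrightarrow> 0) (at x within {0..b})"
    by (simp only: diff_self abs_zero mult_zero_right)
  have "eventually (\<lambda>y. norm (psi_real y - psi_real x) \<le> ?C * \<bar>tail \<theta> y - tail \<theta> x\<bar>) (at x within {0..b})"
    unfolding eventually_at_filter by (intro always_eventually) (use le in auto)
  then have "((\<lambda>y. psi_real y - psi_real x) \<longlongrightarrow> 0) (at x within {0..b})"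
    using t0 by (rule Lim_null_comparison)
  then show "continuous (at x within {0..b}) psi_real"
    by (simp add: continuous_within LIM_zero_iff)
qed

text \<open>Let \<open>y k\<close> have tail \<open>(1 / 2) ^ Suc k\<close>. The step from
  \<open>y k\<close> to the next point adds at least \<open>y k / 2 \<ge> y 0 / 2\<close>, and
  \<open>y 0 > 0\<close> because its tail is less than 1. Hence the inverse of \<open>psi\<close> is
  finite.\<close>

lemma psi_real_unbounded:
  obtains x where "0 \<le> x" "0 < tail \<theta> x" "z < psi_real x"
proof -
  have "\<exists>y. 0 \<le> y \<and> tail \<theta> y = (1 / 2) ^ Suc k" for k
    using ex_tail_eq[of "(1 / 2) ^ Suc k"] power_le_one[of "1 / 2 :: real" "Suc k"] by auto
  then obtain y where y: "\<And>k. 0 \<le> y k" "\<And>k. tail \<theta> (y k) = (1 / 2) ^ Suc k" by metis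
  have y0: "0 < y 0" using y[of 0] tail_0 by (cases "y 0 = 0") auto
  have mono: "y k \<le> y (Suc k)" for k
  proof (rule ccontr)
    assume "\<not> ?thesis"
    then have "(1 / 2) ^ Suc k \<le> (1 / 2 :: real) ^ Suc (Suc k)" using tail_antimono[of "y (Suc k)" "y k"] y(2) by simp
    then show False by simp
  qed
  have y0k: "y 0 \<le> y k" for k using mono lift_Suc_mono_le[of y 0 k] by simp
  have "psi_real (y k) \<ge> real k * (y 0 / 2)" for k
  proof (induction k)
    case (Suc k)
    have p: "0 < tail \<theta> (y (Suc k))" by (simp only: y(2)) simp
    have "y 0 / 2 \<le> y k / 2" using y0k by simp
    also have "y k / 2 = y k / tail \<theta> (y k) * (tail \<theta> (y k) - tail \<theta> (y (Suc k)))"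
      by (simp only: y(2)) (simp add: field_simps)
    also have "\<dots> \<le> psi_real (y (Suc k)) - psi_real (y k)"
      by (rule psi_real_bounds(1)[OF y(1) mono p])
    finally show ?case using Suc by (simp add: algebra_simps add_divide_distrib)
  qed (simp add: psi_real_nonneg)
  moreover obtain k :: nat where "z / (y 0 / 2) < real k" using reals_Archimedean2 by blast
  then have "z < real k * (y 0 / 2)" using y0 by (simp add: field_simps)
  moreover have "0 < tail \<theta> (y k)" by (simp only: y(2)) simp
  ultimately show ?thesis using that[of "y k"] y(1)[of k] by (meson less_le_trans)
qed

text \<open>If \<open>{x<..y}\<close> had mass, a point \<open>u\<close> between with mass left up
  to \<open>y\<close> would make \<open>psi_real\<close> grow from \<open>u\<close> to
  \<open>y\<close>. The detour through \<open>u\<close> is due to the weight at \<open>x\<close>,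
  which is 0 if \<open>x = 0\<close>.\<close>

lemma tail_eq_if_psi_real_eq:
  assumes "0 \<le> x" "x \<le> y" "0 < tail \<theta> y" "psi_real x = psi_real y"
  shows "tail \<theta> x = tail \<theta> y"
proof (rule ccontr)
  assume "tail \<theta> x \<noteq> tail \<theta> y"
  then have less: "tail \<theta> y < tail \<theta> x" using tail_antimono[OF assms(2)] by simp
  define p where "p = (tail \<theta> x + tail \<theta> y) / 2"
  have p: "tail \<theta> y < p" "p < tail \<theta> x" using less by (auto simp: p_def field_simps)
  obtain u where u: "0 \<le> u" "tail \<theta> u = p"
    using ex_tail_eq[of p] p assms(3) tail_le_1[of x] by auto
  have "x < u" "u < y" using p u tail_antimono[of u x] tail_antimono[of y u] by (auto simp: not_le[symmetric])
  have "0 < u / tail \<theta> u * (tail \<theta> u - tail \<theta> y)"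
    using \<open>x < u\<close> assms p u by simp
  also have "\<dots> \<le> psi_real y - psi_real u"
    using \<open>u < y\<close> u assms by (intro psi_real_bounds) auto
  also have "\<dots> \<le> psi_real y - psi_real x"
    using psi_real_mono[of x u] \<open>x < u\<close> assms u p by simp
  finally show False using assms(4) by simp
qed

section \<open>The right-continuous inverse of \<psi> as a real function\<close>

definition phi_real :: "real \<Rightarrow> real" where
  "phi_real z = entry (\<lambda>x. ennreal z < psi \<theta> x)"

lemma ex_psi_gt: "\<exists>x\<ge>0. ennreal z < psi \<theta> x"
proof -
  obtain x where "0 \<le> x" "0 < tail \<theta> x" "max 0 z < psi_real x" by (rule psi_real_unbounded)
  then show ?thesis by (intro exI[of _ x]) (auto simp: psi_eq_psi_real intro!: ennreal_lessI)
qed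

lemma phi_real_nonneg: "0 \<le> phi_real z"
  unfolding phi_real_def by (intro entry_nonneg ex_psi_gt)

lemma phi_eq_phi_real: "phi \<theta> z = ennreal (phi_real z)"
  unfolding phi_def
proof (rule antisym)
  show "Inf {ennreal x |x. 0 \<le> x \<and> ennreal z < psi \<theta> x} \<le> ennreal (phi_real z)"
  proof (rule ennreal_le_epsilon)
    fix e :: real assume "0 < e"
    then obtain x where x: "0 \<le> x" "x < phi_real z + e" "ennreal z < psi \<theta> x"
      using entry_less_iff[OF ex_psi_gt, of z "phi_real z + e"] by (auto simp: phi_real_def)
    then have "Inf {ennreal x |x. 0 \<le> x \<and> ennreal z < psi \<theta> x} \<le> ennreal x" by (intro Inf_lower) auto
    also have "\<dots> \<le> ennreal (phi_real z + e)" using x by (intro ennreal_leI) simp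
    also have "\<dots> = ennreal (phi_real z) + ennreal e" using \<open>0 < e\<close> phi_real_nonneg by simp
    finally show "Inf {ennreal x |x. 0 \<le> x \<and> ennreal z < psi \<theta> x} \<le> ennreal (phi_real z) + ennreal e" .
  qed
  show "ennreal (phi_real z) \<le> Inf {ennreal x |x. 0 \<le> x \<and> ennreal z < psi \<theta> x}"
    by (rule Inf_greatest) (auto simp: phi_real_def intro!: ennreal_leI entry_le)
qed

lemma phi_real_le: "0 \<le> x \<Longrightarrow> ennreal z < psi \<theta> x \<Longrightarrow> phi_real z \<le> x"
  unfolding phi_real_def by (rule entry_le)

lemma phi_real_mono: "mono phi_real"
proof (rule monoI, rule dense_ge)
  fix z z' x :: real assume "z \<le> z'" "phi_real z' < x"
  then obtain y where y: "0 \<le> y" "y < x" "ennreal z' < psi \<theta> y"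
    using entry_less_iff[OF ex_psi_gt] by (auto simp: phi_real_def)
  then have "ennreal z < psi \<theta> y" using \<open>z \<le> z'\<close> by (meson ennreal_leI le_less_trans)
  then show "phi_real z \<le> x" using phi_real_le[of y z] y by simp
qed

lemma phi_real_right: "(phi_real \<longlongrightarrow> phi_real z) (at_right z)"
proof (rule order_tendstoI)
  fix y assume "y < phi_real z"
  have "eventually (\<lambda>s. z < s) (at_right z)" by (rule eventually_at_right_less)
  then show "eventually (\<lambda>s. y < phi_real s) (at_right z)"
    by eventually_elim (use \<open>y < phi_real z\<close> phi_real_mono in \<open>meson monoD less_imp_le less_le_trans\<close>)
next
  fix y assume "phi_real z < y"
  then obtain x where x: "0 \<le> x" "x < y" "ennreal z < psi \<theta> x"
    using entry_less_iff[OF ex_psi_gt] by (auto simp: phi_real_def)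
  \<comment> \<open>The strict inequality at \<open>x\<close> leaves room for a whole interval of
    levels, on which the same \<open>x\<close> bounds \<open>phi_real\<close>. Negative levels are
    all read as 0 by \<open>ennreal\<close>.\<close>
  obtain b where b: "z < b" "ennreal b \<le> psi \<theta> x"
  proof (cases "psi \<theta> x")
    case (real r)
    with x(3) have "max 0 z < r" by (auto simp: ennreal_less_iff max_def ennreal_neg)
    then show ?thesis using that[of r] real by auto
  next
    case top
    then show ?thesis using that[of "z + 1"] by simp
  qed
  have "eventually (\<lambda>s. s \<in> {z<..<b}) (at_right z)" by (rule eventually_at_right_real[OF b(1)])
  then show "eventually (\<lambda>s. phi_real s < y) (at_right z)"
  proof eventually_elim
    case (elim s)
    show ?case
    proof (cases "0 < b")
      case True
      then have "ennreal s < ennreal b" using elim by (cases "0 \<le> s") (auto simp: ennreal_neg intro: ennreal_lessI)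
      then show ?thesis using phi_real_le[OF x(1), of s] b(2) x(2) by (meson le_less_trans less_le_trans)
    next
      case False
      then have "ennreal s = ennreal z" using elim by (simp add: ennreal_neg)
      then show ?thesis using phi_real_le[OF x(1), of s] x by simp
    qed
  qed
qed

text \<open>\<open>psi_real\<close> is continuous, starts at 0 and exceeds \<open>z\<close> at a
  point \<open>b\<close> of positive tail; the intermediate value theorem on \<open>{0..b}\<close>
  excludes a jump over \<open>z\<close>.\<close>

lemma psi_real_phi_real:
  assumes z: "0 \<le> z" shows "0 < tail \<theta> (phi_real z)" "psi_real (phi_real z) = z"
proof -
  obtain b where b: "0 \<le> b" "0 < tail \<theta> b" "z < psi_real b" by (rule psi_real_unbounded)
  have iff: "ennreal z < psi \<theta> x \<longleftrightarrow> z < psi_real x" if "0 \<le> x" "x \<le> b" for x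
    using that z b tail_antimono[OF that(2)] by (subst psi_eq_psi_real) (auto simp: ennreal_less_iff)
  have le: "phi_real z \<le> b" using b iff[of b] by (intro phi_real_le) auto
  note nn = phi_real_nonneg[of z]
  show pos: "0 < tail \<theta> (phi_real z)" using tail_antimono[OF le] b by simp
  have cont: "continuous_on {0..y} psi_real" if "y \<le> b" for y
    by (rule continuous_on_subset[OF psi_real_continuous[OF b(2)]]) (use that in auto)
  show "psi_real (phi_real z) = z"
  proof (rule antisym)
    show "psi_real (phi_real z) \<le> z"
    proof (rule ccontr)
      assume "\<not> ?thesis"
      then have gt: "z < psi_real (phi_real z)" by simp
      define m where "m = (z + psi_real (phi_real z)) / 2"
      have m: "z < m" "m < psi_real (phi_real z)" using gt by (auto simp: m_def field_simps)
      have "\<exists>y. 0 \<le> y \<and> y \<le> phi_real z \<and> psi_real y = m"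
        by (rule IVT'[OF _ _ nn cont[OF le]]) (use m z psi_real_0 in auto)
      then obtain y where y: "0 \<le> y" "y \<le> phi_real z" "psi_real y = m" by blast
      then have "phi_real z \<le> y" using iff[of y] m le by (intro phi_real_le) auto
      with y m show False by auto
    qed
    have "\<exists>y. 0 \<le> y \<and> y \<le> b \<and> psi_real y = z"
      by (rule IVT'[OF _ _ b(1) cont]) (use b z psi_real_0 in auto)
    then obtain y where y: "0 \<le> y" "y \<le> b" "psi_real y = z" by blast
    have "y \<le> phi_real z"
    proof (rule ccontr)
      assume "\<not> ?thesis"
      then obtain x where x: "0 \<le> x" "x < y" "ennreal z < psi \<theta> x"
        using entry_less_iff[OF ex_psi_gt, of z y] by (auto simp: phi_real_def)
      then have "z < psi_real x" using iff[of x] y by simp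
      moreover have "psi_real x \<le> psi_real y"
        using x y tail_antimono[OF y(2)] b by (intro psi_real_mono) auto
      ultimately show False using y by simp
    qed
    then show "z \<le> psi_real (phi_real z)" using psi_real_mono[OF y(1) _ pos] y by simp
  qed
qed

lemma phi_real_pos: "0 < z \<Longrightarrow> 0 < phi_real z"
  using psi_real_phi_real(2)[of z] phi_real_nonneg[of z] psi_real_0 by (cases "phi_real z = 0") auto

text \<open>Left of \<open>x\<close> the values of \<open>psi_real\<close> are at most
  \<open>psi_real x\<close>, so the inverse returns a point of the plateau through \<open>x\<close>
  that is not to the left of \<open>x\<close>.\<close>

lemma le_phi_real_psi_real:
  assumes "0 \<le> x" "0 < tail \<theta> x" shows "x \<le> phi_real (psi_real x)"
proof (rule ccontr)
  assume "\<not> ?thesis"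
  then obtain y where y: "0 \<le> y" "y < x" "ennreal (psi_real x) < psi \<theta> y"
    using entry_less_iff[OF ex_psi_gt, of "psi_real x" x] by (auto simp: phi_real_def not_le)
  moreover have ty: "0 < tail \<theta> y" using tail_antimono[of y x] y assms by simp
  ultimately have "psi_real x < psi_real y" by (simp add: psi_eq_psi_real psi_real_nonneg ennreal_less_iff)
  with psi_real_mono[of y x] y assms show False by simp
qed

text \<open>This is the survival function that the level of \<open>A\<close> at the embedding time
  will turn out to have.\<close>

definition tail_phi :: "real \<Rightarrow> real" where
  "tail_phi z = tail \<theta> (phi_real z)"

lemma tail_phi_pos: "0 \<le> z \<Longrightarrow> 0 < tail_phi z"
  by (simp add: tail_phi_def psi_real_phi_real)

text \<open>\<open>x\<close> and \<open>phi_real (psi_real x)\<close> have the same value of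
  \<open>psi_real\<close>, and a plateau of \<open>psi_real\<close> carries no mass.\<close>

lemma tail_phi_psi_real:
  assumes "0 \<le> x" "0 < tail \<theta> x" shows "tail_phi (psi_real x) = tail \<theta> x"
  unfolding tail_phi_def
  using assms le_phi_real_psi_real[OF assms] psi_real_phi_real[OF psi_real_nonneg]
  by (intro tail_eq_if_psi_real_eq[symmetric]) auto

lemma tail_phi_0: "tail_phi 0 = 1"
  using tail_phi_psi_real[of 0] by (simp add: tail_0 psi_real_0)

lemma tail_phi_right: "(tail_phi \<longlongrightarrow> tail_phi z) (at_right z)"
  unfolding tail_phi_def by (rule isCont_tendsto_compose[OF isCont_tail phi_real_right])

text \<open>These are the bounds on \<open>psi_real\<close> between \<open>phi_real v\<close> and
  \<open>phi_real w\<close>, where its values are \<open>v\<close> and \<open>w\<close>, multiplied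
  by the tails.\<close>

lemma decays_tail_phi: "decays phi_real tail_phi 0"
  unfolding decays_def
proof (intro allI impI)
  fix v w :: real assume v: "0 \<le> v" and w: "v \<le> w"
  then have w0: "0 \<le> w" by simp
  have le: "phi_real v \<le> phi_real w" using phi_real_mono w by (auto simp: mono_def)
  note t = psi_real_phi_real(1)[OF v] psi_real_phi_real(1)[OF w0]
  note b = psi_real_bounds[OF phi_real_nonneg le t(2)]
  show "(w - v) * tail_phi w \<le> phi_real w * (tail_phi v - tail_phi w) \<and>
        phi_real v * (tail_phi v - tail_phi w) \<le> (w - v) * tail_phi v"
    using b t unfolding psi_real_phi_real(2)[OF v] psi_real_phi_real(2)[OF w0] tail_phi_def
    by (simp add: pos_le_divide_eq pos_divide_le_eq)
qed

end

section \<open>The embedding for regular paths\<close>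

lemma (in complete_measure) borel_measurable_cong_AE:
  fixes f g :: "'a \<Rightarrow> real"
  assumes f: "f \<in> borel_measurable M" and eq: "AE x in M. f x = g x"
  shows "g \<in> borel_measurable M"
  unfolding borel_measurable_iff_le
proof
  fix a
  show "{x \<in> space M. g x \<le> a} \<in> sets M"
  proof (rule in_sets_AE)
    show "AE x in M. x \<in> {x \<in> space M. f x \<le> a} \<longleftrightarrow> x \<in> {x \<in> space M. g x \<le> a}"
      using eq by eventually_elim auto
    show "{x \<in> space M. f x \<le> a} \<in> sets M" using f by measurable
  qed auto
qed

locale Sigma_embedding = Sigma_process P G X A \<sigma> + target: embedding_target \<theta>
  for P :: "'a measure" and G :: "real \<Rightarrow> 'a measure" and X A :: "real \<Rightarrow> 'a \<Rightarrow> real"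
    and \<sigma> :: "nat \<Rightarrow> 'a \<Rightarrow> ennreal" and \<theta> :: "real measure"
begin

section \<open>Barriers with a cutoff near level 0\<close>

definition unit_frac :: "nat \<Rightarrow> real" where
  "unit_frac n = 1 / real (Suc n)"

lemma unit_frac_pos: "0 < unit_frac n"
  by (simp add: unit_frac_def)

lemma unit_frac_antimono: "n \<le> m \<Longrightarrow> unit_frac m \<le> unit_frac n"
  unfolding unit_frac_def by (intro divide_left_mono) auto

lemma unit_frac_less: "0 < z \<Longrightarrow> \<exists>n. unit_frac n < z"
  unfolding unit_frac_def by (metis nat_approx_posE)

lemma unit_frac_right: "filterlim unit_frac (at_right 0) sequentially"
  unfolding filterlim_at unit_frac_def using LIMSEQ_Suc[OF lim_1_over_n] by auto

text \<open>\<open>\<phi>(0) = 0\<close> is possible, hence the cutoff that makes the barrier bounded away from 0.\<close>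
definition barrier :: "nat \<Rightarrow> real \<Rightarrow> real" where
  "barrier n z = target.phi_real (max z (unit_frac n))"

abbreviation hit :: "nat \<Rightarrow> 'a \<Rightarrow> real \<Rightarrow> bool" where
  "hit n \<omega> \<equiv> Sigma_path_level.contact (\<lambda>t. X t \<omega>) (\<lambda>t. A t \<omega>) (barrier n)"

abbreviation hit_time :: "nat \<Rightarrow> 'a \<Rightarrow> real" where
  "hit_time n \<omega> \<equiv> Sigma_path_level.contact_time (\<lambda>t. X t \<omega>) (\<lambda>t. A t \<omega>) (barrier n)"

abbreviation hit_level :: "nat \<Rightarrow> 'a \<Rightarrow> ennreal" where
  "hit_level n \<omega> \<equiv> Sigma_path_level.contact_level (\<lambda>t. X t \<omega>) (\<lambda>t. A t \<omega>) (barrier n)"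

abbreviation surv :: "nat \<Rightarrow> real \<Rightarrow> real" where
  "surv n \<equiv> Sigma_process_level.survival P X A (barrier n)"

lemma barrier_eq: "unit_frac n \<le> z \<Longrightarrow> barrier n z = target.phi_real z"
  by (simp add: barrier_def max_def)

lemma barrier_eq_const: "z \<le> unit_frac n \<Longrightarrow> barrier n z = target.phi_real (unit_frac n)"
  by (simp add: barrier_def max_def)

lemma phi_real_leD: "y \<le> z \<Longrightarrow> target.phi_real y \<le> target.phi_real z"
  using target.phi_real_mono by (auto simp: mono_def)

lemma barrier_mono: "y \<le> z \<Longrightarrow> barrier n y \<le> barrier n z"
  unfolding barrier_def by (intro phi_real_leD) auto

lemma barrier_antimono: "n \<le> m \<Longrightarrow> barrier m z \<le> barrier n z"
  unfolding barrier_def using unit_frac_antimono[of n m] by (intro phi_real_leD) auto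

lemma barrier_right: "(barrier n \<longlongrightarrow> barrier n z) (at_right z)"
proof (cases "z < unit_frac n")
  case True
  have "eventually (\<lambda>s. s \<in> {z<..<unit_frac n}) (at_right z)" by (rule eventually_at_right_real[OF True])
  then have "eventually (\<lambda>s. barrier n s = barrier n z) (at_right z)"
  proof eventually_elim
    case (elim s)
    with True show ?case by (simp add: barrier_eq_const)
  qed
  then show ?thesis by (rule tendsto_eventually)
next
  case False
  have "eventually (\<lambda>s. target.phi_real s = barrier n s) (at_right z)"
    using eventually_at_right_less[of z]
  proof eventually_elim
    case (elim s)
    with False show ?case by (simp add: barrier_eq)
  qed
  from Lim_transform_eventually[OF target.phi_real_right this]
  have "(barrier n \<longlongrightarrow> target.phi_real z) (at_right z)" .
  then show ?thesis using False by (simp add: barrier_eq)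
qed

lemma barrier_ge: "target.phi_real (unit_frac n) \<le> barrier n z"
  unfolding barrier_def by (rule phi_real_leD) simp

lemma level: "Sigma_process_level P G X A \<sigma> (barrier n) (target.phi_real (unit_frac n))"
  by (intro Sigma_process_level.intro Sigma_process_level_axioms.intro Sigma_process_axioms
      monoI barrier_mono barrier_right target.phi_real_pos barrier_ge unit_frac_pos)

lemma path_barrier: "Sigma_path_level (\<lambda>t. X t \<omega>) (\<lambda>t. A t \<omega>) (barrier n) (target.phi_real (unit_frac n))"
  by (rule Sigma_process_level.path_level[OF level])

lemma hit_level_measurable[measurable]: "hit_level n \<in> borel_measurable P"
  by (rule Sigma_process_level.touch_level_measurable[OF level])

lemma surv_def: "surv n v = prob {\<omega> \<in> space P. ennreal v < hit_level n \<omega>}"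
  by (rule Sigma_process_level.survival_def[OF level])

lemma surv_nonneg: "0 \<le> surv n v" and surv_le_1: "surv n v \<le> 1"
  by (simp_all add: surv_def)

lemma decays_surv: "decays (barrier n) (surv n) 0"
  unfolding decays_def using Sigma_process_level.survival_ineqs[OF level] by blast

text \<open>Above the cutoff the barrier is \<open>phi_real\<close>, so \<open>surv n\<close> and
  \<open>tail_phi\<close> decay along the same function and their quotient is constant.\<close>

lemma surv_eq:
  assumes v: "unit_frac n \<le> v"
  shows "surv n v = surv n (unit_frac n) / target.tail_phi (unit_frac n) * target.tail_phi v"
proof -
  let ?u = "unit_frac n"
  have u: "0 < ?u" by (rule unit_frac_pos)
  have d: "decays target.phi_real (surv n) ?u"
    unfolding decays_def
  proof (intro allI impI)
    fix v w assume vw: "?u \<le> v" "v \<le> w"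
    then have "0 \<le> v" using u by linarith
    from decaysD[OF decays_surv this vw(2), of n] show "(w - v) * surv n w \<le> target.phi_real w * (surv n v - surv n w) \<and>
        target.phi_real v * (surv n v - surv n w) \<le> (w - v) * surv n v"
      using vw by (simp add: barrier_eq)
  qed
  have d': "decays target.phi_real target.tail_phi ?u"
    using u by (auto simp: decays_def intro!: decaysD[OF target.decays_tail_phi])
  have "surv n v / target.tail_phi v = surv n ?u / target.tail_phi ?u"
    by (rule decays_unique[OF d surv_nonneg d' target.tail_phi_pos phi_real_leD target.phi_real_pos[OF u] v])
      (use u in \<open>linarith\<close>)
  moreover have "0 < target.tail_phi v" using u v by (intro target.tail_phi_pos) linarith
  ultimately show ?thesis by (simp add: field_simps)
qed

text \<open>With \<open>u = unit_frac n\<close>, the barrier is the constant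
  \<open>phi_real u\<close> up to level \<open>u\<close>, so at most \<open>u / phi_real u\<close>
  is lost there. The decay of \<open>tail_phi\<close> on \<open>[0, u]\<close>, where it starts at
  1, bounds this ratio by \<open>1 / tail_phi u - 1\<close>.\<close>

lemma surv_unit_frac_ge: "2 - 1 / target.tail_phi (unit_frac n) \<le> surv n (unit_frac n)"
proof -
  let ?u = "unit_frac n" and ?K = "target.tail_phi (unit_frac n)" and ?f = "target.phi_real (unit_frac n)"
  have u: "0 < ?u" by (rule unit_frac_pos)
  have K: "0 < ?K" using u by (intro target.tail_phi_pos) linarith
  have f: "0 < ?f" by (rule target.phi_real_pos[OF u])
  have "?u * ?K \<le> ?f * (1 - ?K)"
    using decaysD(1)[OF target.decays_tail_phi order_refl, of ?u] u by (simp add: target.tail_phi_0)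
  moreover have "u / f \<le> 1 / K - 1" if "u * K \<le> f * (1 - K)" "0 < K" "0 < f" for u K f :: real
    using that by (simp add: field_simps)
  ultimately have "?u / ?f \<le> 1 / ?K - 1" using K f by blast
  moreover have "?f * (1 - surv n ?u) \<le> ?u"
    using decaysD(2)[OF decays_surv order_refl, of ?u n] u
    by (simp add: Sigma_process_level.survival_0[OF level] barrier_eq_const)
  then have "1 - surv n ?u \<le> ?u / ?f" using f by (simp add: pos_le_divide_eq mult.commute)
  ultimately show ?thesis by linarith
qed

lemma tail_phi_unit_frac: "(\<lambda>n. target.tail_phi (unit_frac n)) \<longlonglongrightarrow> 1"
  using filterlim_compose[OF target.tail_phi_right unit_frac_right] by (simp add: target.tail_phi_0)

lemma surv_tendsto:
  assumes v: "0 < v" shows "(\<lambda>n. surv n v) \<longlonglongrightarrow> target.tail_phi v"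
proof -
  have "(\<lambda>n. 2 - 1 / target.tail_phi (unit_frac n)) \<longlonglongrightarrow> 2 - 1 / 1"
    by (intro tendsto_intros tail_phi_unit_frac) simp
  then have lower: "(\<lambda>n. 2 - 1 / target.tail_phi (unit_frac n)) \<longlonglongrightarrow> 1" by simp
  have "(\<lambda>n. surv n (unit_frac n)) \<longlonglongrightarrow> 1"
    by (rule real_tendsto_sandwich[OF _ _ lower tendsto_const])
      (intro always_eventually allI surv_unit_frac_ge surv_le_1)+
  then have lim: "(\<lambda>n. surv n (unit_frac n) / target.tail_phi (unit_frac n) * target.tail_phi v) \<longlonglongrightarrow> 1 / 1 * target.tail_phi v"
    by (intro tendsto_intros tail_phi_unit_frac) simp_all
  obtain m where "unit_frac m < v" using unit_frac_less[OF v] by blast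
  then have "eventually (\<lambda>n. surv n (unit_frac n) / target.tail_phi (unit_frac n) * target.tail_phi v = surv n v) sequentially"
    using unit_frac_antimono by (intro eventually_sequentiallyI[of m] surv_eq[symmetric]) fastforce
  with lim show ?thesis by (simp add: tendsto_cong)
qed

text \<open>Paths without contact survive every level, while \<open>surv n\<close> is eventually a
  multiple of \<open>tail_phi\<close>, which takes arbitrarily small values.\<close>

lemma AE_hit_level_finite: "AE \<omega> in P. hit_level n \<omega> < \<infinity>"
proof -
  let ?N = "{\<omega> \<in> space P. hit_level n \<omega> = \<infinity>}" and ?K = "target.tail_phi (unit_frac n)"
  have [measurable]: "?N \<in> sets P" by measurable
  note u = unit_frac_pos[of n]
  have K: "0 < ?K" using u by (intro target.tail_phi_pos) linarith
  have "prob ?N \<le> 0"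
  proof (rule field_le_epsilon)
    fix e :: real assume e: "0 < e"
    \<comment> \<open>The bound \<open>?K / 2\<close> forces \<open>v\<close> beyond
      \<open>unit_frac n\<close>, where \<open>surv_eq\<close> applies; the bound
      \<open>e * ?K\<close> makes the resulting estimate at most \<open>e\<close>.\<close>
    define p where "p = min (?K / 2) (e * ?K)"
    have p: "0 < p" "p < ?K" "p \<le> e * ?K" using K e by (auto simp: p_def min_def)
    have "?K \<le> 1" by (simp add: target.tail_phi_def target.tail_le_1)
    with p obtain x where x: "0 \<le> x" "tail \<theta> x = p" using target.ex_tail_eq[of p] by auto
    define v where "v = target.psi_real x"
    have v: "target.tail_phi v = p" "0 \<le> v"
      using x p target.tail_phi_psi_real[of x] target.psi_real_nonneg by (auto simp: v_def)
    have uv: "unit_frac n \<le> v"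
    proof (rule ccontr)
      assume "\<not> ?thesis"
      then have "?K \<le> target.tail_phi v"
        unfolding target.tail_phi_def by (intro target.tail_antimono phi_real_leD) simp
      with v p show False by simp
    qed
    have "prob ?N \<le> surv n v" unfolding surv_def by (intro finite_measure_mono) auto
    also have "\<dots> = surv n (unit_frac n) / ?K * p" unfolding surv_eq[OF uv] v ..
    also have "\<dots> \<le> 1 / ?K * (e * ?K)"
      using p K surv_nonneg[of n] by (intro mult_mono divide_right_mono surv_le_1) auto
    also have "\<dots> = 0 + e" using K by simp
    finally show "prob ?N \<le> 0 + e" .
  qed
  then have "AE \<omega> in P. \<omega> \<notin> ?N"
    by (intro AE_not_in) (simp add: null_sets_def emeasure_eq_measure measure_le_0_iff)
  then show ?thesis using AE_space by eventually_elim (auto simp: less_top[symmetric])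
qed

text \<open>Positive values of \<open>X\<close> are contacts with some constant barrier
  \<open>unit_frac m\<close>, and such contacts almost surely happen at a positive level. This gives
  \<open>A > 0\<close> at the contacts counted by \<open>embedding_time\<close>, also when
  \<open>phi \<theta> 0 > 0\<close>.\<close>

lemma AE_A_pos_if_X_pos: "AE \<omega> in P. \<forall>t\<ge>0. 0 < X t \<omega> \<longrightarrow> 0 < A t \<omega>"
proof -
  have lev: "Sigma_process_level P G X A \<sigma> (\<lambda>_. unit_frac m) (unit_frac m)" for m
    by (intro Sigma_process_level.intro Sigma_process_level_axioms.intro Sigma_process_axioms) (auto simp: mono_def unit_frac_pos)
  have "AE \<omega> in P. \<forall>m. 0 < Sigma_path_level.contact_level (\<lambda>t. X t \<omega>) (\<lambda>t. A t \<omega>) (\<lambda>_. unit_frac m)"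
    by (subst AE_all_countable) (auto intro: Sigma_process_level.AE_touch_level_pos[OF lev])
  then show ?thesis
  proof eventually_elim
    case (elim \<omega>)
    show ?case
    proof (intro allI impI)
      fix t :: real assume t: "0 \<le> t" "0 < X t \<omega>"
      then obtain m where m: "unit_frac m < X t \<omega>" using unit_frac_less by blast
      interpret p: Sigma_path_level "\<lambda>t. X t \<omega>" "\<lambda>t. A t \<omega>" "\<lambda>_. unit_frac m" "unit_frac m"
        by (rule Sigma_process_level.path_level[OF lev])
      have c: "p.contact t" using m by (simp add: p.contact_def)
      then have ex: "\<exists>t\<ge>0. p.contact t" using t by blast
      have "0 < A p.contact_time \<omega>"
        using elim[rule_format, of m] ex unfolding p.contact_level_def by simp
      also have "\<dots> \<le> A t \<omega>"
        by (rule p.a_mono[OF p.contact_contact_time(1)[OF ex] p.contact_time_le[OF t(1) c]])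
      finally show "0 < A t \<omega>" .
    qed
  qed
qed

lemma hit_iff: "hit n \<omega> t \<longleftrightarrow> barrier n (A t \<omega>) \<le> X t \<omega>"
  by (rule Sigma_path_level.contact_def[OF path_barrier])

lemma hit_mono: "n \<le> m \<Longrightarrow> hit n \<omega> t \<Longrightarrow> hit m \<omega> t"
  unfolding hit_iff using barrier_antimono by (meson order_trans)

definition inf_level :: "'a \<Rightarrow> ennreal" where
  "inf_level \<omega> = (INF n. hit_level n \<omega>)"

lemma inf_level_measurable[measurable]: "inf_level \<in> borel_measurable P"
  unfolding inf_level_def by measurable

lemma hit_level_antimono:
  assumes "n \<le> m" shows "hit_level m \<omega> \<le> hit_level n \<omega>"
proof (cases "\<exists>t\<ge>0. hit n \<omega> t")
  case True
  then have ex: "\<exists>t\<ge>0. hit m \<omega> t" using hit_mono[OF assms] by blast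
  note c = Sigma_path_level.contact_contact_time[OF path_barrier True]
  have "hit_time m \<omega> \<le> hit_time n \<omega>"
    by (rule Sigma_path_level.contact_time_le[OF path_barrier c(1) hit_mono[OF assms c(2)]])
  then have "A (hit_time m \<omega>) \<omega> \<le> A (hit_time n \<omega>) \<omega>"
    by (rule Sigma_path.a_mono[OF path Sigma_path_level.contact_contact_time(1)[OF path_barrier ex]])
  then show ?thesis
    using True ex by (simp add: Sigma_path_level.contact_level_def[OF path_barrier] ennreal_leI)
next
  case False
  then have "hit_level n \<omega> = \<infinity>"
    unfolding Sigma_path_level.contact_level_def[OF path_barrier] by (subst if_not_P) auto
  then show ?thesis by simp
qed

lemma prob_all_hit_levels:
  assumes "0 < v"
  shows "prob {\<omega> \<in> space P. \<forall>n. ennreal v < hit_level n \<omega>} = target.tail_phi v"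
proof -
  have "(\<lambda>n. prob {\<omega> \<in> space P. ennreal v < hit_level n \<omega>}) \<longlonglongrightarrow>
      prob (\<Inter>n. {\<omega> \<in> space P. ennreal v < hit_level n \<omega>})"
    by (intro finite_Lim_measure_decseq) (auto simp: decseq_def intro: less_le_trans[OF _ hit_level_antimono])
  moreover have "(\<Inter>n. {\<omega> \<in> space P. ennreal v < hit_level n \<omega>}) = {\<omega> \<in> space P. \<forall>n. ennreal v < hit_level n \<omega>}"
    by auto
  ultimately show ?thesis
    using surv_tendsto[OF assms] by (auto simp: surv_def dest: LIMSEQ_unique)
qed

text \<open>Lowering the cutoff might create contacts at ever smaller levels. The event that all
  levels exceed \<open>unit_frac m\<close> has probability \<open>tail_phi (unit_frac m)\<close>,
  which tends to 1.\<close>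

lemma AE_hit_levels_bounded_below: "AE \<omega> in P. \<exists>m. \<forall>n. ennreal (unit_frac m) < hit_level n \<omega>"
proof -
  let ?E = "{\<omega> \<in> space P. \<exists>m. \<forall>n. ennreal (unit_frac m) < hit_level n \<omega>}"
  have [measurable]: "?E \<in> sets P" by measurable
  have "target.tail_phi (unit_frac m) \<le> prob ?E" for m
    by (subst prob_all_hit_levels[symmetric]) (auto intro!: finite_measure_mono simp: unit_frac_pos)
  then have "1 \<le> prob ?E" by (intro LIMSEQ_le_const2[OF tail_phi_unit_frac]) auto
  then have "prob ?E = 1" using prob_le_1[of ?E] by simp
  then show ?thesis by (subst (asm) prob_eq_1) (auto elim: AE_mp)
qed

section \<open>The embedding time as a contact time with one of the barriers\<close>

lemma embedding_time_real:
  "embedding_time \<theta> X A \<omega> =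
    Inf (ennreal ` {t. 0 \<le> t \<and> 0 < target.phi_real (A t \<omega>) \<and> target.phi_real (A t \<omega>) \<le> X t \<omega>})"
proof -
  have "0 < phi \<theta> z \<and> phi \<theta> z \<le> ennreal y \<longleftrightarrow> 0 < target.phi_real z \<and> target.phi_real z \<le> y"
    for y z
    by (cases "0 \<le> y") (auto simp: target.phi_eq_phi_real target.phi_real_nonneg ennreal_neg)
  then show ?thesis unfolding embedding_time_def
    by (intro arg_cong[where f=Inf]) (auto simp: image_def)
qed

text \<open>If all levels exceed \<open>unit_frac m\<close>, a contact with a barrier of index
  \<open>n > m\<close> happens where it coincides with \<open>barrier m\<close>. So the contact
  times are constant from \<open>m\<close> on and give the embedding time. Conversely, a contact
  with \<open>phi_real\<close> at a positive level is a contact with some barrier.\<close>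

lemma AE_embedding_time:
  "AE \<omega> in P. \<exists>T\<ge>0. embedding_time \<theta> X A \<omega> = ennreal T \<and> X T \<omega> = target.phi_real (A T \<omega>) \<and>
     0 < A T \<omega> \<and> inf_level \<omega> = ennreal (A T \<omega>) \<and> (\<exists>m. inf_level \<omega> = hit_level m \<omega>) \<and>
     (\<forall>t\<ge>0. T \<le> t \<longleftrightarrow> (\<exists>n s. 0 \<le> s \<and> s \<le> t \<and> hit n \<omega> s))"
proof -
  have "AE \<omega> in P. \<forall>n. hit_level n \<omega> < \<infinity>"
    by (subst AE_all_countable) (intro allI AE_hit_level_finite)
  moreover have "AE \<omega> in P. \<forall>n. (\<exists>t\<ge>0. hit n \<omega> t) \<longrightarrow> X (hit_time n \<omega>) \<omega> = barrier n (A (hit_time n \<omega>) \<omega>)"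
    by (subst AE_all_countable) (intro allI Sigma_process_level.AE_X_touch_time[OF level])
  ultimately show ?thesis
    using AE_hit_levels_bounded_below AE_A_pos_if_X_pos
  proof eventually_elim
    case (elim \<omega>)
    obtain m where m: "\<And>n. ennreal (unit_frac m) < hit_level n \<omega>" using elim(3) by blast
    have ex: "\<exists>t\<ge>0. hit n \<omega> t" for n
    proof (rule ccontr)
      assume "\<not> ?thesis"
      then have "hit_level n \<omega> = \<infinity>"
        unfolding Sigma_path_level.contact_level_def[OF path_barrier] by (subst if_not_P) auto
      with elim(1) show False by (metis less_irrefl)
    qed
    let ?T = "\<lambda>n. hit_time n \<omega>"
    note T = Sigma_path_level.contact_contact_time[OF path_barrier ex]
    note Tle = Sigma_path_level.contact_time_le[OF path_barrier]
    have lev: "hit_level n \<omega> = ennreal (A (?T n) \<omega>)" for n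
      using ex by (simp add: Sigma_path_level.contact_level_def[OF path_barrier])
    have um: "unit_frac m < A (?T n) \<omega>" for n
      using m[of n] unit_frac_pos[of m] unfolding lev by (simp add: ennreal_less_iff)
    have Tm: "?T m \<le> ?T n" for n
    proof (cases "n \<le> m")
      case True
      show ?thesis by (rule Tle[OF T(1) hit_mono[OF True T(2)]])
    next
      case False
      then have "unit_frac n \<le> A (?T n) \<omega>" using um[of n] unit_frac_antimono[of m n] by linarith
      then have "barrier n (A (?T n) \<omega>) = barrier m (A (?T n) \<omega>)"
        using um[of n] by (simp add: barrier_eq less_imp_le)
      then have "hit m \<omega> (?T n)" using T(2)[of n] by (simp add: hit_iff)
      then show ?thesis by (rule Tle[OF T(1)])
    qed
    have Xm: "X (?T m) \<omega> = target.phi_real (A (?T m) \<omega>)"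
      using elim(2) ex um[of m] by (simp add: barrier_eq less_imp_le)
    have Apos: "0 < A (?T m) \<omega>" using um[of m] unit_frac_pos[of m] by linarith
    have "embedding_time \<theta> X A \<omega> = ennreal (?T m)"
      unfolding embedding_time_real
    proof (rule antisym)
      show "Inf (ennreal ` {t. 0 \<le> t \<and> 0 < target.phi_real (A t \<omega>) \<and> target.phi_real (A t \<omega>) \<le> X t \<omega>}) \<le> ennreal (?T m)"
        using T(1) Xm target.phi_real_pos[OF Apos] by (intro Inf_lower) auto
      show "ennreal (?T m) \<le> Inf (ennreal ` {t. 0 \<le> t \<and> 0 < target.phi_real (A t \<omega>) \<and> target.phi_real (A t \<omega>) \<le> X t \<omega>})"
      proof (rule Inf_greatest, elim imageE CollectE conjE, hypsubst)
        fix t assume t: "0 \<le> t" "0 < target.phi_real (A t \<omega>)" "target.phi_real (A t \<omega>) \<le> X t \<omega>"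
        then have "0 < A t \<omega>" using elim(4) by auto
        then obtain n where "unit_frac n < A t \<omega>" using unit_frac_less by blast
        then have "hit n \<omega> t" using t by (simp add: hit_iff barrier_eq less_imp_le)
        then have "?T n \<le> t" by (rule Tle[OF t(1)])
        with Tm[of n] show "ennreal (?T m) \<le> ennreal t" by (intro ennreal_leI) simp
      qed
    qed
    moreover have inf: "inf_level \<omega> = ennreal (A (?T m) \<omega>)"
      unfolding inf_level_def lev
    proof (rule antisym)
      show "(INF n. ennreal (A (?T n) \<omega>)) \<le> ennreal (A (?T m) \<omega>)" by (rule INF_lower) simp
      show "ennreal (A (?T m) \<omega>) \<le> (INF n. ennreal (A (?T n) \<omega>))"
        by (intro INF_greatest ennreal_leI Sigma_path.a_mono[OF path T(1) Tm])
    qed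
    moreover have "?T m \<le> t \<longleftrightarrow> (\<exists>n s. 0 \<le> s \<and> s \<le> t \<and> hit n \<omega> s)" for t
    proof
      assume "?T m \<le> t"
      then show "\<exists>n s. 0 \<le> s \<and> s \<le> t \<and> hit n \<omega> s" using T by blast
    next
      assume "\<exists>n s. 0 \<le> s \<and> s \<le> t \<and> hit n \<omega> s"
      then obtain n s where s: "0 \<le> s" "s \<le> t" "hit n \<omega> s" by blast
      then have "?T n \<le> s" by (intro Tle)
      with Tm[of n] s show "?T m \<le> t" by simp
    qed
    moreover have "\<exists>m. inf_level \<omega> = hit_level m \<omega>" using inf lev by metis
    ultimately show ?case using T(1) Xm Apos by blast
  qed
qed

lemma AE_embedding_time_finite: "AE \<omega> in P. embedding_time \<theta> X A \<omega> < \<infinity>"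
  using AE_embedding_time by eventually_elim auto

lemma embedding_time_event:
  assumes t: "0 \<le> t"
  obtains E where "E \<in> sets (G t)" "AE \<omega> in P. embedding_time \<theta> X A \<omega> \<le> ennreal t \<longleftrightarrow> \<omega> \<in> E"
proof -
  have "\<exists>E. E \<in> sets (G t) \<and> (AE \<omega> in P. (\<exists>s. 0 \<le> s \<and> s \<le> t \<and> hit n \<omega> s) \<longleftrightarrow> \<omega> \<in> E)" for n
  proof -
    obtain E where "E \<in> sets (G t)" "AE \<omega> in P. (\<exists>s. 0 \<le> s \<and> s \<le> t \<and> hit n \<omega> s) \<longleftrightarrow> \<omega> \<in> E"
      by (rule Sigma_process_level.touch_event[OF level t])
    then show ?thesis by (intro exI[of _ E] conjI)
  qed
  then have "\<exists>E. \<forall>n. E n \<in> sets (G t) \<and> (AE \<omega> in P. (\<exists>s. 0 \<le> s \<and> s \<le> t \<and> hit n \<omega> s) \<longleftrightarrow> \<omega> \<in> E n)"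
    by (intro choice allI)
  then obtain E where E: "\<And>n. E n \<in> sets (G t)"
    "\<And>n. AE \<omega> in P. (\<exists>s. 0 \<le> s \<and> s \<le> t \<and> hit n \<omega> s) \<longleftrightarrow> \<omega> \<in> E n" by blast
  have "AE \<omega> in P. \<forall>n. (\<exists>s. 0 \<le> s \<and> s \<le> t \<and> hit n \<omega> s) \<longleftrightarrow> \<omega> \<in> E n"
    by (subst AE_all_countable) (intro allI E(2))
  then have "AE \<omega> in P. embedding_time \<theta> X A \<omega> \<le> ennreal t \<longleftrightarrow> \<omega> \<in> (\<Union>n. E n)"
    using AE_embedding_time
  proof eventually_elim
    case (elim \<omega>)
    then obtain T where T: "embedding_time \<theta> X A \<omega> = ennreal T"
      "\<forall>t\<ge>0. T \<le> t \<longleftrightarrow> (\<exists>n s. 0 \<le> s \<and> s \<le> t \<and> hit n \<omega> s)" by blast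
    have "embedding_time \<theta> X A \<omega> \<le> ennreal t \<longleftrightarrow> T \<le> t" using T(1) t by simp
    also have "\<dots> \<longleftrightarrow> (\<exists>n. \<exists>s. 0 \<le> s \<and> s \<le> t \<and> hit n \<omega> s)" using T(2) t by blast
    also have "\<dots> \<longleftrightarrow> \<omega> \<in> (\<Union>n. E n)" unfolding elim(1)[rule_format] by blast
    finally show ?case .
  qed
  then show ?thesis using E(1) by (intro that[of "\<Union>n. E n"]) auto
qed

section \<open>The law of the embedded variable\<close>

abbreviation embedded :: "'a \<Rightarrow> real" where
  "embedded \<omega> \<equiv> X (enn2real (embedding_time \<theta> X A \<omega>)) \<omega>"

lemma AE_embedded: "AE \<omega> in P. 0 < enn2real (inf_level \<omega>) \<and> embedded \<omega> = target.phi_real (enn2real (inf_level \<omega>)) \<and>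
    inf_level \<omega> < \<infinity>"
  using AE_embedding_time
proof eventually_elim
  case (elim \<omega>)
  then obtain T where "0 \<le> T" "embedding_time \<theta> X A \<omega> = ennreal T" "X T \<omega> = target.phi_real (A T \<omega>)"
     "0 < A T \<omega>" "inf_level \<omega> = ennreal (A T \<omega>)" by blast
  then show ?case by simp
qed

lemma embedded_measurable: "embedded \<in> borel_measurable P"
proof (rule borel_measurable_cong_AE)
  have [measurable]: "target.phi_real \<in> borel_measurable borel"
    by (rule borel_measurable_mono[OF target.phi_real_mono])
  show "(\<lambda>\<omega>. target.phi_real (enn2real (inf_level \<omega>))) \<in> borel_measurable P" by measurable
  show "AE \<omega> in P. target.phi_real (enn2real (inf_level \<omega>)) = embedded \<omega>"
    using AE_embedded by eventually_elim simp
qed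

text \<open>The infimum is almost surely attained, so it exceeds \<open>v\<close> exactly if every
  \<open>hit_level n\<close> does. For \<open>v = 0\<close> its positivity is used instead.\<close>

lemma prob_inf_level_le:
  assumes v: "0 \<le> v"
  shows "prob {\<omega> \<in> space P. enn2real (inf_level \<omega>) \<le> v} = 1 - target.tail_phi v"
proof -
  define E where "E = {\<omega> \<in> space P. v < enn2real (inf_level \<omega>)}"
  have E: "E \<in> sets P" unfolding E_def by measurable
  have "prob E = target.tail_phi v"
  proof (cases "v = 0")
    case True
    have "prob E = 1" unfolding prob_eq_1[OF E]
      using AE_embedded AE_space by eventually_elim (simp add: E_def True)
    then show ?thesis by (simp add: True target.tail_phi_0)
  next
    case False
    have "AE \<omega> in P. \<omega> \<in> E \<longleftrightarrow> \<omega> \<in> {\<omega> \<in> space P. \<forall>n. ennreal v < hit_level n \<omega>}"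
      using AE_embedding_time AE_space
    proof eventually_elim
      case (elim \<omega>)
      then obtain T m where T: "0 < A T \<omega>" "inf_level \<omega> = ennreal (A T \<omega>)" "inf_level \<omega> = hit_level m \<omega>"
        by blast
      have "v < enn2real (inf_level \<omega>) \<longleftrightarrow> ennreal v < inf_level \<omega>"
        using T v by (simp add: ennreal_less_iff)
      also have "\<dots> \<longleftrightarrow> (\<forall>n. ennreal v < hit_level n \<omega>)"
      proof
        have "inf_level \<omega> \<le> hit_level n \<omega>" for n unfolding inf_level_def by (rule INF_lower) simp
        then show "ennreal v < inf_level \<omega> \<Longrightarrow> \<forall>n. ennreal v < hit_level n \<omega>"
          by (blast intro: less_le_trans)
      qed (use T(3) in simp)
      finally show ?case using elim(2) by (simp add: E_def)
    qed
    then have "prob E = prob {\<omega> \<in> space P. \<forall>n. ennreal v < hit_level n \<omega>}"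
      using E by (intro measure_eq_AE) auto
    then show ?thesis using prob_all_hit_levels[of v] v False by simp
  qed
  moreover have "{\<omega> \<in> space P. enn2real (inf_level \<omega>) \<le> v} = space P - E" by (auto simp: E_def)
  ultimately show ?thesis using prob_compl[OF E] by simp
qed

lemma X_nonneg: "0 \<le> X (enn2real t) \<omega>"
  by (rule Sigma_path.x_nonneg[OF path]) simp

text \<open>\<open>phi_real (I \<omega>) \<le> x\<close> implies
  \<open>I \<omega> \<le> psi_real x\<close>, which gives one inequality. Conversely only
  \<open>I \<omega> < psi_real x\<close> is sufficient, since at equality \<open>phi_real\<close>
  may already have jumped past \<open>x\<close>; so the other inequality is taken at a slightly
  smaller level.\<close>

lemma cdf_embedded: "prob {\<omega> \<in> space P. embedded \<omega> \<le> x} = cdf \<theta> x"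
proof -
  note embedded_measurable[measurable]
  define I where "I \<omega> = enn2real (inf_level \<omega>)" for \<omega>
  have [measurable]: "I \<in> borel_measurable P" unfolding I_def by measurable
  have ae: "AE \<omega> in P. embedded \<omega> = target.phi_real (I \<omega>) \<and> ennreal (I \<omega>) = inf_level \<omega>"
    using AE_embedded by eventually_elim (simp add: I_def)
  have I0: "0 \<le> I \<omega>" for \<omega> by (simp add: I_def)
  have I_le: "prob {\<omega> \<in> space P. I \<omega> \<le> v} = 1 - target.tail_phi v" if "0 \<le> v" for v
    using prob_inf_level_le[OF that] by (simp add: I_def)
  consider "x < 0" | "0 \<le> x" "tail \<theta> x = 0" | "0 \<le> x" "0 < tail \<theta> x"
    using target.tail_nonneg[of x] by fastforce
  then show ?thesis
  proof cases
    case 1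
    then have "{\<omega> \<in> space P. embedded \<omega> \<le> x} = {}"
      using X_nonneg by (auto simp: not_le intro: less_le_trans)
    then have "prob {\<omega> \<in> space P. embedded \<omega> \<le> x} = 0" by (simp only: measure_empty)
    moreover have "tail \<theta> x = 1" using target.tail_antimono[of x 0] 1 target.tail_0 target.tail_le_1[of x] by simp
    ultimately show ?thesis using target.tail_eq_cdf[of x] by simp
  next
    case 2
    have "AE \<omega> in P. \<omega> \<in> {\<omega> \<in> space P. embedded \<omega> \<le> x}"
      using ae AE_space
    proof eventually_elim
      case (elim \<omega>)
      have "target.phi_real (I \<omega>) \<le> x"
      proof (rule ccontr)
        assume "\<not> ?thesis"
        then have "tail \<theta> (target.phi_real (I \<omega>)) \<le> 0" using target.tail_antimono[of x] 2 by simp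
        then show False using target.psi_real_phi_real(1)[OF I0, of \<omega>] by simp
      qed
      then show ?case using elim by simp
    qed
    then have "prob {\<omega> \<in> space P. embedded \<omega> \<le> x} = 1" by (subst prob_eq_1) auto
    then show ?thesis using target.tail_eq_cdf[of x] 2 by simp
  next
    case 3
    define v where "v = target.psi_real x"
    have v0: "0 \<le> v" unfolding v_def by (rule target.psi_real_nonneg)
    have Kv: "target.tail_phi v = tail \<theta> x" unfolding v_def by (rule target.tail_phi_psi_real[OF 3])
    have px: "psi \<theta> x = ennreal v" unfolding v_def by (rule target.psi_eq_psi_real[OF 3])
    have "prob {\<omega> \<in> space P. embedded \<omega> \<le> x} \<le> prob {\<omega> \<in> space P. I \<omega> \<le> v}"
    proof (rule finite_measure_mono_AE)
      show "AE \<omega> in P. \<omega> \<in> {\<omega> \<in> space P. embedded \<omega> \<le> x} \<longrightarrow> \<omega> \<in> {\<omega> \<in> space P. I \<omega> \<le> v}"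
        using ae
      proof eventually_elim
        case (elim \<omega>)
        have "I \<omega> \<le> v" if "target.phi_real (I \<omega>) \<le> x"
          using target.psi_real_mono[OF target.phi_real_nonneg that 3(2)] target.psi_real_phi_real(2)[OF I0, of \<omega>]
          by (simp add: v_def)
        then show ?case using elim by auto
      qed
    qed measurable
    also have "\<dots> = 1 - tail \<theta> x" by (simp add: I_le v0 Kv)
    finally have upper: "prob {\<omega> \<in> space P. embedded \<omega> \<le> x} \<le> 1 - tail \<theta> x" .
    have "1 - tail \<theta> x \<le> prob {\<omega> \<in> space P. embedded \<omega> \<le> x}"
    proof (cases "v = 0")
      case True
      then show ?thesis using Kv target.tail_phi_0 by simp
    next
      case False
      then have v: "0 < v" using v0 by simp
      have f: "0 < target.phi_real (v / 2)" using v by (intro target.phi_real_pos) simp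
      show ?thesis
      proof (rule field_le_epsilon)
        fix e :: real assume e: "0 < e"
        \<comment> \<open>\<open>d \<le> v / 2\<close> keeps \<open>phi_real (v - d)\<close> at
          least \<open>phi_real (v / 2) > 0\<close>; the other bound then limits the loss of
          \<open>tail_phi\<close> over \<open>[v - d, v]\<close> to \<open>e\<close>.\<close>
        define d where "d = min (v / 2) (e * target.phi_real (v / 2))"
        have d: "0 < d" "d \<le> v / 2" "d \<le> e * target.phi_real (v / 2)" using v e f by (auto simp: d_def)
        have "target.phi_real (v / 2) * (target.tail_phi (v - d) - tail \<theta> x) \<le>
            target.phi_real (v - d) * (target.tail_phi (v - d) - tail \<theta> x)"
        proof (intro mult_right_mono phi_real_leD)
          show "0 \<le> target.tail_phi (v - d) - tail \<theta> x"
            unfolding Kv[symmetric] target.tail_phi_def using d by (auto intro!: target.tail_antimono phi_real_leD)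
        qed (use d in simp)
        also have "\<dots> \<le> d * target.tail_phi (v - d)"
          using decaysD(2)[OF target.decays_tail_phi, of "v - d" v] d v by (simp add: Kv)
        also have "\<dots> \<le> d * 1"
          using d by (intro mult_left_mono) (auto simp: target.tail_phi_def target.tail_le_1)
        also have "\<dots> \<le> target.phi_real (v / 2) * e" using d(3) by (simp add: mult.commute)
        finally have K: "target.tail_phi (v - d) - tail \<theta> x \<le> e" using f by simp
        have "1 - target.tail_phi (v - d) = prob {\<omega> \<in> space P. I \<omega> \<le> v - d}"
          using d v by (simp add: I_le)
        also have "\<dots> \<le> prob {\<omega> \<in> space P. embedded \<omega> \<le> x}"
        proof (rule finite_measure_mono_AE)
          show "AE \<omega> in P. \<omega> \<in> {\<omega> \<in> space P. I \<omega> \<le> v - d} \<longrightarrow> \<omega> \<in> {\<omega> \<in> space P. embedded \<omega> \<le> x}"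
            using ae
          proof eventually_elim
            case (elim \<omega>)
            have "target.phi_real (I \<omega>) \<le> x" if "I \<omega> \<le> v - d"
              using that d v 3(1) px by (intro target.phi_real_le) (auto intro!: ennreal_lessI)
            then show ?case using elim by auto
          qed
        qed measurable
        finally show "1 - tail \<theta> x \<le> prob {\<omega> \<in> space P. embedded \<omega> \<le> x} + e" using K by simp
      qed
    qed
    with upper show ?thesis using target.tail_eq_cdf[of x] by simp
  qed
qed

lemma distr_embedded: "distr P borel embedded = \<theta>"
proof (rule cdf_unique)
  note embedded_measurable[measurable]
  show "real_distribution (distr P borel embedded)"
    by (rule real_distribution_distr) measurable
  show "real_distribution \<theta>" by (rule target.real_distribution_axioms)
  show "cdf (distr P borel embedded) = cdf \<theta>"
  proof
    fix x
    have "embedded -` {..x} \<inter> space P = {\<omega> \<in> space P. embedded \<omega> \<le> x}" by auto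
    then show "cdf (distr P borel embedded) x = cdf \<theta> x"
      using cdf_embedded[of x] by (simp add: cdf_def measure_distr)
  qed
qed

end

section \<open>Augmentation and the general case\<close>

text \<open>One-sided limits of \<open>x\<close> come from those of \<open>n\<close>, as
  \<open>a\<close> is continuous. If \<open>x\<close> had no zero in \<open>{s<..t}\<close>, that
  interval would be null for \<open>dA\<close>, whose mass there is
  \<open>a t - a s > 0\<close>.\<close>

lemma Sigma_path_of_decomposition:
  fixes x n a :: "real \<Rightarrow> real"
  assumes nonneg: "\<forall>t\<ge>0. 0 \<le> x t" and decomp: "\<forall>t\<ge>0. x t = n t + a t"
    and n: "cadlag n" "n 0 = 0"
    and a: "continuous_on {0..} a" "mono_on {0..} a" "a 0 = 0" "filterlim a at_top at_top"
    and carried: "AE t in interval_measure (\<lambda>t. a (max 0 t)). 0 \<le> t \<longrightarrow> x t = 0"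
    and jumps: "\<forall>t>0. jump x t \<le> 0"
  shows "Sigma_path x a"
proof
  show "0 \<le> x t" if "0 \<le> t" for t using nonneg that by simp
  show "x 0 = 0" using decomp n(2) a(3) by simp
  show "a 0 = 0" by fact
  show "continuous_on {0..} a" by fact
  show mono: "a s \<le> a t" if "0 \<le> s" "s \<le> t" for s t
    using a(2) that by (auto simp: monotone_on_def)
  show "filterlim a at_top at_top" by fact
  show "(x \<longlongrightarrow> x t) (at_right t)" if t: "0 \<le> t" for t
  proof -
    have "(n \<longlongrightarrow> n t) (at_right t)" using n(1) t by (simp add: cadlag_def continuous_within)
    moreover have "(a \<longlongrightarrow> a t) (at_right t)"
      using a(1) t by (auto simp: continuous_on_def intro: tendsto_within_subset)
    ultimately have "((\<lambda>s. n s + a s) \<longlongrightarrow> n t + a t) (at_right t)" by (rule tendsto_add)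
    moreover have "eventually (\<lambda>s. n s + a s = x s) (at_right t)"
      using eventually_at_right_less[of t] by eventually_elim (use decomp t in auto)
    ultimately have "(x \<longlongrightarrow> n t + a t) (at_right t)" by (rule Lim_transform_eventually)
    then show ?thesis using decomp t by simp
  qed
  show "\<exists>l\<ge>x t. (x \<longlongrightarrow> l) (at_left t)" if t: "0 < t" for t
  proof -
    obtain l where l: "(n \<longlongrightarrow> l) (at_left t)" using n(1) t by (auto simp: cadlag_def)
    have "isCont a t" using a(1) t by (auto intro: continuous_on_interior)
    then have "(a \<longlongrightarrow> a t) (at_left t)" by (simp add: isCont_def filterlim_at_split)
    with l have "((\<lambda>s. n s + a s) \<longlongrightarrow> l + a t) (at_left t)" by (rule tendsto_add)
    moreover have "eventually (\<lambda>s. n s + a s = x s) (at_left t)"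
      using eventually_at_left_real[OF t] by eventually_elim (use decomp in auto)
    ultimately have lim: "(x \<longlongrightarrow> l + a t) (at_left t)" by (rule Lim_transform_eventually)
    then have "Lim (at_left t) x = l + a t" by (intro tendsto_Lim trivial_limit_at_left_real)
    then show ?thesis using lim jumps t by (auto simp: jump_def intro!: exI[of _ "l + a t"])
  qed
  show "\<exists>r\<in>{s<..t}. x r = 0" if s: "0 \<le> s" and st: "s < t" and as: "a s < a t" for s t
  proof (rule ccontr)
    assume neg: "\<not> ?thesis"
    let ?b = "\<lambda>t. a (max 0 t)"
    have "continuous_on UNIV ?b"
      by (rule continuous_on_compose2[OF a(1)]) (auto intro!: continuous_intros)
    then have cont: "continuous (at_right z) ?b" for z
      by (auto simp: continuous_on_eq_continuous_within intro: continuous_within_subset)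
    have "emeasure (interval_measure ?b) {s<..t} = ennreal (?b t - ?b s)"
      using st mono cont by (intro emeasure_interval_measure_Ioc) auto
    moreover have "AE r in interval_measure ?b. r \<notin> {s<..t}"
      using carried
    proof eventually_elim
      case (elim r)
      then show ?case using neg s by force
    qed
    then have "emeasure (interval_measure ?b) {s<..t} = 0"
      by (subst (asm) AE_iff_measurable[of "{s<..t}"]) auto
    ultimately show False using s st as by (simp add: max_def ennreal_eq_0_iff)
  qed
qed

context filtered_prob_space
begin

lemma space_F_eq: "space (F t) = space M"
  using subalgebra_F[of t] by (simp add: subalgebra_def)

lemma space_augmented: "space (augmented M F t) = space M"
  unfolding augmented_def by (simp add: space_measure_of_conv)

lemma augmented_generators: "sets (F t) \<union> null_sets (completion M) \<subseteq> Pow (space M)"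
  using sets.sets_into_space[of _ "F t"] sets.sets_into_space[of _ "completion M"]
  by (auto simp: space_F_eq null_sets_def)

lemma sets_augmented: "sets (augmented M F t) = sigma_sets (space M) (sets (F t) \<union> null_sets (completion M))"
  unfolding augmented_def by (rule sets_measure_of[OF augmented_generators])

lemma augmentedI: "E \<in> sets (F t) \<Longrightarrow> E \<in> sets (augmented M F t)"
  by (simp add: sets_augmented sigma_sets.Basic)

lemma augmentedI_null: "E \<in> null_sets (completion M) \<Longrightarrow> E \<in> sets (augmented M F t)"
  by (simp add: sets_augmented sigma_sets.Basic)

lemma augmented_mono: "s \<le> t \<Longrightarrow> sets (augmented M F s) \<subseteq> sets (augmented M F t)"
  unfolding sets_augmented using sets_F_mono[of s t] by (intro sigma_sets_mono') auto

lemma subalgebra_augmented: "subalgebra (completion M) (augmented M F t)"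
proof -
  have "sets (F t) \<union> null_sets (completion M) \<subseteq> sets (completion M)"
    using subalgebra_F[of t] by (auto simp: subalgebra_def null_sets_def)
  then have "sets (augmented M F t) \<subseteq> sets (completion M)"
    unfolding sets_augmented using sets.sigma_sets_subset[of _ "completion M"] by simp
  then show ?thesis by (simp add: subalgebra_def space_augmented)
qed

lemma subalgebra_F_augmented: "subalgebra (augmented M F t) (F t)"
  by (auto simp: subalgebra_def space_augmented space_F_eq augmentedI)

text \<open>Induction over the generated \<sigma>-algebra. As integrals ignore null sets, this
  carries the martingale identity from \<open>F\<close> to the augmented filtration.\<close>

lemma augmented_approx:
  assumes "E \<in> sets (augmented M F t)"
  shows "\<exists>E'\<in>sets (F t). AE \<omega> in M. \<omega> \<in> E \<longleftrightarrow> \<omega> \<in> E'"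
  using assms unfolding sets_augmented
proof (induction rule: sigma_sets.induct)
  case (Basic E)
  then show ?case
  proof
    assume "E \<in> null_sets (completion M)"
    then have "AE \<omega> in M. \<omega> \<notin> E" by (subst AE_completion_iff[symmetric]) (rule AE_not_in)
    then show ?thesis by (intro bexI[of _ "{}"]) auto
  qed (auto intro!: bexI[of _ E])
next
  case Empty
  then show ?case by (intro bexI[of _ "{}"]) auto
next
  case (Compl E)
  then obtain E' where E': "E' \<in> sets (F t)" "AE \<omega> in M. \<omega> \<in> E \<longleftrightarrow> \<omega> \<in> E'" by blast
  then have "space M - E' \<in> sets (F t)" using sets.compl_sets[of E' "F t"] by (simp add: space_F_eq)
  with E'(2) show ?case by (intro bexI[of _ "space M - E'"]) auto
next
  case (Union E)
  then have "\<forall>i. \<exists>E'. E' \<in> sets (F t) \<and> (AE \<omega> in M. \<omega> \<in> E i \<longleftrightarrow> \<omega> \<in> E')" by blast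
  then obtain E' where E': "\<And>i. E' i \<in> sets (F t)" "\<And>i. AE \<omega> in M. \<omega> \<in> E i \<longleftrightarrow> \<omega> \<in> E' i"
    using choice[of "\<lambda>i E'. E' \<in> sets (F t) \<and> (AE \<omega> in M. \<omega> \<in> E i \<longleftrightarrow> \<omega> \<in> E')"] by blast
  have "AE \<omega> in M. \<forall>i. \<omega> \<in> E i \<longleftrightarrow> \<omega> \<in> E' i" by (subst AE_all_countable) (intro allI E'(2))
  then have "AE \<omega> in M. \<omega> \<in> (\<Union>i. E i) \<longleftrightarrow> \<omega> \<in> (\<Union>i. E' i)" by eventually_elim auto
  with E'(1) show ?case by (intro bexI[of _ "\<Union>i. E' i"]) auto
qed

text \<open>\<open>B\<close> arises from \<open>E\<close> by adding and removing null sets of the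
  completion, which belong to the augmented \<sigma>-algebra.\<close>

lemma augmented_cong_AE:
  assumes E: "E \<in> sets (augmented M F t)" and eq: "AE \<omega> in M. \<omega> \<in> E \<longleftrightarrow> \<omega> \<in> B" and B: "B \<subseteq> space M"
  shows "B \<in> sets (augmented M F t)"
proof -
  have Esub: "E \<subseteq> space M" using sets.sets_into_space[OF E] by (simp add: space_augmented)
  have "AE \<omega> in completion M. \<omega> \<notin> B - E \<and> \<omega> \<notin> E - B"
    unfolding AE_completion_iff using eq by eventually_elim auto
  then have "B - E \<in> null_sets (completion M)" "E - B \<in> null_sets (completion M)"
    using B Esub unfolding completion.null_sets_iff_AE by auto
  then have "E \<union> (B - E) - (E - B) \<in> sets (augmented M F t)"
    by (intro sets.Diff sets.Un E augmentedI_null)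
  also have "E \<union> (B - E) - (E - B) = B" by auto
  finally show ?thesis .
qed

lemma augmented_measurable_cong_AE:
  fixes f g :: "'a \<Rightarrow> real"
  assumes f: "f \<in> borel_measurable (F t)" and eq: "AE \<omega> in M. f \<omega> = g \<omega>"
  shows "g \<in> borel_measurable (augmented M F t)"
  unfolding borel_measurable_iff_le
proof
  fix b
  have f': "f \<in> borel_measurable (augmented M F t)"
    by (rule measurable_from_subalg[OF subalgebra_F_augmented f])
  have "{\<omega> \<in> space M. g \<omega> \<le> b} \<in> sets (augmented M F t)"
  proof (rule augmented_cong_AE)
    show "{\<omega> \<in> space M. f \<omega> \<le> b} \<in> sets (augmented M F t)"
      using f' by (simp add: borel_measurable_iff_le space_augmented)
    show "AE \<omega> in M. \<omega> \<in> {\<omega> \<in> space M. f \<omega> \<le> b} \<longleftrightarrow> \<omega> \<in> {\<omega> \<in> space M. g \<omega> \<le> b}"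
      using eq by eventually_elim auto
  qed auto
  then show "{\<omega> \<in> space (augmented M F t). g \<omega> \<le> b} \<in> sets (augmented M F t)"
    by (simp add: space_augmented)
qed

lemma martingale_integral_indicator:
  assumes "martingale M F Y" "0 \<le> s" "s \<le> t" "E \<in> sets (F (ennreal s))"
  shows "(\<integral>\<omega>. indicator E \<omega> * Y s \<omega> \<partial>M) = (\<integral>\<omega>. indicator E \<omega> * Y t \<omega> \<partial>M)"
proof -
  interpret fs: finite_measure_subalgebra M "F (ennreal s)"
    by unfold_locales (rule subalgebra_F)
  have int: "integrable M (Y t)" "integrable M (Y s)" using assms by (auto simp: martingale_def)
  have E: "E \<in> sets M" using assms(4) subalgebra_F by (auto simp: subalgebra_def)
  have "(\<integral>\<omega>\<in>E. Y t \<omega> \<partial>M) = (\<integral>\<omega>\<in>E. real_cond_exp M (F (ennreal s)) (Y t) \<omega> \<partial>M)"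
    by (rule fs.real_cond_exp_intA[OF int(1) assms(4)])
  also have "\<dots> = (\<integral>\<omega>\<in>E. Y s \<omega> \<partial>M)"
    unfolding set_lebesgue_integral_def
  proof (rule integral_cong_AE)
    have "AE \<omega> in M. real_cond_exp M (F (ennreal s)) (Y t) \<omega> = Y s \<omega>"
      using assms by (auto simp: martingale_def)
    then show "AE \<omega> in M. indicat_real E \<omega> *\<^sub>R real_cond_exp M (F (ennreal s)) (Y t) \<omega> = indicat_real E \<omega> *\<^sub>R Y s \<omega>"
      by eventually_elim simp
  qed (use int E in auto)
  finally show ?thesis by (simp add: set_lebesgue_integral_def)
qed

end

text \<open>The filtration is augmented because path regularity and the absence of a jump at the
  contact hold only almost surely; for the same reason the stopped value is treated on the
  completion.\<close>

theorem theorem5p1: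
  fixes M :: "'a measure" and F :: "ennreal \<Rightarrow> 'a measure"
    and X N A :: "real \<Rightarrow> 'a \<Rightarrow> real" and \<theta> :: "real measure"
  assumes "filtered_prob_space M F"
    and "real_distribution \<theta>" and "measure \<theta> {0..} = 1" and "\<And>x. measure \<theta> {x} = 0"
    and "class_Sigma M F X N A"
    and "only_negative_jumps M X"
    and "AE \<omega> in M. filterlim (\<lambda>t. A t \<omega>) at_top at_top"
  shows "let T = embedding_time \<theta> X A; X\<^sub>T = (\<lambda>\<omega>. X (enn2real (T \<omega>)) \<omega>) in
    stopping_time (augmented M F) T \<and>
    (AE \<omega> in M. T \<omega> < \<infinity>) \<and>
    X\<^sub>T \<in> borel_measurable (completion M) \<and> distr (completion M) borel X\<^sub>T = \<theta>"
proof -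
  interpret filtered_prob_space M F by fact
  note Sigma = assms(5)[unfolded class_Sigma_def]
  have X_adapted: "X t \<in> borel_measurable (F (ennreal t))" if "0 \<le> t" for t
    using Sigma that by (auto simp: local_submartingale_def adapted_def)
  have A_adapted: "A t \<in> borel_measurable (F (ennreal t))" if "0 \<le> t" for t
    using Sigma that by (auto simp: adapted_def)
  obtain \<sigma> where \<sigma>: "localizing M F \<sigma>" "\<And>n. martingale M F (stopped N (\<sigma> n))"
    using Sigma unfolding local_martingale_def by blast
  have \<sigma>_top: "AE \<omega> in M. (\<lambda>n. \<sigma> n \<omega>) \<longlonglongrightarrow> \<infinity>" using \<sigma>(1) by (auto simp: localizing_def)
  have paths: "AE \<omega> in M. \<forall>t\<ge>0. 0 \<le> X t \<omega>" "AE \<omega> in M. \<forall>t\<ge>0. X t \<omega> = N t \<omega> + A t \<omega>"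
    "AE \<omega> in M. cadlag (\<lambda>t. N t \<omega>)" "AE \<omega> in M. N 0 \<omega> = 0"
    "AE \<omega> in M. continuous_on {0..} (\<lambda>t. A t \<omega>) \<and> mono_on {0..} (\<lambda>t. A t \<omega>)" "AE \<omega> in M. A 0 \<omega> = 0"
    "AE \<omega> in M. AE t in interval_measure (\<lambda>t. A (max 0 t) \<omega>). 0 \<le> t \<longrightarrow> X t \<omega> = 0"
    using Sigma by simp_all
  have "AE \<omega> in M. Sigma_path (\<lambda>t. X t \<omega>) (\<lambda>t. A t \<omega>) \<and> (\<forall>t\<ge>0. X t \<omega> = N t \<omega> + A t \<omega>)"
    using paths assms(6)[unfolded only_negative_jumps_def] assms(7)
  proof eventually_elim
    case (elim \<omega>)
    then show ?case by (auto intro!: Sigma_path_of_decomposition[of _ "\<lambda>t. N t \<omega>"])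
  qed
  then obtain B where B: "{\<omega> \<in> space M. \<not> (Sigma_path (\<lambda>t. X t \<omega>) (\<lambda>t. A t \<omega>) \<and> (\<forall>t\<ge>0. X t \<omega> = N t \<omega> + A t \<omega>))} \<subseteq> B"
    "emeasure M B = 0" "B \<in> sets M" by (rule AE_E)
  define \<Omega>0 where "\<Omega>0 = space M - B"
  have \<Omega>0: "Sigma_path (\<lambda>t. X t \<omega>) (\<lambda>t. A t \<omega>)" "\<And>t. 0 \<le> t \<Longrightarrow> X t \<omega> = N t \<omega> + A t \<omega>" if "\<omega> \<in> \<Omega>0" for \<omega>
    using B(1) that by (auto simp: \<Omega>0_def)
  have ae: "AE \<omega> in M. \<omega> \<in> \<Omega>0"
    using AE_not_in[of B M] B AE_space by (auto simp: \<Omega>0_def null_sets_def)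
  \<comment> \<open>The augmented filtration contains the null sets, so all paths may be made regular.\<close>
  define X' where "X' t \<omega> = (if \<omega> \<in> \<Omega>0 then X t \<omega> else 0)" for t \<omega>
  \<comment> \<open>The substitute path \<open>X' = 0\<close>, \<open>A' = t\<close> is regular;
    \<open>A'\<close> has to tend to infinity, so it cannot be 0.\<close>
  define A' where "A' t \<omega> = (if \<omega> \<in> \<Omega>0 then A t \<omega> else t)" for t \<omega>
  let ?N' = "\<lambda>t \<omega>. X' t \<omega> - A' t \<omega>"
  have stopped_eq: "AE \<omega> in M. stopped N (\<sigma> n) t \<omega> = stopped ?N' (\<sigma> n) t \<omega>" for n t
    using ae by eventually_elim (simp add: stopped_def X'_def A'_def \<Omega>0)
  have stopped_M: "stopped N (\<sigma> n) t \<in> borel_measurable (F (ennreal t))" "integrable M (stopped N (\<sigma> n) t)"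
    if "0 \<le> t" for n t
    using \<sigma>(2)[of n] that by (auto simp: martingale_def adapted_def)
  have stopped_aug: "stopped ?N' (\<sigma> n) t \<in> borel_measurable (augmented M F (ennreal t))" if "0 \<le> t" for n t
    by (rule augmented_measurable_cong_AE[OF stopped_M(1)[OF that] stopped_eq])
  have stopped_completion: "stopped ?N' (\<sigma> n) t \<in> borel_measurable (completion M)" if "0 \<le> t" for n t
    by (rule measurable_from_subalg[OF subalgebra_augmented stopped_aug[OF that]])
  have path': "Sigma_path (\<lambda>t. X' t \<omega>) (\<lambda>t. A' t \<omega>)" for \<omega>
  proof (cases "\<omega> \<in> \<Omega>0")
    case True
    then show ?thesis using \<Omega>0(1)[OF True] by (simp add: X'_def A'_def)
  next
    case False
    have "Sigma_path (\<lambda>_. 0) (\<lambda>t. t)"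
      by unfold_locales (auto simp: filterlim_ident)
    with False show ?thesis by (simp add: X'_def A'_def)
  qed
  interpret P: prob_space "completion M" by (rule prob_space_completion)
  interpret Q: embedding_target \<theta>
    by (intro embedding_target.intro embedding_target_axioms.intro assms(2-4))
  interpret S: Sigma_embedding "completion M" "\<lambda>t. augmented M F (ennreal t)" X' A' \<sigma> \<theta>
  proof (intro Sigma_embedding.intro Sigma_process.intro Sigma_process_axioms.intro real_filtration.intro
      real_filtration_axioms.intro P.prob_space_axioms completion.complete_measure_axioms
      Q.embedding_target_axioms)
    show "subalgebra (completion M) (augmented M F (ennreal t))" for t by (rule subalgebra_augmented)
    show "sets (augmented M F (ennreal s)) \<subseteq> sets (augmented M F (ennreal t))" if "0 \<le> s" "s \<le> t" for s t
      using that by (intro augmented_mono ennreal_leI)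
    show "Sigma_path (\<lambda>t. X' t \<omega>) (\<lambda>t. A' t \<omega>)" for \<omega> by (rule path')
    show "X' t \<in> borel_measurable (augmented M F (ennreal t))" if "0 \<le> t" for t
      by (rule augmented_measurable_cong_AE[OF X_adapted[OF that]])
        (use ae in eventually_elim, simp add: X'_def)
    show "A' t \<in> borel_measurable (augmented M F (ennreal t))" if "0 \<le> t" for t
      by (rule augmented_measurable_cong_AE[OF A_adapted[OF that]])
        (use ae in eventually_elim, simp add: A'_def)
    show "stopped ?N' (\<sigma> n) t \<in> borel_measurable (augmented M F (ennreal t))" if "0 \<le> t" for t n
      by (rule stopped_aug[OF that])
    have bm: "stopped N (\<sigma> n) t \<in> borel_measurable M" if "0 \<le> t" for t n
      using stopped_M(2)[OF that] by auto
    show "integrable (completion M) (stopped ?N' (\<sigma> n) t)" if "0 \<le> t" for t n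
    proof -
      have "integrable (completion M) (stopped N (\<sigma> n) t)"
        using stopped_M(2)[OF that] bm[OF that] by (simp add: integrable_completion)
      moreover have "AE \<omega> in completion M. stopped N (\<sigma> n) t \<omega> = stopped ?N' (\<sigma> n) t \<omega>"
        using stopped_eq by (rule AE_completion)
      ultimately show ?thesis
        by (rule integrable_cong_AE[THEN iffD1, OF measurable_completion[OF bm[OF that]] stopped_completion[OF that], rotated])
    qed
    show "(\<integral>\<omega>. indicator E \<omega> * stopped ?N' (\<sigma> n) s \<omega> \<partial>completion M) =
        (\<integral>\<omega>. indicator E \<omega> * stopped ?N' (\<sigma> n) t \<omega> \<partial>completion M)"
      if st: "0 \<le> s" "s \<le> t" "E \<in> sets (augmented M F (ennreal s))" for s t E n
    proof -
      \<comment> \<open>Passing from \<open>E\<close> to \<open>E'\<close> and from the modified to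
        the original process affects only null sets, so the identity on \<open>M\<close> carries
        over to the completion.\<close>
      obtain E' where E': "E' \<in> sets (F (ennreal s))" "AE \<omega> in M. \<omega> \<in> E \<longleftrightarrow> \<omega> \<in> E'"
        using augmented_approx[OF st(3)] by blast
      have sets: "E' \<in> sets M" "E \<in> sets (completion M)"
        using E'(1) st(3) subalgebra_F[of "ennreal s"] subalgebra_augmented[of "ennreal s"]
        by (auto simp: subalgebra_def)
      have "(\<integral>\<omega>. indicator E \<omega> * stopped ?N' (\<sigma> n) r \<omega> \<partial>completion M) =
        (\<integral>\<omega>. indicator E' \<omega> * stopped N (\<sigma> n) r \<omega> \<partial>M)" if r: "0 \<le> r" for r
      proof -
        have m: "(\<lambda>\<omega>. indicator E' \<omega> * stopped N (\<sigma> n) r \<omega>) \<in> borel_measurable M"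
          using bm[OF r, of n] sets(1) by measurable
        have "AE \<omega> in completion M. indicator E \<omega> * stopped ?N' (\<sigma> n) r \<omega> = indicator E' \<omega> * stopped N (\<sigma> n) r \<omega>"
          unfolding AE_completion_iff using E'(2) stopped_eq[of n r]
          by eventually_elim (simp add: indicator_def)
        moreover have "(\<lambda>\<omega>. indicator E \<omega> * stopped ?N' (\<sigma> n) r \<omega>) \<in> borel_measurable (completion M)"
          using stopped_completion[OF r, of n] sets(2) by measurable
        ultimately have "(\<integral>\<omega>. indicator E \<omega> * stopped ?N' (\<sigma> n) r \<omega> \<partial>completion M) =
            (\<integral>\<omega>. indicator E' \<omega> * stopped N (\<sigma> n) r \<omega> \<partial>completion M)"
          using measurable_completion[OF m] by (intro integral_cong_AE)
        then show ?thesis using m by (simp add: integral_completion)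
      qed
      then show ?thesis using martingale_integral_indicator[OF \<sigma>(2) st(1,2) E'(1)] st by simp
    qed
    show "AE \<omega> in completion M. (\<lambda>n. \<sigma> n \<omega>) \<longlonglongrightarrow> \<infinity>" using \<sigma>_top by (rule AE_completion)
  qed
  let ?T = "embedding_time \<theta> X A" and ?T' = "embedding_time \<theta> X' A'"
  have T_eq: "?T \<omega> = ?T' \<omega>" "X t \<omega> = X' t \<omega>" if "\<omega> \<in> \<Omega>0" for \<omega> t
    using that by (simp_all add: embedding_time_def X'_def A'_def)
  have "stopping_time (augmented M F) ?T"
  proof
    fix t :: ennreal
    have "{\<omega> \<in> space M. ?T \<omega> \<le> t} \<in> sets (augmented M F t)"
    proof (cases t)
      case (real r)
      obtain E where E: "E \<in> sets (augmented M F (ennreal r))"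
        "AE \<omega> in completion M. ?T' \<omega> \<le> ennreal r \<longleftrightarrow> \<omega> \<in> E"
        by (rule S.embedding_time_event[OF real(1)])
      have eq: "AE \<omega> in M. \<omega> \<in> E \<longleftrightarrow> \<omega> \<in> {\<omega> \<in> space M. ?T \<omega> \<le> t}"
        using E(2)[unfolded AE_completion_iff] ae AE_space
      proof eventually_elim
        case (elim \<omega>)
        have "?T \<omega> = ?T' \<omega>" by (rule T_eq(1)[OF elim(2)])
        with elim(1,3) show ?case by (simp add: real(2))
      qed
      have "E \<in> sets (augmented M F t)" using E(1) by (simp only: real(2))
      then show ?thesis using eq Collect_restrict by (rule augmented_cong_AE)
    next
      case top
      then show ?thesis using sets.top[of "augmented M F t"] by (simp add: space_augmented)
    qed
    then show "Measurable.pred (augmented M F t) (\<lambda>\<omega>. ?T \<omega> \<le> t)"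
      by (simp add: pred_def space_augmented)
  qed
  moreover have "AE \<omega> in M. ?T \<omega> < \<infinity>"
    using S.AE_embedding_time_finite[unfolded AE_completion_iff] ae by eventually_elim (simp add: T_eq)
  moreover have eq: "AE \<omega> in completion M. S.embedded \<omega> = X (enn2real (?T \<omega>)) \<omega>"
    unfolding AE_completion_iff using ae by eventually_elim (simp add: T_eq)
  moreover have meas: "(\<lambda>\<omega>. X (enn2real (?T \<omega>)) \<omega>) \<in> borel_measurable (completion M)"
    by (rule completion.borel_measurable_cong_AE[OF S.embedded_measurable eq])
  moreover have "distr (completion M) borel (\<lambda>\<omega>. X (enn2real (?T \<omega>)) \<omega>) = distr (completion M) borel S.embedded"
    by (rule distr_cong_AE[OF refl refl _ meas S.embedded_measurable]) (use eq in eventually_elim, simp)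
  ultimately show ?thesis using S.distr_embedded by (simp add: Let_def)
qed

end
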